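(* Assume that $R\subseteq\mathbb{C}$ is an $L$-good subring and that property $\widetilde{\mathbf{P15}}$ holds (see the context for all notation). For each $\lambda\in\Lambda$ let $\rho^\lambda$ be a balanced representation afforded by $E^\lambda_\varepsilon$ whose leading matrix coefficients $\bar\rho^\lambda_{\mathfrak{s}\mathfrak{t}}(t_w)=c^{\mathfrak{s}\mathfrak{t}}_{w,\lambda}$ all lie in $\mathbb{Z}_W$, and let $B^\lambda=(\beta^\lambda_{\mathfrak{s}\mathfrak{t}})_{1\le \mathfrak{s},\mathfrak{t}\le d_\lambda}$ be a symmetric positive-definite matrix with entries in $\mathbb{Z}_W$ such that $B^\lambda\bar\rho^\lambda(t_{w^{-1}})=\bar\rho^\lambda(t_w)^{\mathrm{tr}}B^\lambda$ for all $w\in W$ and $\det(B^\lambda)$ is invertible in $R$. For $\lambda\in\Lambda$ put $M(\lambda)=\{1,\ldots,d_\lambda\}$, and for $\mathfrak{s},\mathfrak{t}\in M(\lambda)$ define $$C^\lambda_{\mathfrak{s},\mathfrak{t}}=\sum_{w\in W}\sum_{\mathfrak{u}\in M(\lambda)}\beta^\lambda_{\mathfrak{t}\mathfrak{u}}\,\bar\rho^\lambda_{\mathfrak{u}\mathfrak{s}}(t_{w^{-1}})\,\mathbf{C}_w .$$ Then $C^\lambda_{\mathfrak{s},\mathfrak{t}}$ is a $\mathbb{Z}_W$-linear combination of Kazhdan--Lusztig basis elements $\mathbf{C}_w$ with $w\in\mathcal{F}_\lambda$. Moreover, with the partial order $\trianglelefteq$ on $\Lambda$ described in the context, with $C(\mathfrak{s},\mathfrak{t})=C^\lambda_{\mathfrak{s},\mathfrak{t}}$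 for $\mathfrak{s},\mathfrak{t}\in M(\lambda)$, and with the $A$-linear anti-involution $*\colon\mathbf{H}\to\mathbf{H}$, $T_w^*=T_{w^{-1}}$ ($w\in W$), the quadruple $(\Lambda,M,C,* )$ is a cell datum for $\mathbf{H}$ in the sense of Graham--Lehrer.
   Context: Basic setting. $(W,S)$ is a Coxeter system with $W$ finite and length function $l$. $\Gamma$ is an abelian group (written additively) with a fixed monomial order, i.e. a total order $\leq$ such that $g\le g'$ implies $g+h\le g'+h$. $L\colon W\to\Gamma$ is a weight function, i.e. $L(ww')=L(w)+L(w')$ whenever $l(ww')=l(w)+l(w')$; assume $L(s)>0$ for all $s\in S$. Let $\mathbb{Z}_W=\mathbb{Z}[2\cos(2\pi/m_{st})\mid s,t\in S]$, $m_{st}$ the order of $st$. $R\subseteq\mathbb{C}$ is a subring containing $\mathbb{Z}_W$, with field of fractions $F$. $A=R[\Gamma]$ is the group ring with $R$-basis $\{\varepsilon^g\mid g\in\Gamma\}$, $\varepsilon^g\varepsilon^{g'}=\varepsilon^{g+g'}$; it is an integral domain with field of fractions $K$. $\mathbf{H}$ is the Iwahori--Hecke algebra: the associative $A$-algebra, free with basis $\{T_w\mid w\in W\}$ and identity $T_1$, such that for $s\in S$, $w\in W$: $T_sT_w=T_{sw}$ if $l(sw)>l(w)$ and $T_sT_w=T_{sw}+(v_s-v_s^{-1})T_w$ if $l(sw)<l(w)$, where $v_s=\varepsilon^{L(s)}$. Put $\mathbf{H}_K=K\otimes_A\mathbf{H}$. Representations. $F$ is a splitting field for $W$; $\{E^\lambda\mid\lambda\in\Lambda\}$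 are the irreducible $F[W]$-modules up to isomorphism, $d_\lambda=\dim E^\lambda$. $\mathbf{H}_K$ is split semisimple and its irreducible modules up to isomorphism are $E^\lambda_\varepsilon$ ($\lambda\in\Lambda$), determined by $\mathrm{trace}(w,E^\lambda)=\theta_1(\mathrm{trace}(T_w,E^\lambda_\varepsilon))$ for all $w\in W$, where $\theta_1\colon A\to R$ is the $R$-linear ring homomorphism with $\theta_1(\varepsilon^g)=1$ for all $g$. Define $0\ne\mathbf{c}_\lambda\in A$ by $\sum_{w}\mathrm{trace}(T_w,E^\lambda_\varepsilon)\,\mathrm{trace}(T_{w^{-1}},E^\lambda_\varepsilon)=d_\lambda\mathbf{c}_\lambda$; one can write $\mathbf{c}_\lambda=f_\lambda\varepsilon^{-2\mathbf{a}_\lambda}+$ (combination of $\varepsilon^g$ with $g>-2\mathbf{a}_\lambda$), where $\mathbf{a}_\lambda\in\Gamma$, $\mathbf{a}_\lambda\ge0$, and $f_\lambda$ is a positive real number. $R$ is called $L$-good if $\mathbb{Z}_W\subseteq R$ and every $f_\lambda$ lies in $R$ and is invertible in $R$. Balanced representations. Let $F[\Gamma_{>0}]$ be the set of $F$-linear combinations of $\varepsilon^g$ with $g>0$. Each $0\ne x\in K$ can be written $x=r_x\varepsilon^{g_x}\frac{1+p}{1+q}$ with $p,q\in F[\Gamma_{>0}]$ and unique $0\neq r_x\in F$, $g_x\in\Gamma$; set $g_0=+\infty$. $\mathcal{O}=\{x\in K\mid g_x\ge0\}$ is a valuation ring with maximal ideal $\mathfrak{p}=\{x\mid g_x>0\}$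 and residue field $F$; the constant term of $x\in\mathcal{O}$ is its image in $F$ ($r_x$ if $g_x=0$, and $0$ if $x\in\mathfrak{p}$). A matrix representation $\rho^\lambda\colon\mathbf{H}_K\to M_{d_\lambda}(K)$ afforded by $E^\lambda_\varepsilon$ is balanced if $\varepsilon^{\mathbf{a}_\lambda}\rho^\lambda_{ij}(T_w)\in\mathcal{O}$ for all $w,i,j$; its leading matrix coefficient $c^{ij}_{w,\lambda}\in F$ is the constant term of $(-1)^{l(w)}\varepsilon^{\mathbf{a}_\lambda}\rho^\lambda_{ij}(T_w)$. Write $\bar\rho^\lambda(t_w)=(c^{ij}_{w,\lambda})_{i,j}$. Balanced representations exist for all $\lambda$; when $R$ is $L$-good, data $\rho^\lambda$, $B^\lambda$ as in the claim exist for all $\lambda$. Put $$\tilde\gamma_{x,y,z}=\sum_{\lambda\in\Lambda}\sum_{1\le i,j,k\le d_\lambda}f_\lambda^{-1}c^{ij}_{x,\lambda}c^{jk}_{y,\lambda}c^{ki}_{z,\lambda},$$ which does not depend on the choice of balanced representations. Kazhdan--Lusztig basis. Let $a\mapsto\bar a$ be the $R$-linear ring involution of $A$ with $\overline{\varepsilon^g}=\varepsilon^{-g}$, extended to the ring involution of $\mathbf{H}$ given by $\overline{\sum a_wT_w}=\sum\bar a_wT_{w^{-1}}^{-1}$. For $w\in W$, $\mathbf{C}_w$ is the unique element with $\overline{\mathbf{C}_w}=\mathbf{C}_w$ and $\mathbf{C}_w\in(-1)^{l(w)}T_w+\sum_{y\in W}\mathbb{Z}[\Gamma_{>0}]T_y$,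 where $\mathbb{Z}[\Gamma_{>0}]$ is the set of integral combinations of $\varepsilon^g$, $g>0$. These form an $A$-basis of $\mathbf{H}$; write $\mathbf{C}_x\mathbf{C}_y=\sum_zh_{x,y,z}\mathbf{C}_z$. The preorder $\leq_{\mathcal{LR}}$ on $W$ is the reflexive and transitive closure of the relation "$\mathbf{C}_y$ occurs with non-zero coefficient in $\mathbf{C}_x\mathbf{C}_w$ or $\mathbf{C}_w\mathbf{C}_x$ for some $x\in W$" (then $y\leq_{\mathcal{LR}}w$); $\sim_{\mathcal{LR}}$ is the associated equivalence relation, whose classes are the two-sided cells. Property $\widetilde{\mathbf{P15}}$: if $x,x',y,w\in W$ satisfy $w\sim_{\mathcal{LR}}y$, then $\sum_{u\in W}\tilde\gamma_{w,x',u^{-1}}h_{x,u,y}=\sum_{u\in W}h_{x,w,u}\tilde\gamma_{u,x',y^{-1}}$. $L$-blocks and the partial order. Consider the graph with vertex set $W$ in which $x\ne y$ are joined by an edge if for some $\lambda\in\Lambda$ both $\bar\rho^\lambda(t_x)\ne0$ and $\bar\rho^\lambda(t_y)\ne0$ (this does not depend on the choice of balanced representations). The connected components are the $L$-blocks of $W$; each $L$-block is contained in a two-sided cell. For $\lambda\in\Lambda$, $\mathcal{F}_\lambda$ denotes the unique $L$-block containing some $w$ with $\bar\rho^\lambda(t_w)\neq0$. For $\lambda,\mu\in\Lambda$ and any $x\in\mathcal{F}_\lambda$, $y\in\mathcal{F}_\mu$, define $\lambda\trianglelefteq\mu$ if $\lambda=\mu$, or $x\leq_{\mathcal{LR}}y$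 and $x\not\sim_{\mathcal{LR}}y$ (independent of the choice of $x,y$). Cell datum (Graham--Lehrer). A quadruple $(\Lambda,M,C,* )$ is a cell datum for $\mathbf{H}$ if: (C1) $\Lambda$ is a partially ordered set, $\{M(\lambda)\}_{\lambda\in\Lambda}$ are finite sets, and $C\colon\coprod_{\lambda}M(\lambda)\times M(\lambda)\to\mathbf{H}$ is injective with image an $A$-basis of $\mathbf{H}$; (C2) writing $C(\mathfrak{s},\mathfrak{t})=C^\lambda_{\mathfrak{s},\mathfrak{t}}$, the map $*\colon\mathbf{H}\to\mathbf{H}$ is an $A$-linear anti-involution with $(C^\lambda_{\mathfrak{s},\mathfrak{t}})^*=C^\lambda_{\mathfrak{t},\mathfrak{s}}$; (C3) for $\lambda\in\Lambda$, $\mathfrak{s},\mathfrak{t}\in M(\lambda)$ and $h\in\mathbf{H}$, $hC^\lambda_{\mathfrak{s},\mathfrak{t}}\equiv\sum_{\mathfrak{s}'\in M(\lambda)}r_h(\mathfrak{s}',\mathfrak{s})C^\lambda_{\mathfrak{s}',\mathfrak{t}}$ modulo $\mathbf{H}(\triangleleft\lambda)$, where $r_h(\mathfrak{s}',\mathfrak{s})\in A$ is independent of $\mathfrak{t}$ and $\mathbf{H}(\triangleleft\lambda)$ is the $A$-span of all $C^\mu_{\mathfrak{s}'',\mathfrak{t}''}$ with $\mu\trianglelefteq\lambda$, $\mu\ne\lambda$, $\mathfrak{s}'',\mathfrak{t}''\in M(\mu)$. *)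

theory Defs
  imports
    Complex_Main
    "HOL-Algebra.Multiplicative_Group"
    "HOL-Algebra.Generated_Groups"
    "HOL-Library.Poly_Mapping"
    "HOL-Computational_Algebra.Fraction_Field"
    "HOL-Computational_Algebra.Polynomial_Factorial"
    "Jordan_Normal_Form.Determinant"
begin

section \<open>Coxeter systems\<close>

definition word_val :: "('w, 'x) monoid_scheme \<Rightarrow> 'w list \<Rightarrow> 'w" where
  "word_val G u = foldr (\<lambda>x y. x \<otimes>\<^bsub>G\<^esub> y) u \<one>\<^bsub>G\<^esub>"

text \<open>Deletion of one relator $(st)^{m_{st}}$ in a word over $S$. For $s = t$ this deletes
  $ss$, so words modulo the generated equivalence form the group presented by
  $(st)^{m_{st}} = 1$; if $st$ has infinite order, then \<open>group.ord\<close> is $0$ and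
  there is no relation.\<close>

inductive coxeter_step :: "('w, 'x) monoid_scheme \<Rightarrow> 'w set \<Rightarrow> 'w list \<Rightarrow> 'w list \<Rightarrow> bool"
  for G S where
  "\<lbrakk>set u \<subseteq> S; set v \<subseteq> S; s \<in> S; t \<in> S\<rbrakk> \<Longrightarrow>
     coxeter_step G S (u @ concat (replicate (group.ord G (s \<otimes>\<^bsub>G\<^esub> t)) [s, t]) @ v) (u @ v)"

definition coxeter_system :: "('w, 'x) monoid_scheme \<Rightarrow> 'w set \<Rightarrow> bool" where
  "coxeter_system G S \<longleftrightarrow>
     group G \<and> S \<subseteq> carrier G \<and> generate G S = carrier G \<and>
     (\<forall>s\<in>S. s \<noteq> \<one>\<^bsub>G\<^esub> \<and> s \<otimes>\<^bsub>G\<^esub> s = \<one>\<^bsub>G\<^esub>) \<and>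
     (\<forall>u\<in>lists S. \<forall>v\<in>lists S. word_val G u = word_val G v \<longrightarrow> equivclp (coxeter_step G S) u v)"

definition cox_length :: "('w, 'x) monoid_scheme \<Rightarrow> 'w set \<Rightarrow> 'w \<Rightarrow> nat" where
  "cox_length G S w = (LEAST n. \<exists>u\<in>lists S. length u = n \<and> word_val G u = w)"

section \<open>Coefficient rings\<close>

definition is_subring :: "'a::ring_1 set \<Rightarrow> bool" where
  "is_subring R \<longleftrightarrow> 1 \<in> R \<and> (\<forall>x\<in>R. \<forall>y\<in>R. x - y \<in> R \<and> x * y \<in> R)"

definition fraction_subfield :: "'a::field set \<Rightarrow> 'a set" where
  "fraction_subfield R = {a / b | a b. a \<in> R \<and> b \<in> R \<and> b \<noteq> 0}"

definition ZW :: "('w, 'x) monoid_scheme \<Rightarrow> 'w set \<Rightarrow> complex set" where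
  "ZW G S = is_subring hull
     {complex_of_real (2 * cos (2 * pi / real (group.ord G (s \<otimes>\<^bsub>G\<^esub> t)))) | s t. s \<in> S \<and> t \<in> S}"

text \<open>The group ring $R[\Gamma]$ is the subring of \<open>'g \<Rightarrow>\<^sub>0 complex\<close> (with convolution product)
  of elements with coefficients in $R$, and its field of fractions $K$ is formed inside
  \<open>('g \<Rightarrow>\<^sub>0 complex) fract\<close>.\<close>

definition group_ring :: "complex set \<Rightarrow> ('g \<Rightarrow>\<^sub>0 complex) set" where
  "group_ring R = {a. \<forall>g. poly_mapping.lookup a g \<in> R}"

abbreviation eps :: "'g \<Rightarrow> 'g \<Rightarrow>\<^sub>0 complex" where
  "eps g \<equiv> Poly_Mapping.single g 1"

definition group_ring_pos :: "complex set \<Rightarrow> ('g::linordered_ab_group_add \<Rightarrow>\<^sub>0 complex) set" where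
  "group_ring_pos R = {p \<in> group_ring R. \<forall>g\<in>Poly_Mapping.keys p. 0 < g}"

definition theta1 :: "('g \<Rightarrow>\<^sub>0 complex) \<Rightarrow> complex" where
  "theta1 a = (\<Sum>g\<in>Poly_Mapping.keys a. poly_mapping.lookup a g)"

definition ring_bar :: "('g::linordered_ab_group_add \<Rightarrow>\<^sub>0 complex) \<Rightarrow> 'g \<Rightarrow>\<^sub>0 complex" where
  "ring_bar a = (\<Sum>g\<in>Poly_Mapping.keys a. Poly_Mapping.single (- g) (poly_mapping.lookup a g))"

definition fraction_field :: "complex set \<Rightarrow> ('g::linordered_ab_group_add \<Rightarrow>\<^sub>0 complex) fract set" where
  "fraction_field R = {Fract a b | a b. a \<in> group_ring R \<and> b \<in> group_ring R \<and> b \<noteq> 0}"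

text \<open>\<open>has_leading F x r g\<close>: $x = r \varepsilon^g (1+p)/(1+q)$, i.e. $r_x = r \neq 0$ and $g_x = g$.\<close>

definition has_leading ::
    "complex set \<Rightarrow> ('g::linordered_ab_group_add \<Rightarrow>\<^sub>0 complex) fract \<Rightarrow> complex \<Rightarrow> 'g \<Rightarrow> bool" where
  "has_leading F x r g \<longleftrightarrow> r \<in> F \<and> r \<noteq> 0 \<and>
     (\<exists>p\<in>group_ring_pos F. \<exists>q\<in>group_ring_pos F.
        x = Fract (Poly_Mapping.single g r * (1 + p)) (1 + q))"

definition valuation_ring ::
    "complex set \<Rightarrow> ('g::linordered_ab_group_add \<Rightarrow>\<^sub>0 complex) fract set" where
  "valuation_ring R = {x \<in> fraction_field R.
     x = 0 \<or> (\<exists>r g. has_leading (fraction_subfield R) x r g \<and> 0 \<le> g)}"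

definition constant_term ::
    "complex set \<Rightarrow> ('g::linordered_ab_group_add \<Rightarrow>\<^sub>0 complex) fract \<Rightarrow> complex" where
  "constant_term R x =
     (if \<exists>r. has_leading (fraction_subfield R) x r 0
      then THE r. has_leading (fraction_subfield R) x r 0 else 0)"

section \<open>Iwahori--Hecke algebras\<close>

text \<open>An element of the free module with basis $T_w$ is its finitely supported coefficient
  function. The product of $\mathbf{H}$ is part of the data; \<open>hecke_setting\<close> below
  characterises it.\<close>

type_synonym ('w, 'g) hecke_elt = "'w \<Rightarrow>\<^sub>0 ('g \<Rightarrow>\<^sub>0 complex)"

record ('w, 'g) hecke_data = "'w monoid" +
  gens :: "'w set"
  wt :: "'w \<Rightarrow> 'g"
  coeffs :: "complex set"
  hmult :: "('w, 'g) hecke_elt \<Rightarrow> ('w, 'g) hecke_elt \<Rightarrow> ('w, 'g) hecke_elt"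

abbreviation len :: "('w, 'g) hecke_data \<Rightarrow> 'w \<Rightarrow> nat" where
  "len H \<equiv> cox_length H (gens H)"

abbreviation ZWof :: "('w, 'g) hecke_data \<Rightarrow> complex set" where
  "ZWof H \<equiv> ZW H (gens H)"

abbreviation baseF :: "('w, 'g) hecke_data \<Rightarrow> complex set" where
  "baseF H \<equiv> fraction_subfield (coeffs H)"

abbreviation ringA :: "('w, 'g) hecke_data \<Rightarrow> ('g \<Rightarrow>\<^sub>0 complex) set" where
  "ringA H \<equiv> group_ring (coeffs H)"

abbreviation fieldK ::
    "('w, 'g::linordered_ab_group_add) hecke_data \<Rightarrow> ('g \<Rightarrow>\<^sub>0 complex) fract set" where
  "fieldK H \<equiv> fraction_field (coeffs H)"

abbreviation hT :: "'w \<Rightarrow> ('w, 'g::zero) hecke_elt" where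
  "hT w \<equiv> Poly_Mapping.single w 1"

definition smul ::
    "('g::linordered_ab_group_add \<Rightarrow>\<^sub>0 complex) \<Rightarrow> ('w, 'g) hecke_elt \<Rightarrow> ('w, 'g) hecke_elt" where
  "smul a h = Poly_Mapping.map ((*) a) h"

definition hecke_space :: "('w, 'g) hecke_data \<Rightarrow> ('w, 'g) hecke_elt set" where
  "hecke_space H = {h. Poly_Mapping.keys h \<subseteq> carrier H \<and> (\<forall>w. poly_mapping.lookup h w \<in> ringA H)}"

definition is_hecke_product :: "('w, 'g::linordered_ab_group_add) hecke_data \<Rightarrow> bool" where
  "is_hecke_product H \<longleftrightarrow>
     (\<forall>x\<in>hecke_space H. \<forall>y\<in>hecke_space H. hmult H x y \<in> hecke_space H) \<and>
     (\<forall>x\<in>hecke_space H. \<forall>y\<in>hecke_space H. \<forall>z\<in>hecke_space H.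
        hmult H (x + y) z = hmult H x z + hmult H y z \<and>
        hmult H x (y + z) = hmult H x y + hmult H x z \<and>
        hmult H (hmult H x y) z = hmult H x (hmult H y z)) \<and>
     (\<forall>a\<in>ringA H. \<forall>x\<in>hecke_space H. \<forall>y\<in>hecke_space H.
        hmult H (smul a x) y = smul a (hmult H x y) \<and>
        hmult H x (smul a y) = smul a (hmult H x y)) \<and>
     (\<forall>x\<in>hecke_space H. hmult H (hT \<one>\<^bsub>H\<^esub>) x = x \<and> hmult H x (hT \<one>\<^bsub>H\<^esub>) = x) \<and>
     (\<forall>s\<in>gens H. \<forall>w\<in>carrier H.
        (len H w < len H (s \<otimes>\<^bsub>H\<^esub> w) \<longrightarrow> hmult H (hT s) (hT w) = hT (s \<otimes>\<^bsub>H\<^esub> w)) \<and>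
        (len H (s \<otimes>\<^bsub>H\<^esub> w) < len H w \<longrightarrow>
           hmult H (hT s) (hT w) =
             hT (s \<otimes>\<^bsub>H\<^esub> w) + smul (eps (wt H s) - eps (- wt H s)) (hT w)))"

definition hecke_setting :: "('w, 'g::linordered_ab_group_add) hecke_data \<Rightarrow> bool" where
  "hecke_setting H \<longleftrightarrow>
     coxeter_system H (gens H) \<and> finite (carrier H) \<and>
     (\<forall>w\<in>carrier H. \<forall>w'\<in>carrier H.
        len H (w \<otimes>\<^bsub>H\<^esub> w') = len H w + len H w' \<longrightarrow>
        wt H (w \<otimes>\<^bsub>H\<^esub> w') = wt H w + wt H w') \<and>
     (\<forall>s\<in>gens H. 0 < wt H s) \<and>
     is_subring (coeffs H) \<and> ZWof H \<subseteq> coeffs H \<and>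
     is_hecke_product H"

definition hecke_inverse ::
    "('w, 'g::linordered_ab_group_add) hecke_data \<Rightarrow> ('w, 'g) hecke_elt \<Rightarrow> ('w, 'g) hecke_elt" where
  "hecke_inverse H x =
     (THE y. y \<in> hecke_space H \<and> hmult H x y = hT \<one>\<^bsub>H\<^esub> \<and> hmult H y x = hT \<one>\<^bsub>H\<^esub>)"

definition hecke_bar ::
    "('w, 'g::linordered_ab_group_add) hecke_data \<Rightarrow> ('w, 'g) hecke_elt \<Rightarrow> ('w, 'g) hecke_elt" where
  "hecke_bar H h =
     (\<Sum>w\<in>carrier H. smul (ring_bar (poly_mapping.lookup h w)) (hecke_inverse H (hT (inv\<^bsub>H\<^esub> w))))"

definition hecke_star ::
    "('w, 'g::linordered_ab_group_add) hecke_data \<Rightarrow> ('w, 'g) hecke_elt \<Rightarrow> ('w, 'g) hecke_elt" where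
  "hecke_star H h = (\<Sum>w\<in>carrier H. smul (poly_mapping.lookup h w) (hT (inv\<^bsub>H\<^esub> w)))"

section \<open>The Kazhdan--Lusztig basis and the two-sided preorder\<close>

definition kl_basis ::
    "('w, 'g::linordered_ab_group_add) hecke_data \<Rightarrow> 'w \<Rightarrow> ('w, 'g) hecke_elt" where
  "kl_basis H w = (THE c. c \<in> hecke_space H \<and> hecke_bar H c = c \<and>
     (\<exists>p. (\<forall>y\<in>carrier H. p y \<in> group_ring_pos \<int>) \<and>
          c = smul ((- 1) ^ len H w) (hT w) + (\<Sum>y\<in>carrier H. smul (p y) (hT y))))"

definition kl_coords ::
    "('w, 'g::linordered_ab_group_add) hecke_data \<Rightarrow> ('w, 'g) hecke_elt \<Rightarrow> ('w, 'g) hecke_elt" where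
  "kl_coords H h =
     (THE c. c \<in> hecke_space H \<and> h = (\<Sum>z\<in>carrier H. smul (poly_mapping.lookup c z) (kl_basis H z)))"

definition hcoef ::
    "('w, 'g::linordered_ab_group_add) hecke_data \<Rightarrow> 'w \<Rightarrow> 'w \<Rightarrow> 'w \<Rightarrow> 'g \<Rightarrow>\<^sub>0 complex" where
  "hcoef H x y z = poly_mapping.lookup (kl_coords H (hmult H (kl_basis H x) (kl_basis H y))) z"

definition lr_step :: "('w, 'g::linordered_ab_group_add) hecke_data \<Rightarrow> 'w \<Rightarrow> 'w \<Rightarrow> bool" where
  "lr_step H y w \<longleftrightarrow> y \<in> carrier H \<and> w \<in> carrier H \<and>
     (\<exists>x\<in>carrier H. hcoef H x w y \<noteq> 0 \<or> hcoef H w x y \<noteq> 0)"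

definition lr_le :: "('w, 'g::linordered_ab_group_add) hecke_data \<Rightarrow> 'w \<Rightarrow> 'w \<Rightarrow> bool" where
  "lr_le H = (lr_step H)\<^sup>*\<^sup>*"

definition lr_equiv :: "('w, 'g::linordered_ab_group_add) hecke_data \<Rightarrow> 'w \<Rightarrow> 'w \<Rightarrow> bool" where
  "lr_equiv H x y \<longleftrightarrow> lr_le H x y \<and> lr_le H y x"

section \<open>Matrix representations\<close>

text \<open>Matrix indices are $0, \dots, d-1$.\<close>

definition mtrace :: "'a::comm_monoid_add mat \<Rightarrow> 'a" where
  "mtrace A = (\<Sum>i<dim_row A. A $$ (i, i))"

definition mats_over :: "'a set \<Rightarrow> nat \<Rightarrow> 'a mat set" where
  "mats_over k d = {A \<in> carrier_mat d d. elements_mat A \<subseteq> k}"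

definition vecs_over :: "'a set \<Rightarrow> nat \<Rightarrow> 'a vec set" where
  "vecs_over k d = {v \<in> carrier_vec d. \<forall>i<d. v $ i \<in> k}"

definition irreducible_mats :: "'k::field set \<Rightarrow> nat \<Rightarrow> 'w set \<Rightarrow> ('w \<Rightarrow> 'k mat) \<Rightarrow> bool" where
  "irreducible_mats k d X \<rho> \<longleftrightarrow> 0 < d \<and>
     (\<forall>V. V \<subseteq> vecs_over k d \<and> 0\<^sub>v d \<in> V \<and> (\<forall>u\<in>V. \<forall>v\<in>V. u + v \<in> V) \<and>
          (\<forall>c\<in>k. \<forall>v\<in>V. c \<cdot>\<^sub>v v \<in> V) \<and> (\<forall>x\<in>X. \<forall>v\<in>V. \<rho> x *\<^sub>v v \<in> V)
        \<longrightarrow> V = {0\<^sub>v d} \<or> V = vecs_over k d)"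

definition group_mrep ::
    "('w, 'g) hecke_data \<Rightarrow> nat \<Rightarrow> ('w \<Rightarrow> complex mat) \<Rightarrow> bool" where
  "group_mrep H d E \<longleftrightarrow>
     (\<forall>w\<in>carrier H. E w \<in> mats_over (baseF H) d) \<and> E \<one>\<^bsub>H\<^esub> = 1\<^sub>m d \<and>
     (\<forall>x\<in>carrier H. \<forall>y\<in>carrier H. E (x \<otimes>\<^bsub>H\<^esub> y) = E x * E y)"

definition group_irrep ::
    "('w, 'g) hecke_data \<Rightarrow> nat \<Rightarrow> ('w \<Rightarrow> complex mat) \<Rightarrow> bool" where
  "group_irrep H d E \<longleftrightarrow> group_mrep H d E \<and> irreducible_mats (baseF H) d (carrier H) E"

definition group_rep_equiv ::
    "('w, 'g) hecke_data \<Rightarrow> nat \<Rightarrow> ('w \<Rightarrow> complex mat) \<Rightarrow> nat \<Rightarrow> ('w \<Rightarrow> complex mat) \<Rightarrow> bool" where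
  "group_rep_equiv H d E d' E' \<longleftrightarrow> d = d' \<and>
     (\<exists>P\<in>mats_over (baseF H) d. det P \<noteq> 0 \<and> (\<forall>w\<in>carrier H. P * E w = E' w * P))"

definition irreps_indexed_by ::
    "('w, 'g) hecke_data \<Rightarrow> 'l set \<Rightarrow> ('l \<Rightarrow> nat) \<Rightarrow> ('l \<Rightarrow> 'w \<Rightarrow> complex mat) \<Rightarrow> bool" where
  "irreps_indexed_by H \<Lambda> d E \<longleftrightarrow> finite \<Lambda> \<and>
     (\<forall>\<mu>\<in>\<Lambda>. group_irrep H (d \<mu>) (E \<mu>)) \<and>
     (\<forall>\<mu>\<in>\<Lambda>. \<forall>\<nu>\<in>\<Lambda>. group_rep_equiv H (d \<mu>) (E \<mu>) (d \<nu>) (E \<nu>) \<longrightarrow> \<mu> = \<nu>) \<and>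
     (\<forall>n E'. group_irrep H n E' \<longrightarrow> (\<exists>\<mu>\<in>\<Lambda>. group_rep_equiv H n E' (d \<mu>) (E \<mu>)))"

text \<open>Every irreducible $F[W]$-module has endomorphism ring $F$.\<close>

definition splitting_field :: "('w, 'g) hecke_data \<Rightarrow> bool" where
  "splitting_field H \<longleftrightarrow>
     (\<forall>d E. group_irrep H d E \<longrightarrow>
        (\<forall>P\<in>mats_over (baseF H) d. (\<forall>w\<in>carrier H. P * E w = E w * P) \<longrightarrow>
           (\<exists>c\<in>baseF H. P = c \<cdot>\<^sub>m 1\<^sub>m d)))"

text \<open>A matrix representation of $\mathbf{H}_K$ is recorded by the matrices of the $K$-basis
  $T_w$, on which it has to respect the structure constants.\<close>

definition hecke_mrep ::
    "('w, 'g::linordered_ab_group_add) hecke_data \<Rightarrow> nat \<Rightarrow> ('w \<Rightarrow> ('g \<Rightarrow>\<^sub>0 complex) fract mat) \<Rightarrow> bool"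
  where
  "hecke_mrep H d \<rho> \<longleftrightarrow>
     (\<forall>w\<in>carrier H. \<rho> w \<in> mats_over (fieldK H) d) \<and> \<rho> \<one>\<^bsub>H\<^esub> = 1\<^sub>m d \<and>
     (\<forall>x\<in>carrier H. \<forall>y\<in>carrier H.
        \<rho> x * \<rho> y = mat d d (\<lambda>ij. \<Sum>z\<in>carrier H.
          to_fract (poly_mapping.lookup (hmult H (hT x) (hT y)) z) * \<rho> z $$ ij))"

text \<open>\<open>\<rho>\<close> is afforded by the irreducible $\mathbf{H}_K$-module whose character
  specialises to that of \<open>E\<close>.\<close>

definition afforded_by_specialisation ::
    "('w, 'g::linordered_ab_group_add) hecke_data \<Rightarrow> nat \<Rightarrow> ('w \<Rightarrow> complex mat) \<Rightarrow>
     ('w \<Rightarrow> ('g \<Rightarrow>\<^sub>0 complex) fract mat) \<Rightarrow> bool" where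
  "afforded_by_specialisation H d E \<rho> \<longleftrightarrow>
     hecke_mrep H d \<rho> \<and> irreducible_mats (fieldK H) d (carrier H) \<rho> \<and>
     (\<forall>w\<in>carrier H. \<exists>t\<in>ringA H. mtrace (\<rho> w) = to_fract t \<and> mtrace (E w) = theta1 t)"

text \<open>\<open>a\<close> and \<open>f\<close> are read off from the lowest term of the Schur element \<open>c\<close>; they are
  unique, since \<open>'g\<close> has no torsion.\<close>

definition schur_invariants ::
    "('w, 'g::linordered_ab_group_add) hecke_data \<Rightarrow> nat \<Rightarrow>
     ('w \<Rightarrow> ('g \<Rightarrow>\<^sub>0 complex) fract mat) \<Rightarrow> 'g \<Rightarrow> real \<Rightarrow> bool" where
  "schur_invariants H d \<rho> a f \<longleftrightarrow> 0 \<le> a \<and> 0 < f \<and>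
     (\<exists>c\<in>ringA H.
        (\<Sum>w\<in>carrier H. mtrace (\<rho> w) * mtrace (\<rho> (inv\<^bsub>H\<^esub> w))) = of_nat d * to_fract c \<and>
        (\<exists>p. (\<forall>g\<in>Poly_Mapping.keys p. - (a + a) < g) \<and>
             c = Poly_Mapping.single (- (a + a)) (complex_of_real f) + p))"

definition L_good :: "('w, 'g) hecke_data \<Rightarrow> 'l set \<Rightarrow> ('l \<Rightarrow> real) \<Rightarrow> bool" where
  "L_good H \<Lambda> f \<longleftrightarrow> ZWof H \<subseteq> coeffs H \<and>
     (\<forall>\<mu>\<in>\<Lambda>. complex_of_real (f \<mu>) \<in> coeffs H \<and>
            inverse (complex_of_real (f \<mu>)) \<in> coeffs H)"

definition balanced ::
    "('w, 'g::linordered_ab_group_add) hecke_data \<Rightarrow> nat \<Rightarrow> 'g \<Rightarrow>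
     ('w \<Rightarrow> ('g \<Rightarrow>\<^sub>0 complex) fract mat) \<Rightarrow> bool" where
  "balanced H d a \<rho> \<longleftrightarrow>
     (\<forall>w\<in>carrier H. \<forall>i<d. \<forall>j<d. to_fract (eps a) * \<rho> w $$ (i, j) \<in> valuation_ring (coeffs H))"

definition leading_matrix ::
    "('w, 'g::linordered_ab_group_add) hecke_data \<Rightarrow> nat \<Rightarrow> 'g \<Rightarrow>
     ('w \<Rightarrow> ('g \<Rightarrow>\<^sub>0 complex) fract mat) \<Rightarrow> 'w \<Rightarrow> complex mat" where
  "leading_matrix H d a \<rho> w =
     mat d d (\<lambda>ij. constant_term (coeffs H) ((- 1) ^ len H w * to_fract (eps a) * \<rho> w $$ ij))"

section \<open>Leading coefficients: the constants of the asymptotic ring, blocks, partial order\<close>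

text \<open>From here on \<open>c \<mu> w\<close> stands for the matrix of leading coefficients $\bar\rho^\mu(t_w)$.\<close>

definition gamma_tilde ::
    "'l set \<Rightarrow> ('l \<Rightarrow> nat) \<Rightarrow> ('l \<Rightarrow> real) \<Rightarrow> ('l \<Rightarrow> 'w \<Rightarrow> complex mat) \<Rightarrow> 'w \<Rightarrow> 'w \<Rightarrow> 'w \<Rightarrow> complex"
  where
  "gamma_tilde \<Lambda> d f c x y z =
     (\<Sum>\<mu>\<in>\<Lambda>. \<Sum>i<d \<mu>. \<Sum>j<d \<mu>. \<Sum>k<d \<mu>.
        inverse (complex_of_real (f \<mu>)) * c \<mu> x $$ (i, j) * c \<mu> y $$ (j, k) * c \<mu> z $$ (k, i))"

definition P15_tilde ::
    "('w, 'g::linordered_ab_group_add) hecke_data \<Rightarrow> ('w \<Rightarrow> 'w \<Rightarrow> 'w \<Rightarrow> complex) \<Rightarrow> bool" where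
  "P15_tilde H \<gamma> \<longleftrightarrow>
     (\<forall>x\<in>carrier H. \<forall>x'\<in>carrier H. \<forall>y\<in>carrier H. \<forall>w\<in>carrier H. lr_equiv H w y \<longrightarrow>
        (\<Sum>u\<in>carrier H. Poly_Mapping.single 0 (\<gamma> w x' (inv\<^bsub>H\<^esub> u)) * hcoef H x u y) =
        (\<Sum>u\<in>carrier H. hcoef H x w u * Poly_Mapping.single 0 (\<gamma> u x' (inv\<^bsub>H\<^esub> y))))"

definition block_edge ::
    "('w, 'g) hecke_data \<Rightarrow> 'l set \<Rightarrow> ('l \<Rightarrow> nat) \<Rightarrow> ('l \<Rightarrow> 'w \<Rightarrow> complex mat) \<Rightarrow> 'w \<Rightarrow> 'w \<Rightarrow> bool"
  where
  "block_edge H \<Lambda> d c x y \<longleftrightarrow> x \<in> carrier H \<and> y \<in> carrier H \<and> x \<noteq> y \<and>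
     (\<exists>\<mu>\<in>\<Lambda>. c \<mu> x \<noteq> 0\<^sub>m (d \<mu>) (d \<mu>) \<and> c \<mu> y \<noteq> 0\<^sub>m (d \<mu>) (d \<mu>))"

definition L_blocks ::
    "('w, 'g) hecke_data \<Rightarrow> 'l set \<Rightarrow> ('l \<Rightarrow> nat) \<Rightarrow> ('l \<Rightarrow> 'w \<Rightarrow> complex mat) \<Rightarrow> 'w set set" where
  "L_blocks H \<Lambda> d c = {{y \<in> carrier H. (block_edge H \<Lambda> d c)\<^sup>*\<^sup>* x y} | x. x \<in> carrier H}"

definition block_of ::
    "('w, 'g) hecke_data \<Rightarrow> 'l set \<Rightarrow> ('l \<Rightarrow> nat) \<Rightarrow> ('l \<Rightarrow> 'w \<Rightarrow> complex mat) \<Rightarrow> 'l \<Rightarrow> 'w set" where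
  "block_of H \<Lambda> d c \<mu> =
     (THE X. X \<in> L_blocks H \<Lambda> d c \<and> (\<exists>w\<in>X. c \<mu> w \<noteq> 0\<^sub>m (d \<mu>) (d \<mu>)))"

text \<open>The condition does not depend on the choice of \<open>x\<close> and \<open>y\<close>, because a block is contained
  in one two-sided cell.\<close>

definition lambda_le ::
    "('w, 'g::linordered_ab_group_add) hecke_data \<Rightarrow> 'l set \<Rightarrow> ('l \<Rightarrow> nat) \<Rightarrow>
     ('l \<Rightarrow> 'w \<Rightarrow> complex mat) \<Rightarrow> 'l \<Rightarrow> 'l \<Rightarrow> bool" where
  "lambda_le H \<Lambda> d c \<mu> \<nu> \<longleftrightarrow> \<mu> = \<nu> \<or>
     (\<exists>x\<in>block_of H \<Lambda> d c \<mu>. \<exists>y\<in>block_of H \<Lambda> d c \<nu>. lr_le H x y \<and> \<not> lr_equiv H x y)"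

definition sym_pos_def :: "nat \<Rightarrow> complex mat \<Rightarrow> bool" where
  "sym_pos_def d B \<longleftrightarrow> B \<in> mats_over \<real> d \<and> transpose_mat B = B \<and>
     (\<forall>v\<in>carrier_vec d. v \<noteq> 0\<^sub>v d \<longrightarrow> 0 < v \<bullet> (map_mat Re B *\<^sub>v v))"

section \<open>Cell data\<close>

definition hspan ::
    "('w, 'g::linordered_ab_group_add) hecke_data \<Rightarrow> ('w, 'g) hecke_elt set \<Rightarrow> ('w, 'g) hecke_elt set"
  where
  "hspan H B = {\<Sum>b\<in>X. smul (r b) b | X r. finite X \<and> X \<subseteq> B \<and> (\<forall>b\<in>X. r b \<in> ringA H)}"

definition is_A_basis ::
    "('w, 'g::linordered_ab_group_add) hecke_data \<Rightarrow> ('w, 'g) hecke_elt set \<Rightarrow> bool" where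
  "is_A_basis H B \<longleftrightarrow> hspan H B = hecke_space H \<and>
     (\<forall>X r. finite X \<and> X \<subseteq> B \<and> (\<forall>b\<in>X. r b \<in> ringA H) \<and> (\<Sum>b\<in>X. smul (r b) b) = 0
        \<longrightarrow> (\<forall>b\<in>X. r b = 0))"

definition is_A_anti_involution ::
    "('w, 'g::linordered_ab_group_add) hecke_data \<Rightarrow> (('w, 'g) hecke_elt \<Rightarrow> ('w, 'g) hecke_elt) \<Rightarrow> bool"
  where
  "is_A_anti_involution H star \<longleftrightarrow>
     (\<forall>x\<in>hecke_space H. star x \<in> hecke_space H \<and> star (star x) = x) \<and>
     (\<forall>x\<in>hecke_space H. \<forall>y\<in>hecke_space H.
        star (x + y) = star x + star y \<and> star (hmult H x y) = hmult H (star y) (star x)) \<and>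
     (\<forall>a\<in>ringA H. \<forall>x\<in>hecke_space H. star (smul a x) = smul a (star x))"

definition cell_datum ::
    "('w, 'g::linordered_ab_group_add) hecke_data \<Rightarrow> 'l set \<Rightarrow> ('l \<Rightarrow> 'l \<Rightarrow> bool) \<Rightarrow> ('l \<Rightarrow> 'm set) \<Rightarrow>
     ('l \<Rightarrow> 'm \<Rightarrow> 'm \<Rightarrow> ('w, 'g) hecke_elt) \<Rightarrow> (('w, 'g) hecke_elt \<Rightarrow> ('w, 'g) hecke_elt) \<Rightarrow> bool"
  where
  "cell_datum H \<Lambda> below M C star \<longleftrightarrow>
     partial_order_on \<Lambda> {(\<mu>, \<nu>). \<mu> \<in> \<Lambda> \<and> \<nu> \<in> \<Lambda> \<and> below \<mu> \<nu>} \<and>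
     (\<forall>\<mu>\<in>\<Lambda>. finite (M \<mu>)) \<and>
     inj_on (\<lambda>(\<mu>, s, t). C \<mu> s t) (SIGMA \<mu>:\<Lambda>. M \<mu> \<times> M \<mu>) \<and>
     is_A_basis H ((\<lambda>(\<mu>, s, t). C \<mu> s t) ` (SIGMA \<mu>:\<Lambda>. M \<mu> \<times> M \<mu>)) \<and>
     is_A_anti_involution H star \<and>
     (\<forall>\<mu>\<in>\<Lambda>. \<forall>s\<in>M \<mu>. \<forall>t\<in>M \<mu>. star (C \<mu> s t) = C \<mu> t s) \<and>
     (\<forall>\<mu>\<in>\<Lambda>. \<forall>h\<in>hecke_space H. \<exists>r.
        (\<forall>s'\<in>M \<mu>. \<forall>s\<in>M \<mu>. r s' s \<in> ringA H) \<and>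
        (\<forall>s\<in>M \<mu>. \<forall>t\<in>M \<mu>.
           hmult H h (C \<mu> s t) - (\<Sum>s'\<in>M \<mu>. smul (r s' s) (C \<mu> s' t))
             \<in> hspan H {C \<nu> s'' t'' | \<nu> s'' t''.
                  \<nu> \<in> \<Lambda> \<and> below \<nu> \<mu> \<and> \<nu> \<noteq> \<mu> \<and> s'' \<in> M \<nu> \<and> t'' \<in> M \<nu>}))"

end

theory Submission
  imports Defs
begin

text \<open>
  The generic matrix coefficients \<open>\<rho> \<mu> w\<close> are linearly independent, because their trace
  form specialises to that of the group algebra. Hence they satisfy Schur relations, and taking
  lowest terms turns these into orthogonality relations for the leading coefficients \<open>c \<mu> w\<close>;
  as the number of matrix entries is the order of the group, both families of relations can be
  dualised. If \<open>c \<mu> x\<close> and \<open>c \<mu> w\<close> are nonzero, then so are \<open>\<rho> \<mu>\<close> at the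
  Kazhdan--Lusztig element of \<open>x\<close> and at the dual element of \<open>w\<close>, which forces \<open>w\<close> to
  lie below \<open>x\<close>; so blocks lie in two-sided cells. Orthogonality shows that the transition
  matrix from the Kazhdan--Lusztig basis to the elements \<open>C \<mu> s t\<close> is invertible over the
  coefficient ring. Finally, on the cell of \<open>\<mu>\<close> the matrix \<open>\<Sum>w. h\<^sub>x\<^sub>w\<^sub>y c \<mu> (w\<inverse>)\<close>
  factors as \<open>c \<mu> (y\<inverse>)\<close> times a matrix independent of \<open>y\<close>: this comes from
  averaging the relation P15 against leading coefficients, and it is the cell relation.
\<close>

section \<open>Matrices over index sets\<close>

lemma sum_delta_mult:
  fixes f :: "'a \<Rightarrow> 'b::semiring_1"
  assumes "finite X" "a \<in> X"
  shows "(\<Sum>x\<in>X. (if a = x then 1 else 0) * f x) = f a"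
    and "(\<Sum>x\<in>X. f x * (if x = a then 1 else 0)) = f a"
    and "(\<Sum>x\<in>X. (if x = a then 1 else 0) * f x) = f a"
    and "(\<Sum>x\<in>X. f x * (if a = x then 1 else 0)) = f a"
proof -
  have "(\<Sum>x\<in>X. (if a = x then 1 else 0) * f x) = (\<Sum>x\<in>X. if a = x then f x else 0)"
    by (rule sum.cong) auto
  then show 1: "(\<Sum>x\<in>X. (if a = x then 1 else 0) * f x) = f a"
    using assms by simp
  have "(\<Sum>x\<in>X. f x * (if x = a then 1 else 0)) = (\<Sum>x\<in>X. if a = x then f x else 0)"
    by (rule sum.cong) auto
  then show 2: "(\<Sum>x\<in>X. f x * (if x = a then 1 else 0)) = f a"
    using assms by simp
  show "(\<Sum>x\<in>X. (if x = a then 1 else 0) * f x) = f a"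
    "(\<Sum>x\<in>X. f x * (if a = x then 1 else 0)) = f a"
    using 1 2 by (simp_all add: eq_commute)
qed

lemma left_inverse_imp_right_inverse:
  fixes M :: "'x \<Rightarrow> 'y \<Rightarrow> 'k::field"
  assumes X: "finite X" and Y: "finite Y" and card: "card X = card Y"
    and MN: "\<And>x x'. x \<in> X \<Longrightarrow> x' \<in> X \<Longrightarrow> (\<Sum>y\<in>Y. M x y * N y x') = (if x = x' then 1 else 0)"
    and y: "y \<in> Y" "y' \<in> Y"
  shows "(\<Sum>x\<in>X. N y x * M x y') = (if y = y' then 1 else 0)"
proof -
  define n where "n = card X"
  obtain e where e: "bij_betw e {..<n} X"
    using X ex_bij_betw_nat_finite unfolding n_def atLeast0LessThan[symmetric] by blast
  obtain g where g: "bij_betw g {..<n} Y"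
    using Y ex_bij_betw_nat_finite unfolding n_def card atLeast0LessThan[symmetric] by blast
  define P where "P = mat n n (\<lambda>(i, j). M (e i) (g j))"
  define Q where "Q = mat n n (\<lambda>(i, j). N (g i) (e j))"
  have PQ: "P \<in> carrier_mat n n" "Q \<in> carrier_mat n n"
    unfolding P_def Q_def by simp_all
  have "P * Q = 1\<^sub>m n"
  proof (rule eq_matI)
    fix i j assume ij: "i < dim_row (1\<^sub>m n)" "j < dim_col (1\<^sub>m n :: 'k mat)"
    then have ex: "e i \<in> X" "e j \<in> X" "e i = e j \<longleftrightarrow> i = j"
      using e by (auto simp: bij_betw_def inj_on_def)
    have "(P * Q) $$ (i, j) = (\<Sum>k<n. M (e i) (g k) * N (g k) (e j))"
      using ij by (simp add: P_def Q_def scalar_prod_def atLeast0LessThan)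
    also have "\<dots> = (\<Sum>y\<in>Y. M (e i) y * N y (e j))"
      using sum.reindex_bij_betw[OF g] .
    finally show "(P * Q) $$ (i, j) = 1\<^sub>m n $$ (i, j)"
      using MN ex ij by simp
  qed (use PQ in auto)
  then have QP: "Q * P = 1\<^sub>m n"
    using PQ mat_mult_left_right_inverse by blast
  have "y \<in> g ` {..<n}" "y' \<in> g ` {..<n}"
    using y g by (simp_all add: bij_betw_def)
  then obtain i j where ij: "i < n" "j < n" "g i = y" "g j = y'"
    by auto
  then have gij: "i = j \<longleftrightarrow> y = y'"
    using g by (auto simp: bij_betw_def inj_on_def)
  have "(\<Sum>x\<in>X. N y x * M x y') = (\<Sum>k<n. N y (e k) * M (e k) y')"
    using sum.reindex_bij_betw[OF e, of "\<lambda>x. N y x * M x y'"] by simp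
  also have "\<dots> = (Q * P) $$ (i, j)"
    using ij by (simp add: P_def Q_def scalar_prod_def atLeast0LessThan)
  finally show ?thesis
    using QP ij gij by simp
qed

lemma inverse_matrices_card_eq:
  fixes M :: "'x \<Rightarrow> 'y \<Rightarrow> 'k::field_char_0"
  assumes "finite X" and "finite Y"
    and MN: "\<And>x. x \<in> X \<Longrightarrow> (\<Sum>y\<in>Y. M x y * N y x) = 1"
    and NM: "\<And>y. y \<in> Y \<Longrightarrow> (\<Sum>x\<in>X. N y x * M x y) = 1"
  shows "card X = card Y"
proof -
  have "of_nat (card X) = (\<Sum>x\<in>X. \<Sum>y\<in>Y. M x y * N y x)"
    using MN by simp
  also have "\<dots> = (\<Sum>y\<in>Y. \<Sum>x\<in>X. N y x * M x y)"
    by (subst sum.swap) (simp add: mult.commute)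
  also have "\<dots> = of_nat (card Y)"
    using NM by simp
  finally show ?thesis
    by (simp only: of_nat_eq_iff)
qed

lemma specialisation_imp_invertible:
  fixes G :: "'x \<Rightarrow> 'x \<Rightarrow> 'a::idom" and \<theta> :: "'a \<Rightarrow> 'b::idom"
  assumes X: "finite X" and \<theta>: "comm_ring_hom \<theta>" and c: "c \<noteq> 0"
    and G: "\<And>x y. x \<in> X \<Longrightarrow> y \<in> X \<Longrightarrow> \<theta> (G x y) = (if x = y then c else 0)"
  shows "\<exists>J :: 'x \<Rightarrow> 'x \<Rightarrow> 'a fract. \<forall>x\<in>X. \<forall>z\<in>X.
    (\<Sum>y\<in>X. to_fract (G x y) * J y z) = (if x = z then 1 else 0)"
proof -
  interpret \<theta>: comm_ring_hom \<theta> by fact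
  interpret tf: comm_ring_hom "to_fract :: 'a \<Rightarrow> 'a fract"
    by unfold_locales (simp_all add: to_fract_add to_fract_mult)
  define n where "n = card X"
  obtain e where e: "bij_betw e {..<n} X"
    using X ex_bij_betw_nat_finite unfolding n_def atLeast0LessThan[symmetric] by blast
  have exX: "e i \<in> X" if "i < n" for i
    using e that by (auto simp: bij_betw_def)
  have einj: "e i = e j \<longleftrightarrow> i = j" if "i < n" "j < n" for i j
    using e that by (auto simp: bij_betw_def inj_on_def)
  define P where "P = mat n n (\<lambda>(i, j). G (e i) (e j))"
  have P: "P \<in> carrier_mat n n" by (simp add: P_def)
  have "\<theta>.mat_hom P = c \<cdot>\<^sub>m 1\<^sub>m n"
    by (rule eq_matI) (auto simp: P_def G exX einj)
  then have "\<theta> (det P) = c ^ n"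
    by (metis \<theta>.hom_det det_one det_smult index_one_mat(2,3) mult.right_neutral)
  then have "det P \<noteq> 0"
    using c by auto
  then have "det (tf.mat_hom P) \<noteq> 0"
    by (metis tf.hom_det to_fract_eq_0_iff)
  then obtain Q where Q: "Q \<in> carrier_mat n n" "tf.mat_hom P * Q = 1\<^sub>m n"
    using det_non_zero_imp_unit[of "tf.mat_hom P" n] P
    by (auto simp: Units_def ring_mat_def)
  define u where "u = the_inv_into {..<n} e"
  have u: "u (e i) = i" if "i < n" for i
    unfolding u_def using e that by (simp add: bij_betw_def the_inv_into_f_f)
  define J where "J = (\<lambda>x z. Q $$ (u x, u z))"
  have "(\<Sum>y\<in>X. to_fract (G x y) * J y z) = (if x = z then 1 else 0)" if xz: "x \<in> X" "z \<in> X" for x z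
  proof -
    have "x \<in> e ` {..<n}" "z \<in> e ` {..<n}"
      using xz e by (simp_all add: bij_betw_def)
    then obtain i j where ij: "i < n" "j < n" "x = e i" "z = e j"
      by auto
    have "(\<Sum>y\<in>X. to_fract (G x y) * J y z) = (\<Sum>k<n. to_fract (G x (e k)) * J (e k) z)"
      using sum.reindex_bij_betw[OF e, of "\<lambda>y. to_fract (G x y) * J y z"] by simp
    also have "\<dots> = (tf.mat_hom P * Q) $$ (i, j)"
      using ij Q(1) by (simp add: P_def scalar_prod_def atLeast0LessThan J_def u)
    finally show ?thesis
      using Q(2) ij einj by simp
  qed
  then show ?thesis by blast
qed

section \<open>Coxeter groups\<close>

locale coxeter =
  fixes G :: "('w, 'x) monoid_scheme" (structure) and S :: "'w set"
  assumes coxeter_system: "coxeter_system G S"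
begin

abbreviation l :: "'w \<Rightarrow> nat" where "l \<equiv> cox_length G S"

lemma group_G: "group G"
  using coxeter_system by (simp add: coxeter_system_def)

sublocale group G by (rule group_G)

lemma S_carrier [simp]: "s \<in> S \<Longrightarrow> s \<in> carrier G"
  and S_square: "s \<in> S \<Longrightarrow> s \<otimes> s = \<one>"
  using coxeter_system by (auto simp: coxeter_system_def)

lemma S_inv: "s \<in> S \<Longrightarrow> inv s = s"
  using S_square inv_equality by simp

lemma S_cancel: "s \<in> S \<Longrightarrow> w \<in> carrier G \<Longrightarrow> s \<otimes> (s \<otimes> w) = w"
  by (metis S_carrier S_square l_one m_assoc)

lemma S_cancel_right: "s \<in> S \<Longrightarrow> w \<in> carrier G \<Longrightarrow> w \<otimes> s \<otimes> s = w"
  by (metis S_carrier S_square m_assoc r_one)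

lemma S_mult_eq_iff: "s \<in> S \<Longrightarrow> x \<in> carrier G \<Longrightarrow> y \<in> carrier G \<Longrightarrow> s \<otimes> x = y \<longleftrightarrow> x = s \<otimes> y"
  using S_cancel by auto

lemma word_val_Nil [simp]: "word_val G [] = \<one>"
  and word_val_Cons [simp]: "word_val G (s # u) = s \<otimes> word_val G u"
  by (simp_all add: word_val_def)

lemma word_val_closed [simp]: "u \<in> lists S \<Longrightarrow> word_val G u \<in> carrier G"
  by (induction u) auto

lemma word_val_append:
  "u \<in> lists S \<Longrightarrow> v \<in> lists S \<Longrightarrow> word_val G (u @ v) = word_val G u \<otimes> word_val G v"
  by (induction u) (auto simp: m_assoc)

lemma word_val_rev: "u \<in> lists S \<Longrightarrow> word_val G (rev u) = inv (word_val G u)"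
proof (induction u)
  case (Cons s u)
  then have "rev u \<in> lists S" "s \<in> S" "u \<in> lists S"
    by auto
  with Cons show ?case
    using word_val_append[of "rev u" "[s]"] by (simp add: inv_mult_group S_inv)
qed simp

lemma ex_word:
  assumes "w \<in> carrier G"
  shows "\<exists>u\<in>lists S. word_val G u = w"
proof -
  have "w \<in> generate G S"
    using assms coxeter_system by (simp add: coxeter_system_def)
  then show ?thesis
  proof (induction rule: generate.induct)
    case one
    then show ?case by (intro bexI[of _ "[]"]) auto
  next
    case (incl h)
    then show ?case by (intro bexI[of _ "[h]"]) auto
  next
    case (inv h)
    then show ?case by (intro bexI[of _ "[h]"]) (auto simp: S_inv)
  next
    case (eng h1 h2)
    then obtain u v where "u \<in> lists S" "v \<in> lists S" "word_val G u = h1" "word_val G v = h2"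
      by blast
    then show ?case
      by (intro bexI[of _ "u @ v"]) (auto simp: word_val_append)
  qed
qed

lemma reduced_word:
  assumes "w \<in> carrier G"
  obtains u where "u \<in> lists S" "length u = l w" "word_val G u = w"
proof -
  have "\<exists>n. \<exists>u\<in>lists S. length u = n \<and> word_val G u = w"
    using ex_word[OF assms] by blast
  then have "\<exists>u\<in>lists S. length u = l w \<and> word_val G u = w"
    unfolding cox_length_def by (rule LeastI_ex)
  then show thesis
    using that by blast
qed

lemma length_word_val_le: "u \<in> lists S \<Longrightarrow> l (word_val G u) \<le> length u"
  unfolding cox_length_def by (rule Least_le) blast

lemma coxeter_step_even: "coxeter_step G S u v \<Longrightarrow> even (length u) = even (length v)"
proof (induction rule: coxeter_step.induct)
  case (1 u v s t)
  have "length (concat (replicate n [s, t])) = 2 * n" for n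
    by (induction n) auto
  then show ?case by simp
qed

lemma even_length_word:
  assumes "u \<in> lists S" "v \<in> lists S" "word_val G u = word_val G v"
  shows "even (length u) = even (length v)"
proof -
  have "equivclp (coxeter_step G S) u v"
    using assms coxeter_system unfolding coxeter_system_def by blast
  then show ?thesis
  proof (induction rule: equivclp_induct)
    case (step y z)
    then show ?case
      using coxeter_step_even[of y z] coxeter_step_even[of z y] by argo
  qed simp
qed

lemma length_mult_le:
  assumes "s \<in> S" "w \<in> carrier G"
  shows "l (s \<otimes> w) \<le> l w + 1"
proof -
  obtain u where "u \<in> lists S" "length u = l w" "word_val G u = w"
    using reduced_word assms(2) by blast
  then show ?thesis
    using length_word_val_le[of "s # u"] assms by simp
qed

lemma length_mult_cases:
  assumes "s \<in> S" "w \<in> carrier G"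
  obtains "l (s \<otimes> w) = l w + 1" | "l w = l (s \<otimes> w) + 1"
proof -
  obtain u where u: "u \<in> lists S" "length u = l w" "word_val G u = w"
    using reduced_word assms(2) by blast
  obtain v where v: "v \<in> lists S" "length v = l (s \<otimes> w)" "word_val G v = s \<otimes> w"
    using reduced_word assms by (metis S_carrier m_closed)
  have "even (length (s # u)) = even (length v)"
    using even_length_word[of "s # u" v] u v assms by simp
  then have "even (l w) \<noteq> even (l (s \<otimes> w))"
    using u v by auto
  moreover have "l (s \<otimes> w) \<le> l w + 1" "l w \<le> l (s \<otimes> w) + 1"
    using length_mult_le[of s w] length_mult_le[of s "s \<otimes> w"] assms by (auto simp: S_cancel)
  ultimately show thesis
    using that by (metis Suc_eq_plus1 le_SucE le_antisym)
qed

lemma length_less_iff: "s \<in> S \<Longrightarrow> w \<in> carrier G \<Longrightarrow> \<not> l (s \<otimes> w) < l w \<longleftrightarrow> l w < l (s \<otimes> w)"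
  by (cases rule: length_mult_cases[of s w]) auto

lemma length_one [simp]: "l \<one> = 0"
  using length_word_val_le[of "[]"] by simp

lemma length_inv_le: "w \<in> carrier G \<Longrightarrow> l (inv w) \<le> l w"
proof -
  assume "w \<in> carrier G"
  then obtain u where u: "u \<in> lists S" "length u = l w" "word_val G u = w"
    using reduced_word by blast
  then have "word_val G (rev u) = inv w" "rev u \<in> lists S"
    by (auto simp: word_val_rev)
  then show ?thesis
    using length_word_val_le[of "rev u"] u by simp
qed

lemma length_inv [simp]: "w \<in> carrier G \<Longrightarrow> l (inv w) = l w"
  using length_inv_le[of w] length_inv_le[of "inv w"] by simp

lemma length_right: "s \<in> S \<Longrightarrow> w \<in> carrier G \<Longrightarrow> l (w \<otimes> s) = l (s \<otimes> inv w)"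
  by (metis S_carrier S_inv inv_closed inv_inv inv_mult_group length_inv m_closed)

lemma coxeter_induct [consumes 1, case_names one step]:
  assumes "w \<in> carrier G"
    and "P \<one>"
    and "\<And>s w. s \<in> S \<Longrightarrow> w \<in> carrier G \<Longrightarrow> l (s \<otimes> w) = l w + 1 \<Longrightarrow> P w \<Longrightarrow> P (s \<otimes> w)"
  shows "P w"
  using assms(1)
proof (induction "l w" arbitrary: w rule: less_induct)
  case less
  show ?case
  proof (cases "w = \<one>")
    case False
    obtain u where u: "u \<in> lists S" "length u = l w" "word_val G u = w"
      using reduced_word less.prems by blast
    then obtain s v where sv: "u = s # v"
      using False by (cases u) auto
    then have v: "s \<in> S" "v \<in> lists S" "w = s \<otimes> word_val G v" "l (word_val G v) < l w"
      using u length_word_val_le[of v] by auto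
    have "l (s \<otimes> word_val G v) = l (word_val G v) + 1"
      by (rule length_mult_cases[of s "word_val G v"]) (use v in auto)
    then show ?thesis
      using assms(3) less.hyps v by simp
  qed (use assms in simp)
qed

lemma length_gen_pos: "s \<in> S \<Longrightarrow> 0 < l s"
  by (rule length_mult_cases[of s \<one>]) auto

lemma ex_descent:
  "w \<in> carrier G \<Longrightarrow> w \<noteq> \<one> \<Longrightarrow> \<exists>s v. s \<in> S \<and> v \<in> carrier G \<and> w = s \<otimes> v \<and> l w = l v + 1"
  by (induction rule: coxeter_induct) auto

end

section \<open>Subspaces over a subfield\<close>

definition is_subfield :: "'a::field set \<Rightarrow> bool" where
  "is_subfield F \<longleftrightarrow> 1 \<in> F \<and> (\<forall>x\<in>F. \<forall>y\<in>F. x - y \<in> F \<and> x * y \<in> F \<and> x / y \<in> F)"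

lemma is_subring_closed:
  fixes R :: "'a::comm_ring_1 set" and f :: "'i \<Rightarrow> 'a"
  assumes "is_subring R"
  shows "0 \<in> R" and "1 \<in> R" and "x \<in> R \<Longrightarrow> - x \<in> R"
    and "x \<in> R \<Longrightarrow> y \<in> R \<Longrightarrow> x + y \<in> R" and "x \<in> R \<Longrightarrow> y \<in> R \<Longrightarrow> x * y \<in> R"
    and "x \<in> R \<Longrightarrow> y \<in> R \<Longrightarrow> x - y \<in> R"
    and "(\<And>i. i \<in> I \<Longrightarrow> f i \<in> R) \<Longrightarrow> sum f I \<in> R"
    and "(\<And>i. i \<in> I \<Longrightarrow> f i \<in> R) \<Longrightarrow> (\<Prod>i\<in>I. f i) \<in> R"
proof -
  have R: "1 \<in> R" "\<And>x y. x \<in> R \<Longrightarrow> y \<in> R \<Longrightarrow> x - y \<in> R" "\<And>x y. x \<in> R \<Longrightarrow> y \<in> R \<Longrightarrow> x * y \<in> R"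
    using assms by (auto simp: is_subring_def)
  show 0: "0 \<in> R"
    using R(1) R(2)[of 1 1] by simp
  show "1 \<in> R" by (rule R)
  show m: "- x \<in> R" if "x \<in> R" for x
    using R(2)[of 0 x] 0 that by simp
  show p: "x + y \<in> R" if "x \<in> R" "y \<in> R" for x y
    using R(2)[of x "- y"] m that by simp
  show "x * y \<in> R" "x - y \<in> R" if "x \<in> R" "y \<in> R"
    using R that by auto
  show "sum f I \<in> R" if "\<And>i. i \<in> I \<Longrightarrow> f i \<in> R"
    using that by (induction I rule: infinite_finite_induct) (auto intro: p 0)
  show "(\<Prod>i\<in>I. f i) \<in> R" if "\<And>i. i \<in> I \<Longrightarrow> f i \<in> R"
    using that by (induction I rule: infinite_finite_induct) (auto intro: R)
qed

lemma is_subfield_subring: "is_subfield F \<Longrightarrow> is_subring F"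
  by (auto simp: is_subfield_def is_subring_def)

lemma is_subfield_of_nat: "is_subfield F \<Longrightarrow> of_nat n \<in> F"
  by (induction n) (auto dest!: is_subfield_subring intro: is_subring_closed)

lemma is_subfield_divide: "is_subfield F \<Longrightarrow> x \<in> F \<Longrightarrow> y \<in> F \<Longrightarrow> x / y \<in> F"
  by (auto simp: is_subfield_def)

lemma fraction_subfield_subset:
  assumes "is_subring R"
  shows "R \<subseteq> fraction_subfield R"
proof
  fix x assume "x \<in> R"
  then show "x \<in> fraction_subfield R"
    unfolding fraction_subfield_def using is_subring_closed(2)[OF assms]
    by (intro CollectI exI[of _ x] exI[of _ 1]) auto
qed

lemma is_subfield_fraction_subfield:
  fixes R :: "'a::field set"
  assumes R: "is_subring R"
  shows "is_subfield (fraction_subfield R)"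
  unfolding is_subfield_def
proof (intro conjI ballI)
  note cl = is_subring_closed[OF R]
  show "1 \<in> fraction_subfield R"
    using fraction_subfield_subset[OF R] cl(2) by blast
  fix x y assume "x \<in> fraction_subfield R" "y \<in> fraction_subfield R"
  then obtain a b c e where ab: "x = a / b" "y = c / e" "a \<in> R" "b \<in> R" "c \<in> R" "e \<in> R" "b \<noteq> 0" "e \<noteq> 0"
    by (auto simp: fraction_subfield_def)
  have "x - y = (a * e - c * b) / (b * e)" "x * y = (a * c) / (b * e)"
    using ab by (auto simp: field_simps)
  moreover have "a * e - c * b \<in> R" "b * e \<in> R" "a * c \<in> R" "b * e \<noteq> 0"
    using ab cl by auto
  ultimately show "x - y \<in> fraction_subfield R" "x * y \<in> fraction_subfield R"
    unfolding fraction_subfield_def by blast+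
  show "x / y \<in> fraction_subfield R"
  proof (cases "c = 0")
    case True
    then have "x / y = 0 / 1" using ab by simp
    then show ?thesis
      unfolding fraction_subfield_def using cl(1,2) by (metis (mono_tags, lifting) mem_Collect_eq zero_neq_one)
  next
    case False
    then have "x / y = (a * e) / (b * c)" "a * e \<in> R" "b * c \<in> R" "b * c \<noteq> 0"
      using ab cl by auto
    then show ?thesis
      unfolding fraction_subfield_def by blast
  qed
qed

definition fun_subspace :: "'a::field set \<Rightarrow> ('i \<Rightarrow> 'a) set \<Rightarrow> bool" where
  "fun_subspace F V \<longleftrightarrow> (\<lambda>_. 0) \<in> V \<and> (\<forall>u\<in>V. \<forall>v\<in>V. (\<lambda>x. u x + v x) \<in> V) \<and>
     (\<forall>c\<in>F. \<forall>u\<in>V. (\<lambda>x. c * u x) \<in> V)"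

definition funs_over :: "'a::zero set \<Rightarrow> 'i set \<Rightarrow> ('i \<Rightarrow> 'a) set" where
  "funs_over F I = {u. (\<forall>i\<in>I. u i \<in> F) \<and> (\<forall>i. i \<notin> I \<longrightarrow> u i = 0)}"

lemma fun_subspace_sum:
  assumes V: "fun_subspace F V"
    and "\<And>j. j \<in> J \<Longrightarrow> a j \<in> F" "\<And>j. j \<in> J \<Longrightarrow> u j \<in> V"
  shows "(\<lambda>x. \<Sum>j\<in>J. a j * u j x) \<in> V"
  using assms(2,3)
proof (induction J rule: infinite_finite_induct)
  case (insert j J)
  then have "(\<lambda>x. a j * u j x) \<in> V" "(\<lambda>x. \<Sum>j\<in>J. a j * u j x) \<in> V"
    using V by (auto simp: fun_subspace_def)
  then show ?case
    using V insert.hyps by (auto simp: fun_subspace_def)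
qed (use V in \<open>auto simp: fun_subspace_def\<close>)

lemma fun_subspace_lincomb:
  assumes V: "fun_subspace F V" and "u \<in> V" "v \<in> V" "c \<in> F"
  shows "(\<lambda>x. u x + c * v x) \<in> V"
proof -
  have "(\<lambda>x. c * v x) \<in> V"
    using assms by (auto simp: fun_subspace_def)
  then show ?thesis
    using assms by (auto simp: fun_subspace_def)
qed

lemma fun_subspace_basis:
  assumes F: "is_subfield F" and "finite I" "fun_subspace F V" "V \<subseteq> funs_over F I"
  shows "\<exists>k bs. (\<forall>j<k. bs j \<in> V) \<and>
    (\<forall>v\<in>V. \<exists>a. (\<forall>j<k. a j \<in> F) \<and> v = (\<lambda>x. \<Sum>j<(k::nat). a j * bs j x)) \<and>
    (\<forall>a. (\<forall>j<k. a j \<in> F) \<and> (\<forall>x. (\<Sum>j<k. a j * bs j x) = 0) \<longrightarrow> (\<forall>j<k. a j = 0))"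
  using assms(2-)
proof (induction I arbitrary: V rule: finite_induct)
  case empty
  then have "V = {\<lambda>_. 0}"
    by (auto simp: funs_over_def fun_subspace_def)
  then show ?case by (intro exI[of _ 0]) auto
next
  case (insert i J)
  note Fr = is_subring_closed[OF is_subfield_subring[OF F]]
  define V0 where "V0 = {v\<in>V. v i = 0}"
  have "fun_subspace F V0"
    using insert.prems(1) by (auto simp: fun_subspace_def V0_def)
  moreover have "V0 \<subseteq> funs_over F J"
    using insert.prems(2) by (auto simp: funs_over_def V0_def)
  ultimately have "\<exists>k bs. (\<forall>j<k. bs j \<in> V0) \<and>
    (\<forall>v\<in>V0. \<exists>a. (\<forall>j<k. a j \<in> F) \<and> v = (\<lambda>x. \<Sum>j<(k::nat). a j * bs j x)) \<and>
    (\<forall>a. (\<forall>j<k. a j \<in> F) \<and> (\<forall>x. (\<Sum>j<k. a j * bs j x) = 0) \<longrightarrow> (\<forall>j<k. a j = 0))"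
    by (rule insert.IH)
  then obtain k :: nat and bs where bs0: "\<forall>j<k. bs j \<in> V0"
    "\<forall>v\<in>V0. \<exists>a. (\<forall>j<k. a j \<in> F) \<and> v = (\<lambda>x. \<Sum>j<k. a j * bs j x)"
    "\<forall>a. (\<forall>j<k. a j \<in> F) \<and> (\<forall>x. (\<Sum>j<k. a j * bs j x) = 0) \<longrightarrow> (\<forall>j<k. a j = 0)"
    by (elim exE conjE) rule
  then have bs: "\<And>j. j < k \<Longrightarrow> bs j \<in> V0"
    "\<And>v. v \<in> V0 \<Longrightarrow> \<exists>a. (\<forall>j<k. a j \<in> F) \<and> v = (\<lambda>x. \<Sum>j<k. a j * bs j x)"
    "\<And>a j. (\<forall>j<k. a j \<in> F) \<Longrightarrow> (\<forall>x. (\<Sum>j<k. a j * bs j x) = 0) \<Longrightarrow> j < k \<Longrightarrow> a j = 0"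
    by simp_all
  show ?case
  proof (cases "V0 = V")
    case True
    then show ?thesis
      using bs0 by (intro exI[of _ k] exI[of _ bs]) simp
  next
    case False
    then obtain u where u: "u \<in> V" "u i \<noteq> 0"
      by (auto simp: V0_def)
    have uF: "v i \<in> F" if "v \<in> V" for v
      using insert.prems(2) that by (auto simp: funs_over_def)
    define bs' where "bs' = bs(k := u)"
    have sum: "(\<Sum>j<Suc k. a j * bs' j x) = (\<Sum>j<k. a j * bs j x) + a k * u x" for a x
      by (simp add: bs'_def)
    have bsi: "(\<Sum>j<k. a j * bs j i) = 0" for a
      using bs(1) by (intro sum.neutral) (auto simp: V0_def)
    show ?thesis
    proof (intro exI[of _ "Suc k"] exI[of _ bs'] conjI allI impI ballI)
      show "bs' j \<in> V" if "j < Suc k" for j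
        using that bs(1) u by (auto simp: bs'_def V0_def)
    next
      fix v assume v: "v \<in> V"
      define c where "c = v i / u i"
      have c: "c \<in> F" "- c \<in> F"
        using is_subfield_divide[OF F] uF v u Fr by (auto simp: c_def)
      have "(\<lambda>x. v x + (- c) * u x) \<in> V"
        using fun_subspace_lincomb[OF insert.prems(1) v u(1) c(2)] .
      then have "(\<lambda>x. v x + (- c) * u x) \<in> V0"
        using u by (simp add: V0_def c_def)
      then obtain a where a: "\<forall>j<k. a j \<in> F" "(\<lambda>x. v x + (- c) * u x) = (\<lambda>x. \<Sum>j<k. a j * bs j x)"
        using bs(2) by blast
      have "v x = (\<Sum>j<Suc k. (a(k := c)) j * bs' j x)" for x
        using fun_cong[OF a(2), of x] unfolding sum by (simp add: algebra_simps)
      then show "\<exists>a. (\<forall>j<Suc k. a j \<in> F) \<and> v = (\<lambda>x. \<Sum>j<Suc k. a j * bs' j x)"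
        using a(1) c by (intro exI[of _ "a(k := c)"]) auto
    next
      fix a j assume a: "(\<forall>j<Suc k. a j \<in> F) \<and> (\<forall>x. (\<Sum>j<Suc k. a j * bs' j x) = 0)" and j: "j < Suc k"
      have "a k * u i = 0"
        using a sum[of a i] bsi[of a] by simp
      then have ak: "a k = 0" using u by simp
      then have "\<forall>x. (\<Sum>j<k. a j * bs j x) = 0"
        using a sum[of a] by simp
      then have "j < k \<Longrightarrow> a j = 0"
        using bs(3)[of a j] a by auto
      then show "a j = 0"
        using ak j by (auto simp: less_Suc_eq)
    qed
  qed
qed

text \<open>Scalars lie in a subfield given as a set, so the dimension theory for type-based vector
  spaces does not apply; the number of pivots serves as the dimension of a subspace.\<close>

definition pivots :: "(nat \<Rightarrow> 'i) \<Rightarrow> nat \<Rightarrow> ('i \<Rightarrow> 'a::zero) set \<Rightarrow> nat set" where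
  "pivots b n V = {j. j < n \<and> (\<exists>v\<in>V. v (b j) \<noteq> 0 \<and> (\<forall>i<j. v (b i) = 0))}"

lemma pivots_mono: "V \<subseteq> V' \<Longrightarrow> pivots b n V \<subseteq> pivots b n V'"
  unfolding pivots_def by blast

lemma pivots_eq_imp_eq:
  assumes F: "is_subfield F" and b: "bij_betw b {..<n} I"
    and V: "fun_subspace F V" "fun_subspace F V'" "V' \<subseteq> V" "V \<subseteq> funs_over F I"
    and eq: "pivots b n V = pivots b n V'"
  shows "V' = V"
proof (intro equalityI subsetI)
  fix v assume v: "v \<in> V"
  note Fr = is_subring_closed[OF is_subfield_subring[OF F]]
  have "j \<le> n \<Longrightarrow> \<exists>v'\<in>V'. \<forall>i<j. v (b i) = v' (b i)" for j
  proof (induction j)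
    case 0
    then show ?case using V(2) by (auto simp: fun_subspace_def)
  next
    case (Suc j)
    then obtain v' where v': "v' \<in> V'" "\<forall>i<j. v (b i) = v' (b i)"
      by auto
    show ?case
    proof (cases "v (b j) = v' (b j)")
      case True
      then show ?thesis
        using v' by (auto simp: less_Suc_eq)
    next
      case False
      have "(\<lambda>x. v x + (- 1) * v' x) \<in> V"
        using fun_subspace_lincomb[OF V(1) v, of v' "- 1"] v' V(3) Fr by auto
      moreover have "\<forall>i<j. v (b i) + (- 1) * v' (b i) = 0" "v (b j) + (- 1) * v' (b j) \<noteq> 0"
        using v' False by auto
      ultimately have "j \<in> pivots b n V"
        unfolding pivots_def using Suc.prems by (auto intro!: bexI[of _ "\<lambda>x. v x + (- 1) * v' x"])
      then obtain u where u: "u \<in> V'" "u (b j) \<noteq> 0" "\<forall>i<j. u (b i) = 0"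
        unfolding eq by (auto simp: pivots_def)
      define c where "c = (v (b j) - v' (b j)) / u (b j)"
      have "b j \<in> I"
        using b Suc.prems by (auto simp: bij_betw_def)
      then have "v (b j) \<in> F" "v' (b j) \<in> F" "u (b j) \<in> F"
        using v v' u V by (auto simp: funs_over_def)
      then have "c \<in> F"
        unfolding c_def using Fr is_subfield_divide[OF F] by auto
      then have "(\<lambda>x. v' x + c * u x) \<in> V'"
        using fun_subspace_lincomb[OF V(2) v'(1) u(1)] by blast
      then show ?thesis
        by (rule bexI[rotated]) (use u v' in \<open>auto simp: less_Suc_eq c_def\<close>)
    qed
  qed
  then obtain v' where v': "v' \<in> V'" "\<forall>i<n. v (b i) = v' (b i)"
    by blast
  have "v x = v' x" for x
  proof (cases "x \<in> I")
    case True
    then have "x \<in> b ` {..<n}" using b by (simp add: bij_betw_def)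
    then show ?thesis using v' by auto
  next
    case False
    moreover have "v \<in> funs_over F I" "v' \<in> funs_over F I"
      using v v' V(3,4) by auto
    ultimately show ?thesis by (simp add: funs_over_def)
  qed
  then have "v = v'" by auto
  then show "v \<in> V'" using v' by simp
qed (use V in auto)

lemma minimal_fun_subspace:
  fixes Q :: "('i \<Rightarrow> 'a::field) set \<Rightarrow> bool"
  assumes F: "is_subfield F" and I: "finite I"
    and V: "Q V" "\<And>V. Q V \<Longrightarrow> fun_subspace F V \<and> V \<subseteq> funs_over F I"
  shows "\<exists>V. Q V \<and> (\<forall>V'. Q V' \<and> V' \<subseteq> V \<longrightarrow> V' = V)"
proof -
  define n where "n = card I"
  obtain b where b: "bij_betw b {..<n} I"
    using I ex_bij_betw_nat_finite unfolding n_def atLeast0LessThan[symmetric] by blast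
  define m where "m = (\<lambda>V::('i \<Rightarrow> 'a) set. card (pivots b n V))"
  have "\<exists>V. Q V \<and> (\<forall>V'. Q V' \<longrightarrow> m V \<le> m V')"
    using ex_has_least_nat[of Q V m] V(1) by auto
  then obtain V0 where V0: "Q V0" "\<And>V'. Q V' \<Longrightarrow> m V0 \<le> m V'"
    by blast
  have "V' = V0" if "Q V'" "V' \<subseteq> V0" for V'
  proof -
    have "finite (pivots b n V0)"
      by (simp add: pivots_def)
    then have "pivots b n V' = pivots b n V0"
      using pivots_mono[OF that(2), of b n] V0(2)[OF that(1)] by (simp add: m_def card_seteq)
    then show ?thesis
      using pivots_eq_imp_eq[OF F b, of V0 V'] V(2) V0(1) that by auto
  qed
  then show ?thesis using V0 by blast
qed

section \<open>Irreducible representations of the group\<close>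

lemma mats_overD: "A \<in> mats_over k d \<Longrightarrow> A \<in> carrier_mat d d"
  "A \<in> mats_over k d \<Longrightarrow> i < d \<Longrightarrow> j < d \<Longrightarrow> A $$ (i, j) \<in> k"
  unfolding mats_over_def by (blast, blast intro: elements_matI)

lemma mats_overI: "A \<in> carrier_mat d d \<Longrightarrow> (\<And>i j. i < d \<Longrightarrow> j < d \<Longrightarrow> A $$ (i, j) \<in> k) \<Longrightarrow> A \<in> mats_over k d"
  by (auto simp: mats_over_def elements_mat_def)

lemma irreducible_intertwiner:
  fixes A :: "'w \<Rightarrow> 'k::field_char_0 mat"
  assumes F: "is_subfield F"
    and A: "irreducible_mats F d X A" "\<And>w. w \<in> X \<Longrightarrow> A w \<in> mats_over F d"
    and A': "irreducible_mats F d' X A'" "\<And>w. w \<in> X \<Longrightarrow> A' w \<in> mats_over F d'"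
    and P: "P \<in> carrier_mat d d'" "\<And>i j. i < d \<Longrightarrow> j < d' \<Longrightarrow> P $$ (i, j) \<in> F" "P \<noteq> 0\<^sub>m d d'"
    and PA: "\<And>w. w \<in> X \<Longrightarrow> A w * P = P * A' w"
  shows "d' = d \<and> P \<in> mats_over F d \<and> det P \<noteq> 0"
proof -
  note Fr = is_subring_closed[OF is_subfield_subring[OF F]]
  have vec: "v \<in> carrier_vec n" if "v \<in> vecs_over F n" for v n
    using that by (simp add: vecs_over_def)
  have Pv: "P *\<^sub>v v \<in> vecs_over F d" if "v \<in> vecs_over F d'" for v
    using that P unfolding vecs_over_def by (auto simp: scalar_prod_def intro!: Fr)
  have A'v: "A' w *\<^sub>v v \<in> vecs_over F d'" if "v \<in> vecs_over F d'" "w \<in> X" for v w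
    using that mats_overD[OF A'(2)[OF that(2)]]
    unfolding vecs_over_def by (auto simp: scalar_prod_def intro!: Fr)
  have APv: "A w *\<^sub>v (P *\<^sub>v v) = P *\<^sub>v (A' w *\<^sub>v v)" if "v \<in> vecs_over F d'" "w \<in> X" for v w
    using PA[OF that(2)] assoc_mult_mat_vec P(1) mats_overD(1)[OF A(2)[OF that(2)]]
      mats_overD(1)[OF A'(2)[OF that(2)]] vec[OF that(1)] by metis
  have add: "u + v \<in> vecs_over F n" if "u \<in> vecs_over F n" "v \<in> vecs_over F n" for u v n
    using that by (auto simp: vecs_over_def intro!: Fr)
  have smult: "c \<cdot>\<^sub>v v \<in> vecs_over F n" if "v \<in> vecs_over F n" "c \<in> F" for c v n
    using that by (auto simp: vecs_over_def intro!: Fr)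
  have zero: "0\<^sub>v n \<in> vecs_over F n" for n
    by (auto simp: vecs_over_def Fr)
  have unit: "unit_vec n i \<in> vecs_over F n" for i n
    by (auto simp: vecs_over_def unit_vec_def Fr)
  define Ker where "Ker = {v \<in> vecs_over F d'. P *\<^sub>v v = 0\<^sub>v d}"
  define Im where "Im = (\<lambda>v. P *\<^sub>v v) ` vecs_over F d'"
  have col: "P *\<^sub>v unit_vec d' j = col P j" if "j < d'" for j
    using P(1) that by (intro eq_vecI) auto
  have P0: "P = 0\<^sub>m d d'" if "\<And>v. v \<in> vecs_over F d' \<Longrightarrow> P *\<^sub>v v = 0\<^sub>v d"
  proof (rule eq_matI)
    fix i j assume "i < dim_row (0\<^sub>m d d')" "j < dim_col (0\<^sub>m d d' :: 'k mat)"
    then have ij: "i < d" "j < d'" by auto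
    have "P $$ (i, j) = col P j $ i" using ij P(1) by auto
    also have "col P j = 0\<^sub>v d" using that[OF unit[of d' j]] col[OF ij(2)] by simp
    finally show "P $$ (i, j) = 0\<^sub>m d d' $$ (i, j)" using ij by simp
  qed (use P(1) in auto)
  have "Ker = {0\<^sub>v d'} \<or> Ker = vecs_over F d'"
  proof -
    have "Ker \<subseteq> vecs_over F d'" "0\<^sub>v d' \<in> Ker"
      using P(1) zero by (auto simp: Ker_def)
    moreover have "\<forall>u\<in>Ker. \<forall>v\<in>Ker. u + v \<in> Ker"
      using P(1) vec add by (auto simp: Ker_def mult_add_distrib_mat_vec[of P d d'])
    moreover have "\<forall>c\<in>F. \<forall>v\<in>Ker. c \<cdot>\<^sub>v v \<in> Ker"
      using P(1) vec smult by (auto simp: Ker_def mult_mat_vec[of P d d'])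
    moreover have "\<forall>x\<in>X. \<forall>v\<in>Ker. A' x *\<^sub>v v \<in> Ker"
    proof (intro ballI)
      fix x v assume xv: "x \<in> X" "v \<in> Ker"
      then have "P *\<^sub>v (A' x *\<^sub>v v) = A x *\<^sub>v 0\<^sub>v d"
        using APv[of v x] by (simp add: Ker_def)
      also have "\<dots> = 0\<^sub>v d"
        using mats_overD(1)[OF A(2)[OF xv(1)]] by auto
      finally show "A' x *\<^sub>v v \<in> Ker"
        using A'v xv by (simp add: Ker_def)
    qed
    ultimately show ?thesis
      using A'(1) unfolding irreducible_mats_def by blast
  qed
  moreover have "Ker \<noteq> vecs_over F d'"
    using P0 P(3) by (auto simp: Ker_def)
  ultimately have Ker: "Ker = {0\<^sub>v d'}" by blast
  have "Im = {0\<^sub>v d} \<or> Im = vecs_over F d"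
  proof -
    have "Im \<subseteq> vecs_over F d" using Pv by (auto simp: Im_def)
    moreover have "0\<^sub>v d \<in> Im"
      unfolding Im_def using P(1) zero by (intro image_eqI[of _ _ "0\<^sub>v d'"]) auto
    moreover have "\<forall>u\<in>Im. \<forall>v\<in>Im. u + v \<in> Im"
    proof (intro ballI)
      fix u v assume "u \<in> Im" "v \<in> Im"
      then obtain u' v' where "u' \<in> vecs_over F d'" "v' \<in> vecs_over F d'" "u = P *\<^sub>v u'" "v = P *\<^sub>v v'"
        by (auto simp: Im_def)
      then show "u + v \<in> Im"
        unfolding Im_def using P(1) vec add
        by (intro image_eqI[of _ _ "u' + v'"]) (auto simp: mult_add_distrib_mat_vec[of P d d'])
    qed
    moreover have "\<forall>c\<in>F. \<forall>v\<in>Im. c \<cdot>\<^sub>v v \<in> Im"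
    proof (intro ballI)
      fix c v assume "c \<in> F" "v \<in> Im"
      then obtain v' where "v' \<in> vecs_over F d'" "v = P *\<^sub>v v'"
        by (auto simp: Im_def)
      then show "c \<cdot>\<^sub>v v \<in> Im"
        unfolding Im_def using P(1) vec smult \<open>c \<in> F\<close>
        by (intro image_eqI[of _ _ "c \<cdot>\<^sub>v v'"]) (auto simp: mult_mat_vec[of P d d'])
    qed
    moreover have "\<forall>x\<in>X. \<forall>v\<in>Im. A x *\<^sub>v v \<in> Im"
      using APv A'v by (auto simp: Im_def)
    ultimately show ?thesis
      using A(1) unfolding irreducible_mats_def by blast
  qed
  moreover have "Im \<noteq> {0\<^sub>v d}"
    using P0 P(3) unfolding Im_def by blast
  ultimately have Im: "Im = vecs_over F d" by blast
  have "\<forall>j. \<exists>q. q \<in> vecs_over F d' \<and> P *\<^sub>v q = unit_vec d j"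
    using unit[of d] unfolding Im[symmetric] Im_def by (metis imageE)
  then obtain q where q: "\<And>j. q j \<in> vecs_over F d'" "\<And>j. P *\<^sub>v q j = unit_vec d j"
    by metis
  define Q where "Q = mat d' d (\<lambda>(i, j). q j $ i)"
  have Q: "Q \<in> carrier_mat d' d" by (simp add: Q_def)
  have colQ: "col Q j = q j" if "j < d" for j
    using vec[OF q(1)[of j]] that by (auto simp: Q_def)
  have PQ: "P * Q = 1\<^sub>m d"
  proof (rule eq_matI)
    fix i j assume "i < dim_row (1\<^sub>m d)" "j < dim_col (1\<^sub>m d :: 'k mat)"
    then have ij: "i < d" "j < d" by auto
    then have "(P * Q) $$ (i, j) = (P *\<^sub>v q j) $ i"
      using P(1) Q colQ by simp
    then show "(P * Q) $$ (i, j) = 1\<^sub>m d $$ (i, j)"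
      using q(2) ij by (simp add: unit_vec_def)
  qed (use P Q in auto)
  have QP: "Q * P = 1\<^sub>m d'"
  proof (rule eq_matI)
    fix i j assume "i < dim_row (1\<^sub>m d')" "j < dim_col (1\<^sub>m d' :: 'k mat)"
    then have ij: "i < d'" "j < d'" by auto
    define r where "r = Q *\<^sub>v col P j"
    have r: "r \<in> vecs_over F d'"
    proof -
      have "Q $$ (i, k) \<in> F" if "i < d'" "k < d" for i k
        using q(1)[of k] that by (auto simp: Q_def vecs_over_def)
      then show ?thesis
        unfolding r_def vecs_over_def using Q P ij
        by (auto simp: scalar_prod_def intro!: Fr)
    qed
    have "P *\<^sub>v r = (P * Q) *\<^sub>v col P j"
      unfolding r_def using P(1) Q by (metis assoc_mult_mat_vec carrier_matD(1) col_dim)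
    also have "\<dots> = P *\<^sub>v unit_vec d' j"
      using PQ P(1) col[OF ij(2)] by (metis carrier_matD(1) col_dim one_mult_mat_vec)
    finally have eq: "P *\<^sub>v r = P *\<^sub>v unit_vec d' j" .
    have "P *\<^sub>v (r + (- 1) \<cdot>\<^sub>v unit_vec d' j) = P *\<^sub>v r + (- 1) \<cdot>\<^sub>v (P *\<^sub>v unit_vec d' j)"
      using P(1) vec[OF r] by (simp add: mult_add_distrib_mat_vec[of P d d'] mult_mat_vec[of P d d'])
    also have "\<dots> = 0\<^sub>v d"
      unfolding eq using P(1) by auto
    finally have "r + (- 1) \<cdot>\<^sub>v unit_vec d' j \<in> Ker"
      unfolding Ker_def using r unit Fr by (auto intro!: add smult)
    then have "r + (- 1) \<cdot>\<^sub>v unit_vec d' j = 0\<^sub>v d'"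
      unfolding Ker by simp
    then have "(r + (- 1) \<cdot>\<^sub>v unit_vec d' j) $ i = 0"
      using ij by simp
    then have "r $ i = unit_vec d' j $ i"
      using ij vec[OF r] by (simp add: index_add_vec)
    moreover have "(Q * P) $$ (i, j) = r $ i"
      using ij P(1) Q by (simp add: r_def)
    ultimately show "(Q * P) $$ (i, j) = 1\<^sub>m d' $$ (i, j)"
      using ij by (simp add: unit_vec_def)
  qed (use P Q in auto)
  have "card {..<d} = card {..<d'}"
  proof (rule inverse_matrices_card_eq[where M = "\<lambda>i k. P $$ (i, k)" and N = "\<lambda>i k. Q $$ (i, k)"])
    fix i assume "i \<in> {..<d}"
    then have "(P * Q) $$ (i, i) = (\<Sum>k<d'. P $$ (i, k) * Q $$ (k, i))"
      using P(1) Q by (simp add: scalar_prod_def atLeast0LessThan)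
    then show "(\<Sum>k<d'. P $$ (i, k) * Q $$ (k, i)) = 1"
      using PQ \<open>i \<in> {..<d}\<close> by simp
  next
    fix i assume "i \<in> {..<d'}"
    then have "(Q * P) $$ (i, i) = (\<Sum>k<d. Q $$ (i, k) * P $$ (k, i))"
      using P(1) Q by (simp add: scalar_prod_def atLeast0LessThan)
    then show "(\<Sum>k<d. Q $$ (i, k) * P $$ (k, i)) = 1"
      using QP \<open>i \<in> {..<d'}\<close> by simp
  qed auto
  then have dd: "d' = d" by simp
  have "det P * det Q = 1"
    using PQ P(1) Q dd det_mult[of P d Q] by simp
  then have "det P \<noteq> 0" by auto
  moreover have "P \<in> mats_over F d"
    using P dd by (intro mats_overI) auto
  ultimately show ?thesis using dd by simp
qed

lemma sum_matrix_entries: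
  assumes "finite \<Lambda>"
  shows "(\<Sum>y\<in>(SIGMA \<mu>:\<Lambda>. {..<d \<mu>} \<times> {..<d \<mu>}). g y) =
    (\<Sum>\<mu>\<in>\<Lambda>. \<Sum>i<d \<mu>. \<Sum>j<(d \<mu> :: nat). g (\<mu>, i, j))"
proof -
  have "(\<Sum>y\<in>(SIGMA \<mu>:\<Lambda>. {..<d \<mu>} \<times> {..<d \<mu>}). g y) =
      (\<Sum>\<mu>\<in>\<Lambda>. \<Sum>p\<in>{..<d \<mu>} \<times> {..<d \<mu>}. g (\<mu>, p))"
    using assms by (subst sum.Sigma) auto
  also have "\<dots> = (\<Sum>\<mu>\<in>\<Lambda>. \<Sum>i<d \<mu>. \<Sum>j<d \<mu>. g (\<mu>, i, j))"
    by (rule sum.cong) (auto simp: sum.cartesian_product)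
  finally show ?thesis .
qed

locale group_irreps =
  fixes H :: "('w, 'g) hecke_data" (structure)
    and \<Lambda> :: "'l set" and d :: "'l \<Rightarrow> nat" and E :: "'l \<Rightarrow> 'w \<Rightarrow> complex mat"
  assumes is_group: "group H" and finite_carrier: "finite (carrier H)"
    and subring: "is_subring (coeffs H)"
    and splitting: "splitting_field H" and irreps: "irreps_indexed_by H \<Lambda> d E"
begin

sublocale group H by (rule is_group)

abbreviation F :: "complex set" where "F \<equiv> baseF H"

lemma subfield_F: "is_subfield F"
  using subring by (rule is_subfield_fraction_subfield)

lemmas F_closed = is_subring_closed[OF is_subfield_subring[OF subfield_F]]

definition e :: "'l \<Rightarrow> 'w \<Rightarrow> nat \<Rightarrow> nat \<Rightarrow> complex" where
  "e \<mu> w i j = E \<mu> w $$ (i, j)"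

lemma finite_Lambda: "finite \<Lambda>"
  using irreps by (simp add: irreps_indexed_by_def)

lemma irrep: "\<mu> \<in> \<Lambda> \<Longrightarrow> group_irrep H (d \<mu>) (E \<mu>)"
  using irreps by (simp add: irreps_indexed_by_def)

lemma E_mats: "\<mu> \<in> \<Lambda> \<Longrightarrow> w \<in> carrier H \<Longrightarrow> E \<mu> w \<in> mats_over F (d \<mu>)"
  using irrep[of \<mu>] by (simp add: group_irrep_def group_mrep_def)

lemma E_carrier: "\<mu> \<in> \<Lambda> \<Longrightarrow> w \<in> carrier H \<Longrightarrow> E \<mu> w \<in> carrier_mat (d \<mu>) (d \<mu>)"
  using E_mats mats_overD(1) by blast

lemma E_mult: "\<mu> \<in> \<Lambda> \<Longrightarrow> x \<in> carrier H \<Longrightarrow> y \<in> carrier H \<Longrightarrow> E \<mu> (x \<otimes> y) = E \<mu> x * E \<mu> y"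
  using irrep[of \<mu>] by (simp add: group_irrep_def group_mrep_def)

lemma E_one: "\<mu> \<in> \<Lambda> \<Longrightarrow> E \<mu> \<one> = 1\<^sub>m (d \<mu>)"
  using irrep[of \<mu>] by (simp add: group_irrep_def group_mrep_def)

lemma d_pos: "\<mu> \<in> \<Lambda> \<Longrightarrow> 0 < d \<mu>"
  using irrep[of \<mu>] by (simp add: group_irrep_def irreducible_mats_def)

lemma e_F: "\<mu> \<in> \<Lambda> \<Longrightarrow> w \<in> carrier H \<Longrightarrow> i < d \<mu> \<Longrightarrow> j < d \<mu> \<Longrightarrow> e \<mu> w i j \<in> F"
  unfolding e_def using E_mats mats_overD(2) by blast

lemma e_mult:
  assumes "\<mu> \<in> \<Lambda>" "x \<in> carrier H" "y \<in> carrier H" "i < d \<mu>" "j < d \<mu>"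
  shows "e \<mu> (x \<otimes> y) i j = (\<Sum>k<d \<mu>. e \<mu> x i k * e \<mu> y k j)"
  unfolding e_def E_mult[OF assms(1-3)]
  using E_carrier[OF assms(1,2)] E_carrier[OF assms(1,3)] assms
  by (simp add: scalar_prod_def atLeast0LessThan)

lemma e_one: "\<mu> \<in> \<Lambda> \<Longrightarrow> i < d \<mu> \<Longrightarrow> j < d \<mu> \<Longrightarrow> e \<mu> \<one> i j = (if i = j then 1 else 0)"
  by (simp add: e_def E_one)

lemma sum_mult_left: "x \<in> carrier H \<Longrightarrow> (\<Sum>w\<in>carrier H. f (x \<otimes> w)) = sum f (carrier H)"
  by (rule sum.reindex_bij_witness[of _ "\<lambda>w. inv x \<otimes> w" "\<lambda>w. x \<otimes> w"]) (auto simp: m_assoc[symmetric])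

lemma sum_inv: "(\<Sum>w\<in>carrier H. f (inv w)) = sum f (carrier H)"
  by (rule sum.reindex_bij_witness[of _ "\<lambda>w. inv w" "\<lambda>w. inv w"]) auto

definition order_W :: complex where "order_W = of_nat (card (carrier H))"

lemma order_W_neq_0: "order_W \<noteq> 0"
  unfolding order_W_def using finite_carrier one_closed by (auto simp: card_eq_0_iff)

lemma order_W_F: "order_W \<in> F"
  unfolding order_W_def by (rule is_subfield_of_nat[OF subfield_F])

lemma intertwiner:
  assumes \<mu>\<nu>: "\<mu> \<in> \<Lambda>" "\<nu> \<in> \<Lambda>" and jk: "j < d \<mu>" "k < d \<nu>"
  defines "P \<equiv> mat (d \<mu>) (d \<nu>) (\<lambda>(p, q). \<Sum>w\<in>carrier H. e \<mu> w p j * e \<nu> (inv w) k q)"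
  assumes x: "x \<in> carrier H"
  shows "E \<mu> x * P = P * E \<nu> x"
proof (rule eq_matI)
  fix i q assume "i < dim_row (P * E \<nu> x)" "q < dim_col (P * E \<nu> x)"
  then have iq: "i < d \<mu>" "q < d \<nu>"
    using E_carrier[OF \<mu>\<nu>(2) x] by (auto simp: P_def)
  have "(E \<mu> x * P) $$ (i, q) = (\<Sum>p<d \<mu>. e \<mu> x i p * (\<Sum>w\<in>carrier H. e \<mu> w p j * e \<nu> (inv w) k q))"
    using E_carrier[OF \<mu>\<nu>(1) x] iq by (simp add: P_def scalar_prod_def e_def atLeast0LessThan)
  also have "\<dots> = (\<Sum>w\<in>carrier H. (\<Sum>p<d \<mu>. e \<mu> x i p * e \<mu> w p j) * e \<nu> (inv w) k q)"
    by (simp add: sum_distrib_left sum_distrib_right sum.swap[of _ "carrier H"] mult.assoc)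
  also have "\<dots> = (\<Sum>w\<in>carrier H. e \<mu> (x \<otimes> w) i j * e \<nu> (inv (x \<otimes> w) \<otimes> x) k q)"
  proof (rule sum.cong)
    fix w assume w: "w \<in> carrier H"
    have "inv (x \<otimes> w) \<otimes> x = inv w"
      using w x by (simp add: inv_mult_group m_assoc)
    then show "(\<Sum>p<d \<mu>. e \<mu> x i p * e \<mu> w p j) * e \<nu> (inv w) k q =
        e \<mu> (x \<otimes> w) i j * e \<nu> (inv (x \<otimes> w) \<otimes> x) k q"
      using e_mult[OF \<mu>\<nu>(1) x w iq(1) jk(1)] by simp
  qed simp
  also have "\<dots> = (\<Sum>w\<in>carrier H. e \<mu> w i j * e \<nu> (inv w \<otimes> x) k q)"
    by (rule sum_mult_left[OF x])
  also have "\<dots> = (\<Sum>w\<in>carrier H. e \<mu> w i j * (\<Sum>p<d \<nu>. e \<nu> (inv w) k p * e \<nu> x p q))"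
    by (rule sum.cong) (use e_mult \<mu>\<nu> jk iq x in auto)
  also have "\<dots> = (\<Sum>p<d \<nu>. (\<Sum>w\<in>carrier H. e \<mu> w i j * e \<nu> (inv w) k p) * e \<nu> x p q)"
    by (simp add: sum_distrib_left sum_distrib_right sum.swap[of _ "carrier H"] mult.assoc)
  also have "\<dots> = (P * E \<nu> x) $$ (i, q)"
    using E_carrier[OF \<mu>\<nu>(2) x] iq by (simp add: P_def scalar_prod_def e_def atLeast0LessThan)
  finally show "(E \<mu> x * P) $$ (i, q) = (P * E \<nu> x) $$ (i, q)" .
qed (use E_carrier[OF \<mu>\<nu>(1) x] E_carrier[OF \<mu>\<nu>(2) x] in \<open>auto simp: P_def\<close>)

lemma Schur_neq:
  assumes \<mu>\<nu>: "\<mu> \<in> \<Lambda>" "\<nu> \<in> \<Lambda>" "\<mu> \<noteq> \<nu>" and ij: "i < d \<mu>" "j < d \<mu>" "k < d \<nu>" "l < d \<nu>"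
  shows "(\<Sum>w\<in>carrier H. e \<mu> w i j * e \<nu> (inv w) k l) = 0"
proof -
  define P where "P = mat (d \<mu>) (d \<nu>) (\<lambda>(p, q). \<Sum>w\<in>carrier H. e \<mu> w p j * e \<nu> (inv w) k q)"
  have P: "P \<in> carrier_mat (d \<mu>) (d \<nu>)" by (simp add: P_def)
  have EP: "E \<mu> x * P = P * E \<nu> x" if "x \<in> carrier H" for x
    unfolding P_def using intertwiner[OF \<mu>\<nu>(1,2) ij(2,3) that] .
  have "P = 0\<^sub>m (d \<mu>) (d \<nu>)"
  proof (rule ccontr)
    assume "P \<noteq> 0\<^sub>m (d \<mu>) (d \<nu>)"
    moreover have "P $$ (i, j) \<in> F" if "i < d \<mu>" "j < d \<nu>" for i j
      unfolding P_def using that ij \<mu>\<nu> by (auto intro!: F_closed e_F)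
    ultimately have "d \<nu> = d \<mu> \<and> P \<in> mats_over F (d \<mu>) \<and> det P \<noteq> 0"
      using irreducible_intertwiner[OF subfield_F, of "d \<mu>" "carrier H" "E \<mu>" "d \<nu>" "E \<nu>" P]
        irrep \<mu>\<nu> P EP E_mats unfolding group_irrep_def by blast
    then have "group_rep_equiv H (d \<nu>) (E \<nu>) (d \<mu>) (E \<mu>)"
      unfolding group_rep_equiv_def using EP by (auto intro!: bexI[of _ P])
    then show False
      using irreps \<mu>\<nu> unfolding irreps_indexed_by_def by metis
  qed
  then have "P $$ (i, l) = 0" using ij by simp
  then show ?thesis using ij by (simp add: P_def)
qed

lemma Schur_eq:
  assumes \<mu>: "\<mu> \<in> \<Lambda>" and ij: "i < d \<mu>" "j < d \<mu>" "k < d \<mu>" "l < d \<mu>"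
  shows "(\<Sum>w\<in>carrier H. e \<mu> w i j * e \<mu> (inv w) k l) =
    (if i = l \<and> j = k then order_W / of_nat (d \<mu>) else 0)"
proof -
  define P where "P = mat (d \<mu>) (d \<mu>) (\<lambda>(p, q). \<Sum>w\<in>carrier H. e \<mu> w p j * e \<mu> (inv w) k q)"
  have EP: "E \<mu> x * P = P * E \<mu> x" if "x \<in> carrier H" for x
    unfolding P_def using intertwiner[OF \<mu> \<mu> ij(2,3) that] .
  have "P \<in> mats_over F (d \<mu>)"
    unfolding P_def using ij \<mu> by (intro mats_overI) (auto intro!: F_closed e_F)
  then obtain c where c: "P = c \<cdot>\<^sub>m 1\<^sub>m (d \<mu>)"
    using splitting irrep[OF \<mu>] EP unfolding splitting_field_def by metis
  have Ppq: "(\<Sum>w\<in>carrier H. e \<mu> w p j * e \<mu> (inv w) k q) = (if p = q then c else 0)"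
    if "p < d \<mu>" "q < d \<mu>" for p q
  proof -
    have "P $$ (p, q) = (c \<cdot>\<^sub>m 1\<^sub>m (d \<mu>)) $$ (p, q)" using c by simp
    then show ?thesis using that by (simp add: P_def)
  qed
  have "of_nat (d \<mu>) * c = (\<Sum>p<d \<mu>. \<Sum>w\<in>carrier H. e \<mu> w p j * e \<mu> (inv w) k p)"
    by (simp add: Ppq)
  also have "\<dots> = (\<Sum>w\<in>carrier H. \<Sum>p<d \<mu>. e \<mu> (inv w) k p * e \<mu> w p j)"
    by (subst sum.swap) (simp add: mult.commute)
  also have "\<dots> = (\<Sum>w\<in>carrier H. e \<mu> (inv w \<otimes> w) k j)"
  proof (rule sum.cong)
    fix w assume "w \<in> carrier H"
    then show "(\<Sum>p<d \<mu>. e \<mu> (inv w) k p * e \<mu> w p j) = e \<mu> (inv w \<otimes> w) k j"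
      using e_mult[OF \<mu> _ _ ij(3,2), of "inv w" w] by simp
  qed simp
  also have "\<dots> = (\<Sum>w\<in>carrier H. if j = k then 1 else 0)"
    by (rule sum.cong) (use e_one[OF \<mu>] ij in auto)
  also have "\<dots> = (if j = k then order_W else 0)"
    by (simp add: order_W_def)
  finally have "c = (if j = k then order_W / of_nat (d \<mu>) else 0)"
    using d_pos[OF \<mu>] by (simp add: field_simps split: if_splits)
  then show ?thesis
    using Ppq[of i l] ij by simp
qed

definition idem :: "'w \<Rightarrow> complex" where
  "idem w = (\<Sum>\<mu>\<in>\<Lambda>. of_nat (d \<mu>) / order_W * (\<Sum>i<d \<mu>. e \<mu> (inv w) i i))"

lemma idem_F: "w \<in> carrier H \<Longrightarrow> idem w \<in> F"
  unfolding idem_def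
  by (auto intro!: F_closed is_subfield_divide[OF subfield_F] is_subfield_of_nat[OF subfield_F]
      order_W_F e_F)

lemma idem_acts_as_one:
  assumes \<mu>: "\<mu> \<in> \<Lambda>" and ij: "i < d \<mu>" "j < d \<mu>"
  shows "(\<Sum>w\<in>carrier H. idem w * e \<mu> w i j) = (if i = j then 1 else 0)"
proof -
  have "(\<Sum>w\<in>carrier H. idem w * e \<mu> w i j) =
      (\<Sum>w\<in>carrier H. \<Sum>\<nu>\<in>\<Lambda>. \<Sum>k<d \<nu>. of_nat (d \<nu>) / order_W * (e \<mu> w i j * e \<nu> (inv w) k k))"
    unfolding idem_def sum_distrib_right sum_distrib_left
    by (intro sum.cong refl) (simp add: mult_ac)
  also have "\<dots> = (\<Sum>\<nu>\<in>\<Lambda>. \<Sum>k<d \<nu>. of_nat (d \<nu>) / order_W *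
      (\<Sum>w\<in>carrier H. e \<mu> w i j * e \<nu> (inv w) k k))"
    by (simp add: sum_distrib_left sum.swap[of _ "carrier H"])
  also have "\<dots> = (\<Sum>\<nu>\<in>\<Lambda>. if \<nu> = \<mu> then (if i = j then 1 else 0) else 0)"
  proof (rule sum.cong)
    fix \<nu> assume \<nu>: "\<nu> \<in> \<Lambda>"
    show "(\<Sum>k<d \<nu>. of_nat (d \<nu>) / order_W * (\<Sum>w\<in>carrier H. e \<mu> w i j * e \<nu> (inv w) k k)) =
      (if \<nu> = \<mu> then (if i = j then 1 else 0) else 0)"
    proof (cases "\<nu> = \<mu>")
      case False
      then show ?thesis
        using Schur_neq[OF \<mu> \<nu> _ ij] by auto
    next
      case True
      have "(\<Sum>k<d \<mu>. of_nat (d \<mu>) / order_W * (\<Sum>w\<in>carrier H. e \<mu> w i j * e \<mu> (inv w) k k)) =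
        (\<Sum>k<d \<mu>. if k = i then (if i = j then 1 else 0) else 0)"
        by (rule sum.cong) (use Schur_eq[OF \<mu> ij] order_W_neq_0 d_pos[OF \<mu>] in auto)
      then show ?thesis using True ij by simp
    qed
  qed simp
  also have "\<dots> = (if i = j then 1 else 0)"
    using \<mu> finite_Lambda by simp
  finally show ?thesis .
qed

definition killed :: "('w \<Rightarrow> complex) set" where
  "killed = {u \<in> funs_over F (carrier H).
     \<forall>\<mu>\<in>\<Lambda>. \<forall>i<d \<mu>. \<forall>j<d \<mu>. (\<Sum>w\<in>carrier H. u w * e \<mu> w i j) = 0}"

definition act :: "'w \<Rightarrow> ('w \<Rightarrow> complex) \<Rightarrow> 'w \<Rightarrow> complex" where
  "act x u w = (if w \<in> carrier H then u (inv x \<otimes> w) else 0)"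

lemma killed_subspace: "fun_subspace F killed"
  unfolding fun_subspace_def
proof (intro conjI ballI)
  show "(\<lambda>_. 0) \<in> killed"
    by (auto simp: killed_def funs_over_def F_closed)
  show "(\<lambda>x. u x + v x) \<in> killed" if "u \<in> killed" "v \<in> killed" for u v
    using that by (auto simp: killed_def funs_over_def distrib_right sum.distrib intro!: F_closed)
  show "(\<lambda>x. c * u x) \<in> killed" if "c \<in> F" "u \<in> killed" for c u
    using that by (auto simp: killed_def funs_over_def mult.assoc sum_distrib_left[symmetric] intro!: F_closed)
qed

lemma act_killed:
  assumes x: "x \<in> carrier H" and u: "u \<in> killed"
  shows "act x u \<in> killed"
  unfolding killed_def
proof (intro CollectI conjI ballI allI impI)
  show "act x u \<in> funs_over F (carrier H)"
    using assms by (auto simp: killed_def funs_over_def act_def)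
  fix \<mu> i j assume \<mu>: "\<mu> \<in> \<Lambda>" and ij: "i < d \<mu>" "j < d \<mu>"
  have "(\<Sum>w\<in>carrier H. act x u w * e \<mu> w i j) =
      (\<Sum>w\<in>carrier H. act x u (x \<otimes> w) * e \<mu> (x \<otimes> w) i j)"
    by (rule sum_mult_left[OF x, symmetric])
  also have "\<dots> = (\<Sum>w\<in>carrier H. u w * (\<Sum>k<d \<mu>. e \<mu> x i k * e \<mu> w k j))"
    by (rule sum.cong) (use x e_mult[OF \<mu> x] ij in \<open>auto simp: act_def m_assoc[symmetric]\<close>)
  also have "\<dots> = (\<Sum>k<d \<mu>. e \<mu> x i k * (\<Sum>w\<in>carrier H. u w * e \<mu> w k j))"
    by (simp add: sum_distrib_left sum.swap[of _ "carrier H"] mult_ac)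
  also have "\<dots> = 0"
    using u \<mu> ij by (auto simp: killed_def)
  finally show "(\<Sum>w\<in>carrier H. act x u w * e \<mu> w i j) = 0" .
qed

lemma idem_kills_killed:
  assumes u: "u \<in> killed" and w: "w \<in> carrier H"
  shows "(\<Sum>x\<in>carrier H. idem x * act x u w) = 0"
proof -
  have "(\<Sum>x\<in>carrier H. idem x * act x u w) = (\<Sum>x\<in>carrier H. idem (w \<otimes> x) * act (w \<otimes> x) u w)"
    by (rule sum_mult_left[OF w, symmetric])
  also have "\<dots> = (\<Sum>v\<in>carrier H. idem (w \<otimes> inv v) * act (w \<otimes> inv v) u w)"
    by (rule sum_inv[symmetric])
  also have "\<dots> = (\<Sum>v\<in>carrier H. \<Sum>\<mu>\<in>\<Lambda>. \<Sum>i<d \<mu>. \<Sum>k<d \<mu>.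
      of_nat (d \<mu>) / order_W * (e \<mu> (inv w) k i * (u v * e \<mu> v i k)))"
  proof (rule sum.cong)
    fix v assume v: "v \<in> carrier H"
    have "inv (w \<otimes> inv v) = v \<otimes> inv w"
      using v w by (simp add: inv_mult_group)
    moreover have "act (w \<otimes> inv v) u w = u v"
      using v w by (simp add: act_def inv_mult_group m_assoc)
    moreover have "e \<mu> (v \<otimes> inv w) i i = (\<Sum>k<d \<mu>. e \<mu> v i k * e \<mu> (inv w) k i)"
      if "\<mu> \<in> \<Lambda>" "i < d \<mu>" for \<mu> i
      using e_mult[OF that(1) v _ that(2) that(2), of "inv w"] w by simp
    ultimately show "idem (w \<otimes> inv v) * act (w \<otimes> inv v) u w = (\<Sum>\<mu>\<in>\<Lambda>. \<Sum>i<d \<mu>. \<Sum>k<d \<mu>.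
      of_nat (d \<mu>) / order_W * (e \<mu> (inv w) k i * (u v * e \<mu> v i k)))"
      unfolding idem_def by (auto simp: sum_distrib_left sum_distrib_right mult_ac intro!: sum.cong)
  qed simp
  also have "\<dots> = (\<Sum>\<mu>\<in>\<Lambda>. \<Sum>i<d \<mu>. \<Sum>k<d \<mu>.
      of_nat (d \<mu>) / order_W * (e \<mu> (inv w) k i * (\<Sum>v\<in>carrier H. u v * e \<mu> v i k)))"
    by (simp add: sum_distrib_left sum.swap[of _ "carrier H"])
  also have "\<dots> = 0"
    using u by (auto simp: killed_def)
  finally show ?thesis .
qed

lemma act_sum: "act x (\<lambda>w. \<Sum>j\<in>J. a j * u j w) = (\<lambda>w. \<Sum>j\<in>J. a j * act x (u j) w)"
  by (auto simp: act_def)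

lemma act_mult:
  "x \<in> carrier H \<Longrightarrow> y \<in> carrier H \<Longrightarrow> act (x \<otimes> y) u = act x (act y u)"
  by (auto simp: act_def inv_mult_group m_assoc)

text \<open>A minimal invariant subspace of the functions killed by all \<open>E \<mu>\<close> would be
  irreducible. The element \<open>idem\<close> acts on it as the identity, since it does so in every
  irreducible representation, and as zero, since it annihilates every killed function.
  This replaces an appeal to semisimplicity.\<close>

lemma killed_trivial:
  assumes u: "u \<in> killed"
  shows "u = (\<lambda>_. 0)"
proof (rule ccontr)
  assume u0: "u \<noteq> (\<lambda>_. 0)"
  define Q where "Q = (\<lambda>V. fun_subspace F V \<and> V \<subseteq> killed \<and> (\<forall>x\<in>carrier H. \<forall>v\<in>V. act x v \<in> V) \<and>
    V \<noteq> {\<lambda>_. 0})"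
  have "Q killed"
    using u u0 killed_subspace act_killed by (auto simp: Q_def)
  moreover have "fun_subspace F V \<and> V \<subseteq> funs_over F (carrier H)" if "Q V" for V
    using that by (auto simp: Q_def killed_def)
  ultimately obtain V where V: "Q V" "\<And>V'. Q V' \<Longrightarrow> V' \<subseteq> V \<Longrightarrow> V' = V"
    using minimal_fun_subspace[OF subfield_F finite_carrier, of Q killed] by metis
  have Vs: "fun_subspace F V" and Vk: "V \<subseteq> killed" and Vact: "\<And>x v. x \<in> carrier H \<Longrightarrow> v \<in> V \<Longrightarrow> act x v \<in> V"
    and V0: "V \<noteq> {\<lambda>_. 0}"
    using V(1) by (auto simp: Q_def)
  have "V \<subseteq> funs_over F (carrier H)"
    using Vk by (auto simp: killed_def)
  from fun_subspace_basis[OF subfield_F finite_carrier Vs this]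
  obtain k :: nat and bs where bs: "\<forall>j<k. bs j \<in> V"
    and span: "\<forall>v\<in>V. \<exists>a. (\<forall>j<k. a j \<in> F) \<and> v = (\<lambda>x. \<Sum>j<k. a j * bs j x)"
    and indep: "\<forall>a. (\<forall>j<k. a j \<in> F) \<and> (\<forall>x. (\<Sum>j<k. a j * bs j x) = 0) \<longrightarrow> (\<forall>j<k. a j = 0)"
    by (elim exE conjE) rule
  have coeff_eq: "a i = b i" if "\<forall>j<k. a j \<in> F" "\<forall>j<k. b j \<in> F" "i < k"
    "\<And>x. (\<Sum>j<k. a j * bs j x) = (\<Sum>j<k. b j * bs j x)" for a b i
  proof -
    have "\<forall>j<k. a j - b j \<in> F"
      using that by (auto intro: F_closed)
    moreover have "\<forall>x. (\<Sum>j<k. (a j - b j) * bs j x) = 0"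
      using that(4) by (simp add: left_diff_distrib sum_subtractf)
    ultimately have "\<forall>j<k. a j - b j = 0"
      using indep[rule_format, of "\<lambda>j. a j - b j"] by blast
    then show ?thesis using that(3) by simp
  qed
  have "\<exists>a. (\<forall>i<k. a i \<in> F) \<and> act x (bs j) = (\<lambda>w. \<Sum>i<k. a i * bs i w)" if "x \<in> carrier H" "j < k" for x j
    using span Vact[OF that(1)] bs that(2) by blast
  then obtain m where m: "\<And>x j i. x \<in> carrier H \<Longrightarrow> j < k \<Longrightarrow> i < k \<Longrightarrow> m x j i \<in> F"
    "\<And>x j. x \<in> carrier H \<Longrightarrow> j < k \<Longrightarrow> act x (bs j) = (\<lambda>w. \<Sum>i<k. m x j i * bs i w)"
    by metis
  define E' where "E' = (\<lambda>x. mat k k (\<lambda>(i, j). m x j i))"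
  have E'c: "E' x \<in> carrier_mat k k" for x by (simp add: E'_def)
  have act_comb: "act x (\<lambda>w. \<Sum>j<k. a j * bs j w) = (\<lambda>w. \<Sum>i<k. (\<Sum>j<k. m x j i * a j) * bs i w)"
    if "x \<in> carrier H" for x a
  proof -
    have "(\<Sum>j<k. a j * act x (bs j) w) = (\<Sum>i<k. (\<Sum>j<k. m x j i * a j) * bs i w)" for w
    proof -
      have "(\<Sum>j<k. a j * act x (bs j) w) = (\<Sum>j<k. \<Sum>i<k. a j * (m x j i * bs i w))"
        using m(2)[OF that] by (auto simp: sum_distrib_left)
      also have "\<dots> = (\<Sum>i<k. (\<Sum>j<k. m x j i * a j) * bs i w)"
        by (subst sum.swap) (simp add: sum_distrib_right sum_distrib_left mult_ac)
      finally show ?thesis .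
    qed
    then show ?thesis unfolding act_sum by simp
  qed
  have rep: "group_mrep H k E'"
    unfolding group_mrep_def
  proof (intro conjI ballI)
    show "E' w \<in> mats_over F k" if "w \<in> carrier H" for w
      using m(1)[OF that] by (intro mats_overI) (auto simp: E'_def)
    have act_one: "act \<one> v = v" if "v \<in> V" for v
    proof
      fix w
      have "v \<in> funs_over F (carrier H)" using that Vk by (auto simp: killed_def)
      then show "act \<one> v w = v w" by (auto simp: act_def funs_over_def)
    qed
    show "E' \<one> = 1\<^sub>m k"
    proof (rule eq_matI)
      fix i j assume "i < dim_row (1\<^sub>m k)" "j < dim_col (1\<^sub>m k :: complex mat)"
      then have ij: "i < k" "j < k" by auto
      have "m \<one> j i = (if i = j then 1 else 0)"
      proof (rule coeff_eq[of "m \<one> j" "\<lambda>i. if i = j then 1 else 0"])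
        fix x
        have "(\<Sum>i<k. m \<one> j i * bs i x) = bs j x"
          using m(2)[of \<one> j] ij act_one[of "bs j"] bs by (metis one_closed)
        then show "(\<Sum>i<k. m \<one> j i * bs i x) = (\<Sum>i<k. (if i = j then 1 else 0) * bs i x)"
          using ij by (simp add: sum_delta_mult)
      qed (use m(1) ij F_closed in auto)
      then show "E' \<one> $$ (i, j) = 1\<^sub>m k $$ (i, j)"
        using ij by (simp add: E'_def)
    qed (auto simp: E'_def)
    fix x y assume xy: "x \<in> carrier H" "y \<in> carrier H"
    show "E' (x \<otimes> y) = E' x * E' y"
    proof (rule eq_matI)
      fix i j assume "i < dim_row (E' x * E' y)" "j < dim_col (E' x * E' y)"
      then have ij: "i < k" "j < k" by (auto simp: E'_def)
      have "m (x \<otimes> y) j i = (\<Sum>l<k. m x l i * m y j l)"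
      proof (rule coeff_eq[of "m (x \<otimes> y) j" "\<lambda>i. \<Sum>l<k. m x l i * m y j l"])
        fix w
        have "(\<lambda>w. \<Sum>i<k. m (x \<otimes> y) j i * bs i w) = act x (act y (bs j))"
          using m(2)[of "x \<otimes> y" j] act_mult[OF xy] xy ij by simp
        also have "\<dots> = (\<lambda>w. \<Sum>i<k. (\<Sum>l<k. m x l i * m y j l) * bs i w)"
          using m(2)[OF xy(2) ij(2)] act_comb[OF xy(1)] by simp
        finally show "(\<Sum>i<k. m (x \<otimes> y) j i * bs i w) = (\<Sum>i<k. (\<Sum>l<k. m x l i * m y j l) * bs i w)"
          by metis
      qed (use m(1) ij xy in \<open>auto intro!: F_closed\<close>)
      then show "E' (x \<otimes> y) $$ (i, j) = (E' x * E' y) $$ (i, j)"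
        using ij by (simp add: E'_def scalar_prod_def atLeast0LessThan)
    qed (auto simp: E'_def)
  qed
  have kpos: "0 < k"
  proof (rule ccontr)
    assume "\<not> 0 < k"
    then have "V \<subseteq> {\<lambda>_. 0}" using span by auto
    then show False using V0 Vs by (auto simp: fun_subspace_def)
  qed
  have irr: "irreducible_mats F k (carrier H) E'"
    unfolding irreducible_mats_def
  proof (intro conjI allI impI)
    fix S assume S: "S \<subseteq> vecs_over F k \<and> 0\<^sub>v k \<in> S \<and> (\<forall>u\<in>S. \<forall>v\<in>S. u + v \<in> S) \<and>
      (\<forall>c\<in>F. \<forall>v\<in>S. c \<cdot>\<^sub>v v \<in> S) \<and> (\<forall>x\<in>carrier H. \<forall>v\<in>S. E' x *\<^sub>v v \<in> S)"
    define g where "g = (\<lambda>v :: complex vec. \<lambda>w. \<Sum>j<k. v $ j * bs j w)"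
    have Sd: "v \<in> carrier_vec k" "\<forall>j<k. v $ j \<in> F" if "v \<in> S" for v
      using that S by (auto simp: vecs_over_def)
    show "S = {0\<^sub>v k} \<or> S = vecs_over F k"
    proof (cases "S = {0\<^sub>v k}")
      case False
      then obtain v0 where v0: "v0 \<in> S" "v0 \<noteq> 0\<^sub>v k" using S by blast
      have "Q (g ` S)"
        unfolding Q_def fun_subspace_def
      proof (intro conjI ballI)
        show "(\<lambda>_. 0) \<in> g ` S"
          using S by (intro image_eqI[of _ _ "0\<^sub>v k"]) (auto simp: g_def)
        show "(\<lambda>x. u x + v x) \<in> g ` S" if uv: "u \<in> g ` S" "v \<in> g ` S" for u v
        proof -
          obtain u' v' where u'v': "u' \<in> S" "v' \<in> S" "u = g u'" "v = g v'" using uv by auto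
          have "(\<lambda>x. u x + v x) = g (u' + v')"
            unfolding u'v' g_def using Sd(1)[OF u'v'(1)] Sd(1)[OF u'v'(2)]
            by (auto simp: distrib_right sum.distrib)
          then show ?thesis using S u'v' by blast
        qed
        show "(\<lambda>x. c * u x) \<in> g ` S" if cu: "c \<in> F" "u \<in> g ` S" for c u
        proof -
          obtain u' where u': "u' \<in> S" "u = g u'" using cu by auto
          have "(\<lambda>x. c * u x) = g (c \<cdot>\<^sub>v u')"
            unfolding u' g_def using Sd(1)[OF u'(1)] by (auto simp: sum_distrib_left mult.assoc)
          then show ?thesis using S u' cu by blast
        qed
        have gV: "g v \<in> V" if "v \<in> S" for v
          unfolding g_def using fun_subspace_sum[OF Vs, of "{..<k}" "\<lambda>j. v $ j" bs] Sd[OF that] bs by simp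
        then show "g ` S \<subseteq> killed"
          using Vk by blast
        show "act x v \<in> g ` S" if xv: "x \<in> carrier H" "v \<in> g ` S" for x v
        proof -
          obtain v' where v': "v' \<in> S" "v = g v'" using xv by auto
          have "act x v = g (E' x *\<^sub>v v')"
            unfolding v' g_def act_comb[OF xv(1)] using Sd(1)[OF v'(1)]
            by (auto simp: E'_def scalar_prod_def atLeast0LessThan)
          then show ?thesis using S v' xv by blast
        qed
        show "g ` S \<noteq> {\<lambda>_. 0}"
        proof
          assume "g ` S = {\<lambda>_. 0}"
          then have "g v0 = (\<lambda>_. 0)" using v0 by blast
          then have "\<forall>x. (\<Sum>j<k. v0 $ j * bs j x) = 0" unfolding g_def by metis
          then have "\<forall>j<k. v0 $ j = 0"
            using indep[rule_format, of "\<lambda>j. v0 $ j"] Sd[OF v0(1)] by blast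
          then have "v0 = 0\<^sub>v k" using Sd[OF v0(1)] by (intro eq_vecI) auto
          then show False using v0 by simp
        qed
      qed
      moreover have "g ` S \<subseteq> V"
        unfolding g_def using fun_subspace_sum[OF Vs, of "{..<k}" "\<lambda>j. _ $ j" bs] Sd bs by auto
      ultimately have gS: "g ` S = V" by (rule V(2))
      have "vecs_over F k \<subseteq> S"
      proof
        fix v assume "v \<in> vecs_over F k"
        then have v: "v \<in> carrier_vec k" "\<forall>j<k. v $ j \<in> F" by (auto simp: vecs_over_def)
        have "g v \<in> V"
          unfolding g_def using fun_subspace_sum[OF Vs, of "{..<k}" "\<lambda>j. v $ j" bs] v bs by simp
        then obtain v' where v': "v' \<in> S" "g v = g v'" using gS by (metis imageE)
        have "v $ j = v' $ j" if "j < k" for j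
          using coeff_eq[of "\<lambda>j. v $ j" "\<lambda>j. v' $ j" j] v Sd[OF v'(1)] that v'(2) unfolding g_def by metis
        then have "v = v'" using v Sd[OF v'(1)] by (intro eq_vecI) auto
        then show "v \<in> S" using v' by simp
      qed
      then show ?thesis using S by blast
    qed simp
  qed (rule kpos)
  have "group_irrep H k E'"
    using rep irr by (simp add: group_irrep_def)
  then obtain \<mu> P where \<mu>: "\<mu> \<in> \<Lambda>" "k = d \<mu>" and P: "P \<in> mats_over F k" "det P \<noteq> 0"
    and PE: "\<And>w. w \<in> carrier H \<Longrightarrow> P * E' w = E \<mu> w * P"
    using irreps unfolding irreps_indexed_by_def group_rep_equiv_def by metis
  have Pc: "P \<in> carrier_mat k k" using P mats_overD by blast
  then obtain Q' where Q': "Q' \<in> carrier_mat k k" "Q' * P = 1\<^sub>m k"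
    using det_non_zero_imp_unit[OF Pc P(2)] by (auto simp: Units_def ring_mat_def)
  have E'Q: "E' w $$ (i, j) = (\<Sum>p<k. \<Sum>q<k. Q' $$ (i, p) * e \<mu> w p q * P $$ (q, j))"
    if "w \<in> carrier H" "i < k" "j < k" for w i j
  proof -
    have Ec: "E \<mu> w \<in> carrier_mat k k" using E_carrier[OF \<mu>(1) that(1)] \<mu> by simp
    have "E' w = Q' * (E \<mu> w * P)"
      using Q' PE[OF that(1)] Pc E'c[of w] by (metis assoc_mult_mat left_mult_one_mat)
    then show ?thesis
      using that Q'(1) Pc Ec
      by (simp add: scalar_prod_def atLeast0LessThan e_def sum_distrib_left mult.assoc)
  qed
  have "(\<Sum>w\<in>carrier H. idem w * E' w $$ (i, j)) = (if i = j then 1 else 0)" if "i < k" "j < k" for i j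
  proof -
    have "(\<Sum>w\<in>carrier H. idem w * E' w $$ (i, j)) =
      (\<Sum>w\<in>carrier H. \<Sum>p<k. \<Sum>q<k. Q' $$ (i, p) * P $$ (q, j) * (idem w * e \<mu> w p q))"
      by (rule sum.cong) (use E'Q that in \<open>auto simp: sum_distrib_left mult_ac\<close>)
    also have "\<dots> = (\<Sum>p<k. \<Sum>q<k. Q' $$ (i, p) * P $$ (q, j) * (\<Sum>w\<in>carrier H. idem w * e \<mu> w p q))"
      by (simp add: sum_distrib_left sum.swap[of _ "carrier H"])
    also have "\<dots> = (\<Sum>p<k. \<Sum>q<k. Q' $$ (i, p) * P $$ (q, j) * (if p = q then 1 else 0))"
      using idem_acts_as_one[OF \<mu>(1)] \<mu>(2) by simp
    also have "\<dots> = (\<Sum>p<k. Q' $$ (i, p) * P $$ (p, j))"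
      by (simp add: sum_delta_mult)
    also have "\<dots> = (Q' * P) $$ (i, j)"
      using that Q'(1) Pc by (simp add: scalar_prod_def atLeast0LessThan)
    finally show ?thesis using Q'(2) that by simp
  qed
  then have idE': "(\<Sum>w\<in>carrier H. idem w * m w j i) = (if i = j then 1 else 0)" if "i < k" "j < k" for i j
    using that by (simp add: E'_def)
  have "bs 0 w = 0" for w
  proof (cases "w \<in> carrier H")
    case True
    have "0 = (\<Sum>x\<in>carrier H. idem x * act x (bs 0) w)"
      using idem_kills_killed[OF _ True] bs kpos Vk by auto
    also have "\<dots> = (\<Sum>x\<in>carrier H. \<Sum>i<k. idem x * m x 0 i * bs i w)"
      by (rule sum.cong) (use m(2) kpos in \<open>auto simp: sum_distrib_left mult.assoc\<close>)
    also have "\<dots> = (\<Sum>i<k. (\<Sum>x\<in>carrier H. idem x * m x 0 i) * bs i w)"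
      by (subst sum.swap) (simp add: sum_distrib_right)
    also have "\<dots> = (\<Sum>i<k. (if i = 0 then 1 else 0) * bs i w)"
      by (rule sum.cong) (use idE' kpos in auto)
    also have "\<dots> = bs 0 w"
      using kpos by (simp add: sum_delta_mult)
    finally show ?thesis by simp
  next
    case False
    then show ?thesis using bs kpos Vk by (auto simp: killed_def funs_over_def)
  qed
  then have "\<forall>x. (\<Sum>j<k. (if j = 0 then 1 else 0) * bs j x) = 0"
    using kpos by (simp add: sum_delta_mult)
  moreover have "\<forall>j<k. (if j = 0 then 1 else 0) \<in> F"
    using F_closed(1,2) by auto
  ultimately have "(if 0 = (0::nat) then 1 else 0 :: complex) = 0"
    using F_closed(1) kpos by (intro coeff_eq[of "\<lambda>j. if j = 0 then 1 else 0" "\<lambda>_. 0" 0]) auto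
  then show False
    by simp
qed

lemma idem_eq:
  assumes w: "w \<in> carrier H"
  shows "idem w = (if w = \<one> then 1 else 0)"
proof -
  define u where "u = (\<lambda>w. if w \<in> carrier H then idem w + (- 1) * (if w = \<one> then 1 else 0) else 0)"
  have "u \<in> killed"
    unfolding killed_def
  proof (intro CollectI conjI ballI allI impI)
    show "u \<in> funs_over F (carrier H)"
      by (auto simp: u_def funs_over_def intro!: F_closed idem_F)
    fix \<mu> i j assume \<mu>: "\<mu> \<in> \<Lambda>" and ij: "i < d \<mu>" "j < d \<mu>"
    have "(\<Sum>w\<in>carrier H. u w * e \<mu> w i j) =
        (\<Sum>w\<in>carrier H. idem w * e \<mu> w i j) - (\<Sum>w\<in>carrier H. (if w = \<one> then 1 else 0) * e \<mu> w i j)"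
      unfolding sum_subtractf[symmetric] by (rule sum.cong) (auto simp: u_def algebra_simps)
    also have "\<dots> = 0"
      using idem_acts_as_one[OF \<mu> ij] e_one[OF \<mu> ij] finite_carrier by (simp add: sum_delta_mult)
    finally show "(\<Sum>w\<in>carrier H. u w * e \<mu> w i j) = 0" .
  qed
  from fun_cong[OF killed_trivial[OF this], of w] show ?thesis
    using w by (auto simp: u_def split: if_splits)
qed

theorem sum_dim_character:
  assumes w: "w \<in> carrier H"
  shows "(\<Sum>\<mu>\<in>\<Lambda>. of_nat (d \<mu>) * mtrace (E \<mu> w)) = (if w = \<one> then order_W else 0)"
proof -
  have "(\<Sum>\<mu>\<in>\<Lambda>. of_nat (d \<mu>) * mtrace (E \<mu> w)) = order_W * idem (inv w)"
    unfolding idem_def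
  proof (subst sum_distrib_left, rule sum.cong)
    fix \<mu> assume "\<mu> \<in> \<Lambda>"
    then have "dim_row (E \<mu> w) = d \<mu>"
      using E_carrier w by blast
    then show "of_nat (d \<mu>) * mtrace (E \<mu> w) =
        order_W * (of_nat (d \<mu>) / order_W * (\<Sum>i<d \<mu>. e \<mu> (inv (inv w)) i i))"
      using w order_W_neq_0 by (simp add: mtrace_def e_def)
  qed simp
  also have "\<dots> = (if w = \<one> then order_W else 0)"
    using idem_eq[of "inv w"] w inv_eq_1_iff by auto
  finally show ?thesis .
qed

theorem card_matrix_entries: "card (SIGMA \<mu>:\<Lambda>. {..<d \<mu>} \<times> {..<d \<mu>}) = card (carrier H)"
proof (rule inverse_matrices_card_eq[symmetric, where
    M = "\<lambda>w (\<mu>, i, j). e \<mu> w i j" and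
    N = "\<lambda>(\<mu>, i, j) w. of_nat (d \<mu>) / order_W * e \<mu> (inv w) j i"])
  fix w assume w: "w \<in> carrier H"
  have "(\<Sum>y\<in>(SIGMA \<mu>:\<Lambda>. {..<d \<mu>} \<times> {..<d \<mu>}). (case y of (\<mu>, i, j) \<Rightarrow> e \<mu> w i j) *
      (case y of (\<mu>, i, j) \<Rightarrow> \<lambda>w. of_nat (d \<mu>) / order_W * e \<mu> (inv w) j i) w) =
      (\<Sum>\<mu>\<in>\<Lambda>. \<Sum>i<d \<mu>. \<Sum>j<d \<mu>. e \<mu> w i j * (of_nat (d \<mu>) / order_W * e \<mu> (inv w) j i))"
    using finite_Lambda by (simp add: sum_matrix_entries)
  also have "\<dots> = (\<Sum>\<mu>\<in>\<Lambda>. of_nat (d \<mu>) / order_W * (\<Sum>i<d \<mu>. e \<mu> (inv \<one>) i i))"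
  proof (rule sum.cong)
    fix \<mu> assume \<mu>: "\<mu> \<in> \<Lambda>"
    have "e \<mu> \<one> i i = (\<Sum>j<d \<mu>. e \<mu> w i j * e \<mu> (inv w) j i)" if "i < d \<mu>" for i
      using e_mult[OF \<mu> w _ that that, of "inv w"] w by simp
    then show "(\<Sum>i<d \<mu>. \<Sum>j<d \<mu>. e \<mu> w i j * (of_nat (d \<mu>) / order_W * e \<mu> (inv w) j i)) =
        of_nat (d \<mu>) / order_W * (\<Sum>i<d \<mu>. e \<mu> (inv \<one>) i i)"
      by (simp add: sum_distrib_left mult_ac)
  qed simp
  also have "\<dots> = idem \<one>" by (simp add: idem_def)
  finally show "(\<Sum>y\<in>(SIGMA \<mu>:\<Lambda>. {..<d \<mu>} \<times> {..<d \<mu>}). (case y of (\<mu>, i, j) \<Rightarrow> e \<mu> w i j) *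
      (case y of (\<mu>, i, j) \<Rightarrow> \<lambda>w. of_nat (d \<mu>) / order_W * e \<mu> (inv w) j i) w) = 1"
    using idem_eq[of \<one>] by simp
next
  fix y assume "y \<in> (SIGMA \<mu>:\<Lambda>. {..<d \<mu>} \<times> {..<d \<mu>})"
  then obtain \<mu> i j where y: "y = (\<mu>, i, j)" "\<mu> \<in> \<Lambda>" "i < d \<mu>" "j < d \<mu>" by auto
  have "(\<Sum>w\<in>carrier H. of_nat (d \<mu>) / order_W * e \<mu> (inv w) j i * e \<mu> w i j) =
      of_nat (d \<mu>) / order_W * (\<Sum>w\<in>carrier H. e \<mu> w i j * e \<mu> (inv w) j i)"
    by (simp add: sum_distrib_left mult_ac)
  then show "(\<Sum>w\<in>carrier H. (case y of (\<mu>, i, j) \<Rightarrow> \<lambda>w. of_nat (d \<mu>) / order_W * e \<mu> (inv w) j i) w *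
      (case y of (\<mu>, i, j) \<Rightarrow> e \<mu> w i j)) = 1"
    using Schur_eq[OF y(2-4) y(4,3)] y order_W_neq_0 d_pos[OF y(2)] by simp
qed (use finite_carrier finite_Lambda in auto)

end

section \<open>The group algebra of the weights and its residue map\<close>

lemma poly_mapping_eq_sum_single:
  "a = (\<Sum>g\<in>Poly_Mapping.keys a. Poly_Mapping.single g (poly_mapping.lookup a g))"
proof (rule poly_mapping_eqI)
  fix k
  have "poly_mapping.lookup (\<Sum>g\<in>Poly_Mapping.keys a. Poly_Mapping.single g (poly_mapping.lookup a g)) k
    = (\<Sum>g\<in>Poly_Mapping.keys a. if g = k then poly_mapping.lookup a g else 0)"
    by (auto simp: lookup_sum lookup_single when_def intro!: sum.cong)
  then show "poly_mapping.lookup a k =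
      poly_mapping.lookup (\<Sum>g\<in>Poly_Mapping.keys a. Poly_Mapping.single g (poly_mapping.lookup a g)) k"
    by (simp add: in_keys_iff)
qed

lemma poly_mapping_mult_eq_sum:
  "a * b = (\<Sum>g\<in>Poly_Mapping.keys a. \<Sum>h\<in>Poly_Mapping.keys b.
    Poly_Mapping.single (g + h) (poly_mapping.lookup a g * poly_mapping.lookup b h))"
proof -
  have "a * b = (\<Sum>g\<in>Poly_Mapping.keys a. Poly_Mapping.single g (poly_mapping.lookup a g)) *
      (\<Sum>h\<in>Poly_Mapping.keys b. Poly_Mapping.single h (poly_mapping.lookup b h))"
    using poly_mapping_eq_sum_single[of a] poly_mapping_eq_sum_single[of b] by simp
  then show ?thesis
    by (simp add: sum_product mult_single)
qed

lemma theta1_superset: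
  assumes "finite K" "Poly_Mapping.keys a \<subseteq> K"
  shows "theta1 a = (\<Sum>g\<in>K. poly_mapping.lookup a g)"
  unfolding theta1_def using assms by (intro sum.mono_neutral_left) (auto simp: in_keys_iff)

lemma theta1_add: "theta1 (a + b) = theta1 a + theta1 b"
proof -
  have "Poly_Mapping.keys (a + b) \<subseteq> Poly_Mapping.keys a \<union> Poly_Mapping.keys b"
    by (rule keys_add)
  then show ?thesis
    by (simp add: theta1_superset[of "Poly_Mapping.keys a \<union> Poly_Mapping.keys b"] lookup_add sum.distrib)
qed

lemma theta1_zero [simp]: "theta1 0 = 0"
  by (simp add: theta1_def)

lemma theta1_single [simp]: "theta1 (Poly_Mapping.single g c) = c"
  by (simp add: theta1_superset[of "{g}"])

lemma theta1_sum: "theta1 (sum f I) = (\<Sum>i\<in>I. theta1 (f i))"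
  by (induction I rule: infinite_finite_induct) (simp_all add: theta1_add)

lemma theta1_mult: "theta1 (a * b) = theta1 a * theta1 b"
  unfolding poly_mapping_mult_eq_sum theta1_sum theta1_single
  by (simp add: theta1_def sum_product)

lemma theta1_diff: "theta1 (a - b) = theta1 a - theta1 b"
  using theta1_add[of "a - b" b] by simp

lemma theta1_one [simp]: "theta1 1 = 1"
  using theta1_single[of 0 1] by simp

lemma comm_ring_hom_theta1: "comm_ring_hom (theta1 :: ('g::comm_monoid_add \<Rightarrow>\<^sub>0 complex) \<Rightarrow> complex)"
  by unfold_locales (simp_all add: theta1_add theta1_mult)

lemma lookup_ring_bar: "poly_mapping.lookup (ring_bar a) g = poly_mapping.lookup a (- g)"
proof -
  have "(- h = g) = (h = - g)" for h
    by auto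
  then have "poly_mapping.lookup (ring_bar a) g =
      (\<Sum>h\<in>Poly_Mapping.keys a. if h = - g then poly_mapping.lookup a h else 0)"
    unfolding ring_bar_def lookup_sum lookup_single when_def
    by (intro sum.cong) auto
  then show ?thesis by (simp add: in_keys_iff)
qed

lemma ring_bar_add: "ring_bar (a + b) = ring_bar a + ring_bar b"
  by (rule poly_mapping_eqI) (simp add: lookup_ring_bar lookup_add)

lemma ring_bar_zero [simp]: "ring_bar 0 = 0"
  by (rule poly_mapping_eqI) (simp add: lookup_ring_bar)

lemma ring_bar_minus: "ring_bar (- a) = - ring_bar a"
  by (rule poly_mapping_eqI) (simp add: lookup_ring_bar)

lemma ring_bar_diff: "ring_bar (a - b) = ring_bar a - ring_bar b"
  by (rule poly_mapping_eqI) (simp add: lookup_ring_bar lookup_minus)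

lemma ring_bar_single [simp]: "ring_bar (Poly_Mapping.single g c) = Poly_Mapping.single (- g) c"
  by (rule poly_mapping_eqI) (auto simp: lookup_ring_bar lookup_single when_def)

lemma ring_bar_one [simp]: "ring_bar 1 = 1"
  using ring_bar_single[of 0 1] by simp

lemma ring_bar_sum: "ring_bar (sum f I) = (\<Sum>i\<in>I. ring_bar (f i))"
  by (induction I rule: infinite_finite_induct) (simp_all add: ring_bar_add)

lemma ring_bar_mult: "ring_bar (a * b) = ring_bar a * ring_bar b"
  unfolding poly_mapping_mult_eq_sum[of a b] ring_bar_sum ring_bar_single
  by (simp add: ring_bar_def sum_product mult_single add.commute)

lemma is_subring_group_ring:
  assumes R: "is_subring R"
  shows "is_subring (group_ring R :: ('g::linordered_ab_group_add \<Rightarrow>\<^sub>0 complex) set)"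
  unfolding is_subring_def
proof (intro conjI ballI)
  note cl = is_subring_closed[OF R]
  show "1 \<in> group_ring R"
    using cl by (auto simp: group_ring_def lookup_one when_def)
  fix x y :: "'g \<Rightarrow>\<^sub>0 complex"
  assume xy: "x \<in> group_ring R" "y \<in> group_ring R"
  then show "x - y \<in> group_ring R"
    using cl by (auto simp: group_ring_def lookup_minus)
  show "x * y \<in> group_ring R"
    using xy unfolding group_ring_def poly_mapping_mult_eq_sum[of x y]
    by (auto simp: lookup_sum lookup_single when_def intro!: cl)
qed

lemma single_group_ring: "is_subring R \<Longrightarrow> c \<in> R \<Longrightarrow> Poly_Mapping.single g c \<in> group_ring R"
  using is_subring_closed(1)[of R] by (auto simp: group_ring_def lookup_single when_def)

lemma ring_bar_group_ring: "a \<in> group_ring R \<Longrightarrow> ring_bar a \<in> group_ring R"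
  by (auto simp: group_ring_def lookup_ring_bar)

definition pos_supp :: "('g::linordered_ab_group_add \<Rightarrow>\<^sub>0 'a::zero) \<Rightarrow> bool" where
  "pos_supp p \<longleftrightarrow> (\<forall>g\<in>Poly_Mapping.keys p. 0 < g)"

definition nonneg_supp :: "('g::linordered_ab_group_add \<Rightarrow>\<^sub>0 'a::zero) \<Rightarrow> bool" where
  "nonneg_supp p \<longleftrightarrow> (\<forall>g\<in>Poly_Mapping.keys p. 0 \<le> g)"

lemma group_ring_pos_iff: "p \<in> group_ring_pos R \<longleftrightarrow> p \<in> group_ring R \<and> pos_supp p"
  by (simp add: group_ring_pos_def pos_supp_def)

lemma pos_supp_imp_nonneg: "pos_supp p \<Longrightarrow> nonneg_supp p"
  by (auto simp: pos_supp_def nonneg_supp_def)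

lemma pos_supp_zero [simp]: "pos_supp 0" and nonneg_supp_zero [simp]: "nonneg_supp 0"
  by (simp_all add: pos_supp_def nonneg_supp_def)

lemma nonneg_supp_one [simp]: "nonneg_supp (1 :: 'g::linordered_ab_group_add \<Rightarrow>\<^sub>0 'a::zero_neq_one)"
  by (simp add: nonneg_supp_def)

lemma pos_supp_add: "pos_supp p \<Longrightarrow> pos_supp q \<Longrightarrow> pos_supp (p + q)"
  and nonneg_supp_add: "nonneg_supp p \<Longrightarrow> nonneg_supp q \<Longrightarrow> nonneg_supp (p + q)"
  using keys_add[of p q] by (auto simp: pos_supp_def nonneg_supp_def)

lemma pos_supp_uminus: "pos_supp p \<Longrightarrow> pos_supp (- p)" for p :: "_ \<Rightarrow>\<^sub>0 'a::ab_group_add"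
  by (auto simp: pos_supp_def in_keys_iff)

lemma pos_supp_sum: "(\<And>i. i \<in> I \<Longrightarrow> pos_supp (f i)) \<Longrightarrow> pos_supp (sum f I)"
  by (induction I rule: infinite_finite_induct) (auto intro: pos_supp_add)

lemma pos_supp_mult_nonneg:
  fixes p q :: "'g::linordered_ab_group_add \<Rightarrow>\<^sub>0 'a::comm_semiring_0"
  assumes "pos_supp p" "nonneg_supp q" shows "pos_supp (p * q)"
  unfolding pos_supp_def
proof
  fix g assume "g \<in> Poly_Mapping.keys (p * q)"
  then obtain a b where "a \<in> Poly_Mapping.keys p" "b \<in> Poly_Mapping.keys q" "g = a + b"
    using keys_mult[of p q] by blast
  then show "0 < g"
    using assms by (auto simp: pos_supp_def nonneg_supp_def intro: add_pos_nonneg)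
qed

lemma nonneg_supp_mult:
  fixes p q :: "'g::linordered_ab_group_add \<Rightarrow>\<^sub>0 'a::comm_semiring_0"
  assumes "nonneg_supp p" "nonneg_supp q" shows "nonneg_supp (p * q)"
  unfolding nonneg_supp_def
proof
  fix g assume "g \<in> Poly_Mapping.keys (p * q)"
  then obtain a b where "a \<in> Poly_Mapping.keys p" "b \<in> Poly_Mapping.keys q" "g = a + b"
    using keys_mult[of p q] by blast
  then show "0 \<le> g"
    using assms by (auto simp: nonneg_supp_def)
qed

lemma pos_supp_lookup_0: "pos_supp p \<Longrightarrow> poly_mapping.lookup p 0 = 0"
  by (auto simp: pos_supp_def in_keys_iff)

lemma nonneg_supp_single: "0 \<le> g \<Longrightarrow> nonneg_supp (Poly_Mapping.single g c)"
  by (auto simp: nonneg_supp_def split: if_splits)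

lemma nonneg_supp_one_plus:
  fixes q :: "'g::linordered_ab_group_add \<Rightarrow>\<^sub>0 'a::comm_ring_1"
  shows "pos_supp q \<Longrightarrow> nonneg_supp (1 + q)"
  by (simp add: nonneg_supp_add pos_supp_imp_nonneg)

lemma nonneg_supp_split:
  fixes p :: "'g::linordered_ab_group_add \<Rightarrow>\<^sub>0 'a::ab_group_add"
  assumes "nonneg_supp p"
  obtains q where "pos_supp q" "p = Poly_Mapping.single 0 (poly_mapping.lookup p 0) + q"
proof
  show "pos_supp (p - Poly_Mapping.single 0 (poly_mapping.lookup p 0))"
    using assms unfolding pos_supp_def nonneg_supp_def
    by (auto simp: in_keys_iff lookup_minus lookup_single when_def order_less_le split: if_splits)
qed simp

lemma nonneg_supp_lookup_mult:
  fixes p q :: "'g::linordered_ab_group_add \<Rightarrow>\<^sub>0 'a::comm_ring"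
  assumes "nonneg_supp p" "nonneg_supp q"
  shows "poly_mapping.lookup (p * q) 0 = poly_mapping.lookup p 0 * poly_mapping.lookup q 0"
proof -
  obtain p' where p': "pos_supp p'" "p = Poly_Mapping.single 0 (poly_mapping.lookup p 0) + p'"
    using nonneg_supp_split assms by blast
  obtain q' where q': "pos_supp q'" "q = Poly_Mapping.single 0 (poly_mapping.lookup q 0) + q'"
    using nonneg_supp_split assms by blast
  have "p * q = Poly_Mapping.single 0 (poly_mapping.lookup p 0) * Poly_Mapping.single 0 (poly_mapping.lookup q 0)
      + q' * Poly_Mapping.single 0 (poly_mapping.lookup p 0) + p' * q"
    using p'(2) q'(2) by (metis (no_types, lifting) distrib_left distrib_right mult.commute)
  moreover have "poly_mapping.lookup (q' * Poly_Mapping.single 0 (poly_mapping.lookup p 0)) 0 = 0"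
    "poly_mapping.lookup (p' * q) 0 = 0"
    using p' q' assms by (auto intro!: pos_supp_lookup_0 pos_supp_mult_nonneg nonneg_supp_single)
  ultimately show ?thesis
    by (simp add: lookup_add mult_single)
qed

lemma one_plus_pos_neq_0:
  fixes q :: "'g::linordered_ab_group_add \<Rightarrow>\<^sub>0 'a::comm_ring_1"
  assumes "pos_supp q" shows "1 + q \<noteq> 0"
proof
  assume "1 + q = 0"
  then have "poly_mapping.lookup (1 + q) 0 = 0" by simp
  then show False using pos_supp_lookup_0[OF assms] by (simp add: lookup_add)
qed

text \<open>The residue map of the valuation ring, with numerators and denominators in the full
  group algebra over the complex numbers.\<close>

definition residue_eq :: "('g::linordered_ab_group_add \<Rightarrow>\<^sub>0 complex) fract \<Rightarrow> complex \<Rightarrow> bool" where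
  "residue_eq x r \<longleftrightarrow> (\<exists>n q. nonneg_supp n \<and> pos_supp q \<and> x = Fract n (1 + q) \<and> poly_mapping.lookup n 0 = r)"

lemma residue_eq_unique:
  assumes "residue_eq x r" "residue_eq x r'"
  shows "r = r'"
proof -
  obtain n q n' q' where n: "nonneg_supp n" "pos_supp q" "x = Fract n (1 + q)" "poly_mapping.lookup n 0 = r"
    and n': "nonneg_supp n'" "pos_supp q'" "x = Fract n' (1 + q')" "poly_mapping.lookup n' 0 = r'"
    using assms by (auto simp: residue_eq_def)
  have nn: "nonneg_supp (1 + q)" "nonneg_supp (1 + q')"
    using n n' by (simp_all add: nonneg_supp_one_plus)
  have "n * (1 + q') = n' * (1 + q)"
    using n(2,3) n'(2,3) one_plus_pos_neq_0[OF n(2)] one_plus_pos_neq_0[OF n'(2)] by (simp add: eq_fract)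
  then have "poly_mapping.lookup (n * (1 + q')) 0 = poly_mapping.lookup (n' * (1 + q)) 0"
    by simp
  then show ?thesis
    using n n' nn by (simp add: nonneg_supp_lookup_mult lookup_add pos_supp_lookup_0)
qed

lemma residue_eq_add:
  assumes "residue_eq x r" "residue_eq y s"
  shows "residue_eq (x + y) (r + s)"
proof -
  obtain n q n' q' where n: "nonneg_supp n" "pos_supp q" "x = Fract n (1 + q)" "poly_mapping.lookup n 0 = r"
    and n': "nonneg_supp n'" "pos_supp q'" "y = Fract n' (1 + q')" "poly_mapping.lookup n' 0 = s"
    using assms by (auto simp: residue_eq_def)
  have nn: "nonneg_supp (1 + q)" "nonneg_supp (1 + q')"
    using n n' by (simp_all add: nonneg_supp_one_plus)
  have "x + y = Fract (n * (1 + q') + n' * (1 + q)) (1 + (q * (1 + q') + q'))"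
    using n(2,3) n'(2,3) one_plus_pos_neq_0[OF n(2)] one_plus_pos_neq_0[OF n'(2)]
    by (simp add: algebra_simps)
  moreover have "pos_supp (q * (1 + q') + q')"
    using n n' nn by (intro pos_supp_add pos_supp_mult_nonneg)
  moreover have "poly_mapping.lookup (n * (1 + q') + n' * (1 + q)) 0 = r + s"
    using n n' nn by (simp add: nonneg_supp_lookup_mult lookup_add pos_supp_lookup_0)
  moreover have "nonneg_supp (n * (1 + q') + n' * (1 + q))"
    using n n' nn by (simp add: nonneg_supp_add nonneg_supp_mult)
  ultimately show ?thesis
    unfolding residue_eq_def by blast
qed

lemma residue_eq_mult:
  assumes "residue_eq x r" "residue_eq y s"
  shows "residue_eq (x * y) (r * s)"
proof -
  obtain n q n' q' where n: "nonneg_supp n" "pos_supp q" "x = Fract n (1 + q)" "poly_mapping.lookup n 0 = r"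
    and n': "nonneg_supp n'" "pos_supp q'" "y = Fract n' (1 + q')" "poly_mapping.lookup n' 0 = s"
    using assms by (auto simp: residue_eq_def)
  have nn: "nonneg_supp (1 + q)" "nonneg_supp (1 + q')"
    using n n' by (simp_all add: nonneg_supp_one_plus)
  have "x * y = Fract (n * n') (1 + (q * (1 + q') + q'))"
    using n(2,3) n'(2,3) one_plus_pos_neq_0[OF n(2)] one_plus_pos_neq_0[OF n'(2)]
    by (simp add: algebra_simps)
  moreover have "pos_supp (q * (1 + q') + q')"
    using n n' nn by (intro pos_supp_add pos_supp_mult_nonneg)
  moreover have "poly_mapping.lookup (n * n') 0 = r * s"
    using n n' by (simp add: nonneg_supp_lookup_mult)
  moreover have "nonneg_supp (n * n')"
    using n n' by (simp add: nonneg_supp_mult)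
  ultimately show ?thesis
    unfolding residue_eq_def by blast
qed

lemma residue_eq_to_fract: "nonneg_supp p \<Longrightarrow> residue_eq (to_fract p) (poly_mapping.lookup p 0)"
  unfolding residue_eq_def to_fract_def by (intro exI[of _ p] exI[of _ 0]) auto

lemma residue_eq_0: "residue_eq 0 0"
  using residue_eq_to_fract[of 0] by simp

lemma residue_eq_sum: "(\<And>i. i \<in> I \<Longrightarrow> residue_eq (f i) (r i)) \<Longrightarrow> residue_eq (sum f I) (sum r I)"
  by (induction I rule: infinite_finite_induct) (auto intro: residue_eq_add residue_eq_0)

lemma has_leading_residue:
  assumes "has_leading F x r g" "0 \<le> g"
  shows "residue_eq x (if g = 0 then r else 0)"
proof -
  obtain p q where pq: "pos_supp p" "pos_supp q" "x = Fract (Poly_Mapping.single g r * (1 + p)) (1 + q)"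
    using assms(1) by (auto simp: has_leading_def group_ring_pos_iff)
  have "nonneg_supp (Poly_Mapping.single g r)" "nonneg_supp (1 + p)"
    using assms pq by (simp_all add: nonneg_supp_one_plus nonneg_supp_single)
  then have "nonneg_supp (Poly_Mapping.single g r * (1 + p))"
    "poly_mapping.lookup (Poly_Mapping.single g r * (1 + p)) 0 = (if g = 0 then r else 0)"
    using pq pos_supp_lookup_0[OF pq(1)]
    by (auto simp: nonneg_supp_lookup_mult lookup_add lookup_single when_def intro: nonneg_supp_mult)
  then show ?thesis
    unfolding residue_eq_def using pq by blast
qed

lemma constant_term_residue:
  assumes "x \<in> valuation_ring R"
  shows "residue_eq x (constant_term R x)"
proof -
  have lead0: "r = s" if "has_leading (fraction_subfield R) x r 0" "residue_eq x s" for r s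
    using has_leading_residue[OF that(1)] residue_eq_unique that(2) by auto
  have ct: "constant_term R x = s" if "residue_eq x s" "s \<noteq> 0 \<longrightarrow> has_leading (fraction_subfield R) x s 0" for s
  proof (cases "\<exists>r. has_leading (fraction_subfield R) x r 0")
    case True
    then obtain r where r: "has_leading (fraction_subfield R) x r 0" by blast
    have "(THE r. has_leading (fraction_subfield R) x r 0) = s"
      by (rule the_equality) (use r lead0 that(1) in blast)+
    then show ?thesis
      unfolding constant_term_def using True by simp
  next
    case False
    then show ?thesis using that unfolding constant_term_def by auto
  qed
  from assms consider "x = 0" | r g where "has_leading (fraction_subfield R) x r g" "0 \<le> g"
    by (auto simp: valuation_ring_def)
  then show ?thesis
  proof cases
    case 1
    then have "residue_eq x 0" using residue_eq_0 by simp
    with ct[OF this] show ?thesis by simp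
  next
    case 2
    then have r: "residue_eq x (if g = 0 then r else 0)" by (rule has_leading_residue)
    have "constant_term R x = (if g = 0 then r else 0)"
      by (rule ct[OF r]) (use 2 in \<open>auto split: if_splits\<close>)
    with r show ?thesis by simp
  qed
qed

section \<open>The Hecke algebra\<close>

lemma lookup_smul [simp]: "poly_mapping.lookup (smul a h) w = a * poly_mapping.lookup h w"
  by (simp add: smul_def Poly_Mapping.map.rep_eq when_def)

lemma smul_add: "smul a (x + y) = smul a x + smul a y"
  and smul_add_left: "smul (a + b) x = smul a x + smul b x"
  and smul_diff_left: "smul (a - b) x = smul a x - smul b x"
  and smul_smul [simp]: "smul a (smul b x) = smul (a * b) x"
  and smul_one [simp]: "smul 1 x = x"
  and smul_zero_left [simp]: "smul 0 x = 0"
  and smul_zero [simp]: "smul a 0 = 0"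
  and smul_uminus_left: "smul (- a) x = - smul a x"
  by (rule poly_mapping_eqI; simp add: lookup_add lookup_minus algebra_simps)+

lemma smul_sum: "smul a (sum f I) = (\<Sum>i\<in>I. smul a (f i))"
  by (induction I rule: infinite_finite_induct) (simp_all add: smul_add)

lemma smul_sum_left: "smul (sum f I) x = (\<Sum>i\<in>I. smul (f i) x)"
  by (induction I rule: infinite_finite_induct) (simp_all add: smul_add_left)

locale hecke =
  fixes H :: "('w, 'g::linordered_ab_group_add) hecke_data" (structure)
  assumes setting: "hecke_setting H"
begin

sublocale coxeter H "gens H"
  by unfold_locales (use setting in \<open>simp add: hecke_setting_def\<close>)

abbreviation hecke_mult :: "('w, 'g) hecke_elt \<Rightarrow> ('w, 'g) hecke_elt \<Rightarrow> ('w, 'g) hecke_elt" (infixl "\<star>" 70)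
  where "x \<star> y \<equiv> hmult H x y"

abbreviation T :: "'w \<Rightarrow> ('w, 'g) hecke_elt" where "T \<equiv> hT"
abbreviation A :: "('g \<Rightarrow>\<^sub>0 complex) set" where "A \<equiv> ringA H"
abbreviation HH :: "('w, 'g) hecke_elt set" where "HH \<equiv> hecke_space H"
abbreviation coef :: "('w, 'g) hecke_elt \<Rightarrow> 'w \<Rightarrow> 'g \<Rightarrow>\<^sub>0 complex" where "coef \<equiv> poly_mapping.lookup"

lemma finite_W: "finite (carrier H)"
  using setting by (simp add: hecke_setting_def)

lemma subring_R: "is_subring (coeffs H)"
  using setting by (simp add: hecke_setting_def)

lemma subring_A: "is_subring A"
  using subring_R by (rule is_subring_group_ring)

lemmas A_closed = is_subring_closed[OF subring_A]

lemma single_A: "r \<in> coeffs H \<Longrightarrow> Poly_Mapping.single g r \<in> A"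
  using subring_R by (rule single_group_ring)

lemma hecke_product: "is_hecke_product H"
  using setting by (simp add: hecke_setting_def)

lemma coef_A: "h \<in> HH \<Longrightarrow> coef h w \<in> A"
  by (simp add: hecke_space_def)

lemma coef_outside: "h \<in> HH \<Longrightarrow> w \<notin> carrier H \<Longrightarrow> coef h w = 0"
  by (auto simp: hecke_space_def in_keys_iff)

lemma HH_I: "(\<And>w. w \<notin> carrier H \<Longrightarrow> coef h w = 0) \<Longrightarrow> (\<And>w. coef h w \<in> A) \<Longrightarrow> h \<in> HH"
  by (auto simp: hecke_space_def in_keys_iff)

lemma hecke_eqI:
  assumes "x \<in> HH" "y \<in> HH" "\<And>w. w \<in> carrier H \<Longrightarrow> coef x w = coef y w"
  shows "x = y"
  using assms coef_outside by (intro poly_mapping_eqI) metis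

lemma HH_zero [simp]: "0 \<in> HH"
  by (auto intro!: HH_I A_closed)

lemma HH_add: "x \<in> HH \<Longrightarrow> y \<in> HH \<Longrightarrow> x + y \<in> HH"
  by (rule HH_I) (auto simp: lookup_add coef_outside intro!: A_closed coef_A)

lemma HH_diff: "x \<in> HH \<Longrightarrow> y \<in> HH \<Longrightarrow> x - y \<in> HH"
  by (rule HH_I) (auto simp: lookup_minus coef_outside intro!: A_closed coef_A)

lemma HH_smul: "a \<in> A \<Longrightarrow> x \<in> HH \<Longrightarrow> smul a x \<in> HH"
  by (rule HH_I) (auto simp: coef_outside intro!: A_closed coef_A)

lemma HH_sum: "(\<And>i. i \<in> I \<Longrightarrow> f i \<in> HH) \<Longrightarrow> sum f I \<in> HH"
  by (induction I rule: infinite_finite_induct) (auto intro: HH_add)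

lemma HH_T [simp]: "w \<in> carrier H \<Longrightarrow> T w \<in> HH"
  by (rule HH_I) (auto simp: lookup_single when_def intro: A_closed)

lemma HH_mult: "x \<in> HH \<Longrightarrow> y \<in> HH \<Longrightarrow> x \<star> y \<in> HH"
  using hecke_product by (simp add: is_hecke_product_def)

lemma mult_add_left: "x \<in> HH \<Longrightarrow> y \<in> HH \<Longrightarrow> z \<in> HH \<Longrightarrow> (x + y) \<star> z = x \<star> z + y \<star> z"
  and mult_add_right: "x \<in> HH \<Longrightarrow> y \<in> HH \<Longrightarrow> z \<in> HH \<Longrightarrow> x \<star> (y + z) = x \<star> y + x \<star> z"
  and mult_assoc: "x \<in> HH \<Longrightarrow> y \<in> HH \<Longrightarrow> z \<in> HH \<Longrightarrow> x \<star> y \<star> z = x \<star> (y \<star> z)"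
  and mult_smul_left: "a \<in> A \<Longrightarrow> x \<in> HH \<Longrightarrow> y \<in> HH \<Longrightarrow> smul a x \<star> y = smul a (x \<star> y)"
  and mult_smul_right: "a \<in> A \<Longrightarrow> x \<in> HH \<Longrightarrow> y \<in> HH \<Longrightarrow> x \<star> smul a y = smul a (x \<star> y)"
  and mult_one_left [simp]: "x \<in> HH \<Longrightarrow> T \<one> \<star> x = x"
  and mult_one_right [simp]: "x \<in> HH \<Longrightarrow> x \<star> T \<one> = x"
  using hecke_product by (simp_all add: is_hecke_product_def)

lemma mult_zero_left [simp]: "x \<in> HH \<Longrightarrow> 0 \<star> x = 0"
  using mult_add_left[of 0 0 x] by simp

lemma mult_zero_right [simp]: "x \<in> HH \<Longrightarrow> x \<star> 0 = 0"
  using mult_add_right[of x 0 0] by simp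

lemma mult_diff_left: "x \<in> HH \<Longrightarrow> y \<in> HH \<Longrightarrow> z \<in> HH \<Longrightarrow> (x - y) \<star> z = x \<star> z - y \<star> z"
  using mult_add_left[of "x - y" y z] by (simp add: HH_diff algebra_simps)

lemma mult_diff_right: "x \<in> HH \<Longrightarrow> y \<in> HH \<Longrightarrow> z \<in> HH \<Longrightarrow> x \<star> (y - z) = x \<star> y - x \<star> z"
  using mult_add_right[of x "y - z" z] by (simp add: HH_diff algebra_simps)

lemma mult_sum_left: "(\<And>i. i \<in> I \<Longrightarrow> f i \<in> HH) \<Longrightarrow> y \<in> HH \<Longrightarrow> sum f I \<star> y = (\<Sum>i\<in>I. f i \<star> y)"
  by (induction I rule: infinite_finite_induct) (auto simp: mult_add_left HH_sum)

lemma mult_sum_right: "(\<And>i. i \<in> I \<Longrightarrow> f i \<in> HH) \<Longrightarrow> y \<in> HH \<Longrightarrow> y \<star> sum f I = (\<Sum>i\<in>I. y \<star> f i)"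
  by (induction I rule: infinite_finite_induct) (auto simp: mult_add_right HH_sum)

lemma hecke_expand:
  assumes "h \<in> HH"
  shows "h = (\<Sum>w\<in>carrier H. smul (coef h w) (T w))"
proof (rule poly_mapping_eqI)
  fix k
  have "coef (\<Sum>w\<in>carrier H. smul (coef h w) (T w)) k = (\<Sum>w\<in>carrier H. if w = k then coef h w else 0)"
    by (auto simp: lookup_sum lookup_single when_def intro!: sum.cong)
  then show "coef h k = coef (\<Sum>w\<in>carrier H. smul (coef h w) (T w)) k"
    using coef_outside[OF assms] finite_W by simp
qed

lemma hecke_linear_induct [consumes 1, case_names T add smul]:
  assumes "h \<in> HH"
    and T: "\<And>w. w \<in> carrier H \<Longrightarrow> P (T w)"
    and add: "\<And>x y. x \<in> HH \<Longrightarrow> y \<in> HH \<Longrightarrow> P x \<Longrightarrow> P y \<Longrightarrow> P (x + y)"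
    and smul: "\<And>a x. a \<in> A \<Longrightarrow> x \<in> HH \<Longrightarrow> P x \<Longrightarrow> P (smul a x)"
  shows "P h"
proof -
  have P0: "P 0"
    using smul[of 0 "T \<one>"] T[of \<one>] A_closed by simp
  have "P (\<Sum>w\<in>X. smul (coef h w) (T w))" if "X \<subseteq> carrier H" "finite X" for X
    using that(2,1)
  proof (induction X rule: finite_induct)
    case (insert w X)
    then show ?case
      using coef_A[OF assms(1)] by (auto intro!: add smul T HH_smul HH_sum)
  qed (use P0 in simp)
  then show ?thesis
    using hecke_expand[OF assms(1)] finite_W by force
qed

definition \<xi> :: "'w \<Rightarrow> 'g \<Rightarrow>\<^sub>0 complex" where
  "\<xi> s = eps (wt H s) - eps (- wt H s)"

lemma eps_A: "eps g \<in> A"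
  by (rule single_A) (rule is_subring_closed[OF subring_R])

lemma xi_A: "\<xi> s \<in> A"
  unfolding \<xi>_def by (intro A_closed eps_A)

lemma ring_bar_xi: "ring_bar (\<xi> s) = - \<xi> s"
  by (simp add: \<xi>_def ring_bar_diff)

lemma theta1_xi: "theta1 (\<xi> s) = 0"
  by (simp add: \<xi>_def theta1_diff)

lemma Ts_Tw_up: "s \<in> gens H \<Longrightarrow> w \<in> carrier H \<Longrightarrow> l w < l (s \<otimes> w) \<Longrightarrow> T s \<star> T w = T (s \<otimes> w)"
  and Ts_Tw_down: "s \<in> gens H \<Longrightarrow> w \<in> carrier H \<Longrightarrow> l (s \<otimes> w) < l w \<Longrightarrow>
    T s \<star> T w = T (s \<otimes> w) + smul (\<xi> s) (T w)"
  using hecke_product by (simp_all add: is_hecke_product_def \<xi>_def)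

lemma Ts_Tw:
  assumes "s \<in> gens H" "w \<in> carrier H"
  shows "T s \<star> T w = T (s \<otimes> w) + smul (if l (s \<otimes> w) < l w then \<xi> s else 0) (T w)"
  using Ts_Tw_up[OF assms] Ts_Tw_down[OF assms] length_less_iff[OF assms] by auto

lemma Tw_Ts_up:
  assumes s: "s \<in> gens H"
  shows "w \<in> carrier H \<Longrightarrow> l w < l (w \<otimes> s) \<Longrightarrow> T w \<star> T s = T (w \<otimes> s)"
proof (induction rule: coxeter_induct)
  case one
  then show ?case using s by simp
next
  case (step t w)
  have ls: "l (w \<otimes> s) = l (s \<otimes> inv w)"
    using length_right s step by simp
  have "l (t \<otimes> w \<otimes> s) \<le> l (w \<otimes> s) + 1"
    using length_mult_le[of t "w \<otimes> s"] s step by (simp add: m_assoc)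
  then have up: "l w < l (w \<otimes> s)" "l (w \<otimes> s) < l (t \<otimes> (w \<otimes> s))"
    using step.prems step.hyps s length_mult_le[of s "inv w"] ls
    by (auto simp: m_assoc)
  have "T (t \<otimes> w) \<star> T s = T t \<star> (T w \<star> T s)"
    using Ts_Tw_up[of t w] step s by (simp add: mult_assoc[symmetric])
  also have "\<dots> = T (t \<otimes> (w \<otimes> s))"
    using step.IH[OF up(1)] Ts_Tw_up[OF _ _ up(2)] step.hyps s by simp
  finally show ?case
    using step s by (simp add: m_assoc)
qed

lemma Tw_Ts:
  assumes s: "s \<in> gens H" and w: "w \<in> carrier H"
  shows "T w \<star> T s = T (w \<otimes> s) + smul (if l (w \<otimes> s) < l w then \<xi> s else 0) (T w)"
proof (cases "l w < l (w \<otimes> s)")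
  case True
  then show ?thesis using Tw_Ts_up[OF s w] by simp
next
  case False
  then have down: "l (w \<otimes> s) < l w"
    using length_less_iff[OF s, of "inv w"] length_right[OF s w] w by auto
  have ws: "w \<otimes> s \<in> carrier H" "w \<otimes> s \<otimes> s = w"
    using s w S_cancel_right by auto
  have Tw: "T w = T (w \<otimes> s) \<star> T s"
    using Tw_Ts_up[OF s ws(1)] ws down by simp
  have ss: "T s \<star> T s = T \<one> + smul (\<xi> s) (T s)"
  proof -
    show ?thesis using Ts_Tw[OF s, of s] S_square[OF s] length_gen_pos[OF s] s by simp
  qed
  have "T w \<star> T s = T (w \<otimes> s) \<star> (T s \<star> T s)"
    using Tw s ws mult_assoc by simp
  also have "\<dots> = T (w \<otimes> s) + smul (\<xi> s) (T (w \<otimes> s) \<star> T s)"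
    unfolding ss using s ws xi_A by (simp add: mult_add_right mult_smul_right HH_smul)
  finally show ?thesis
    using Tw down by simp
qed

lemma coef_Ts_mult:
  assumes s: "s \<in> gens H" and m: "m \<in> HH" and z: "z \<in> carrier H"
  shows "coef (T s \<star> m) z = coef m (s \<otimes> z) + (if l (s \<otimes> z) < l z then \<xi> s * coef m z else 0)"
proof -
  have "T s \<star> m = (\<Sum>w\<in>carrier H. T s \<star> smul (coef m w) (T w))"
    using mult_sum_right[of "carrier H" "\<lambda>w. smul (coef m w) (T w)" "T s"] hecke_expand[OF m] s coef_A[OF m]
    by (simp add: HH_smul)
  also have "\<dots> = (\<Sum>w\<in>carrier H. smul (coef m w) (T (s \<otimes> w) + smul (if l (s \<otimes> w) < l w then \<xi> s else 0) (T w)))"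
    by (rule sum.cong) (use coef_A[OF m] s in \<open>auto simp: mult_smul_right Ts_Tw\<close>)
  finally have "coef (T s \<star> m) z = (\<Sum>w\<in>carrier H. (if w = s \<otimes> z then coef m w else 0)) +
      (\<Sum>w\<in>carrier H. if w = z then (if l (s \<otimes> w) < l w then \<xi> s * coef m w else 0) else 0)"
    unfolding sum.distrib[symmetric] using S_mult_eq_iff[OF s _ z]
    by (auto simp: lookup_sum lookup_add lookup_single when_def distrib_left mult_ac intro!: sum.cong)
  then show ?thesis
    using z s finite_W by simp
qed

lemma coef_mult_Ts:
  assumes s: "s \<in> gens H" and m: "m \<in> HH" and z: "z \<in> carrier H"
  shows "coef (m \<star> T s) z = coef m (z \<otimes> s) + (if l (z \<otimes> s) < l z then \<xi> s * coef m z else 0)"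
proof -
  have "m \<star> T s = (\<Sum>w\<in>carrier H. smul (coef m w) (T w) \<star> T s)"
    using mult_sum_left[of "carrier H" "\<lambda>w. smul (coef m w) (T w)" "T s"] hecke_expand[OF m] s coef_A[OF m]
    by (simp add: HH_smul)
  also have "\<dots> = (\<Sum>w\<in>carrier H. smul (coef m w) (T (w \<otimes> s) + smul (if l (w \<otimes> s) < l w then \<xi> s else 0) (T w)))"
    by (rule sum.cong) (use coef_A[OF m] s in \<open>auto simp: mult_smul_left Tw_Ts\<close>)
  finally have "coef (m \<star> T s) z = (\<Sum>w\<in>carrier H. (if w = z \<otimes> s then coef m w else 0)) +
      (\<Sum>w\<in>carrier H. if w = z then (if l (w \<otimes> s) < l w then \<xi> s * coef m w else 0) else 0)"
    unfolding sum.distrib[symmetric] using S_cancel_right[OF s] z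
    by (auto simp: lookup_sum lookup_add lookup_single when_def distrib_left mult_ac intro!: sum.cong)
  then show ?thesis
    using z s finite_W by simp
qed

lemma theta1_coef_T_mult:
  "x \<in> carrier H \<Longrightarrow> y \<in> carrier H \<Longrightarrow> z \<in> carrier H \<Longrightarrow>
    theta1 (coef (T x \<star> T y) z) = (if z = x \<otimes> y then 1 else 0)"
proof (induction x arbitrary: z rule: coxeter_induct)
  case one
  then show ?case by (auto simp: lookup_single when_def)
next
  case (step s x)
  have "T (s \<otimes> x) \<star> T y = T s \<star> (T x \<star> T y)"
    using Ts_Tw_up[of s x] step by (simp add: mult_assoc[symmetric])
  then have "theta1 (coef (T (s \<otimes> x) \<star> T y) z) = theta1 (coef (T x \<star> T y) (s \<otimes> z))"
    using step by (simp add: coef_Ts_mult HH_mult theta1_add theta1_mult theta1_xi)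
  also have "\<dots> = (if s \<otimes> z = x \<otimes> y then 1 else 0)"
    using step by simp
  finally show ?case
    using step S_mult_eq_iff[of s z "x \<otimes> y"] by (auto simp: m_assoc)
qed

abbreviation star :: "('w, 'g) hecke_elt \<Rightarrow> ('w, 'g) hecke_elt" where "star \<equiv> hecke_star H"

lemma HH_star: "h \<in> HH \<Longrightarrow> star h \<in> HH"
  unfolding hecke_star_def by (intro HH_sum HH_smul coef_A) auto

lemma coef_star: "z \<in> carrier H \<Longrightarrow> coef (star h) z = coef h (inv z)"
proof -
  assume z: "z \<in> carrier H"
  have "coef (star h) z = (\<Sum>w\<in>carrier H. if w = inv z then coef h w else 0)"
    unfolding hecke_star_def using z by (auto simp: lookup_sum lookup_single when_def intro!: sum.cong)
  then show ?thesis using z finite_W by simp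
qed

lemma star_star: "h \<in> HH \<Longrightarrow> star (star h) = h"
  by (rule hecke_eqI) (auto simp: HH_star coef_star)

lemma star_add: "x \<in> HH \<Longrightarrow> y \<in> HH \<Longrightarrow> star (x + y) = star x + star y"
  by (rule hecke_eqI) (auto simp: HH_star HH_add coef_star lookup_add)

lemma star_smul: "a \<in> A \<Longrightarrow> x \<in> HH \<Longrightarrow> star (smul a x) = smul a (star x)"
  by (rule hecke_eqI) (auto simp: HH_star HH_smul coef_star)

lemma star_T: "w \<in> carrier H \<Longrightarrow> star (T w) = T (inv w)"
  by (rule hecke_eqI) (auto simp: HH_star coef_star lookup_single when_def)

lemma star_zero: "star 0 = 0"
  by (simp add: hecke_star_def)

lemma star_sum: "(\<And>i. i \<in> I \<Longrightarrow> f i \<in> HH) \<Longrightarrow> star (sum f I) = (\<Sum>i\<in>I. star (f i))"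
  by (induction I rule: infinite_finite_induct) (auto simp: star_add HH_sum star_zero)

lemma star_Ts_mult:
  assumes s: "s \<in> gens H" and m: "m \<in> HH"
  shows "star (T s \<star> m) = star m \<star> T s"
proof (rule hecke_eqI)
  fix z assume z: "z \<in> carrier H"
  have "inv (z \<otimes> s) = s \<otimes> inv z" using z s by (simp add: inv_mult_group S_inv)
  then show "coef (star (T s \<star> m)) z = coef (star m \<star> T s) z"
    using z s m length_right[OF s z] by (simp add: coef_star coef_Ts_mult coef_mult_Ts HH_star)
qed (use s m in \<open>auto intro!: HH_star HH_mult\<close>)

lemma star_mult:
  assumes x: "x \<in> HH" and y: "y \<in> HH"
  shows "star (x \<star> y) = star y \<star> star x"
  using x
proof (induction rule: hecke_linear_induct)
  case (T w)
  then show ?case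
  proof (induction rule: coxeter_induct)
    case one
    then show ?case using y by (simp add: star_T HH_star)
  next
    case (step s w)
    have Tsw: "T (s \<otimes> w) = T s \<star> T w"
      using Ts_Tw_up[of s w] step by simp
    have "star (T (s \<otimes> w) \<star> y) = star (T s \<star> (T w \<star> y))"
      unfolding Tsw using step y by (simp add: mult_assoc)
    also have "\<dots> = star y \<star> star (T w) \<star> T s"
      using step y by (simp add: star_Ts_mult HH_mult)
    also have "\<dots> = star y \<star> star (T s \<star> T w)"
      using step y by (simp add: star_Ts_mult mult_assoc HH_star)
    finally show ?case unfolding Tsw .
  qed
next
  case (add x z)
  then show ?case
    using y by (simp add: mult_add_left mult_add_right star_add HH_mult HH_star)
next
  case (smul a x)
  then show ?case
    using y by (simp add: mult_smul_left mult_smul_right star_smul HH_mult HH_star)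
qed

lemma star_anti_involution: "is_A_anti_involution H star"
  unfolding is_A_anti_involution_def
  by (simp add: HH_star star_star star_add star_mult star_smul)

lemma hecke_inverse_eq:
  assumes "x \<in> HH" "y \<in> HH" "x \<star> y = T \<one>" "y \<star> x = T \<one>"
  shows "hecke_inverse H x = y"
  unfolding hecke_inverse_def
proof (rule the_equality)
  fix z assume z: "z \<in> HH \<and> x \<star> z = T \<one> \<and> z \<star> x = T \<one>"
  then have "z = z \<star> (x \<star> y)" using assms by simp
  also have "\<dots> = y" using assms z mult_assoc[of z x y] by simp
  finally show "z = y" .
qed (use assms in simp)

definition Tinv :: "'w \<Rightarrow> ('w, 'g) hecke_elt" where
  "Tinv s = T s - smul (\<xi> s) (T \<one>)"

lemma HH_Tinv: "s \<in> gens H \<Longrightarrow> Tinv s \<in> HH"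
  unfolding Tinv_def by (intro HH_diff HH_smul xi_A) auto

lemma Ts_square: "s \<in> gens H \<Longrightarrow> T s \<star> T s = T \<one> + smul (\<xi> s) (T s)"
  using Ts_Tw[of s s] S_square length_gen_pos by simp


lemma Ts_Tinv: "s \<in> gens H \<Longrightarrow> T s \<star> Tinv s = T \<one>" "s \<in> gens H \<Longrightarrow> Tinv s \<star> T s = T \<one>"
  unfolding Tinv_def
  by (simp_all add: mult_diff_left mult_diff_right mult_smul_left mult_smul_right HH_smul xi_A Ts_square)

definition barT :: "'w \<Rightarrow> ('w, 'g) hecke_elt" where
  "barT w = hecke_inverse H (T (inv w))"

lemma barT_inverse_aux:
  assumes "w \<in> carrier H"
  shows "\<exists>y\<in>HH. T (inv w) \<star> y = T \<one> \<and> y \<star> T (inv w) = T \<one>"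
  using assms
proof (induction rule: coxeter_induct)
  case one
  then show ?case by (intro bexI[of _ "T \<one>"]) auto
next
  case (step s w)
  then obtain y where y: "y \<in> HH" "T (inv w) \<star> y = T \<one>" "y \<star> T (inv w) = T \<one>" by blast
  have "inv (s \<otimes> w) = inv w \<otimes> s" using step by (simp add: inv_mult_group S_inv)
  moreover have "l (inv w) < l (inv w \<otimes> s)"
    using length_right[of s "inv w"] step by simp
  ultimately have Tsw: "T (inv (s \<otimes> w)) = T (inv w) \<star> T s"
    using Tw_Ts_up[of s "inv w"] step by simp
  note HH = HH_Tinv[OF step.hyps(1)] y(1) HH_T[of "inv w"] HH_T[of s]
  have "T (inv w) \<star> T s \<star> (Tinv s \<star> y) = T (inv w) \<star> (T s \<star> Tinv s) \<star> y"
    using HH step by (simp add: mult_assoc HH_mult)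
  moreover have "Tinv s \<star> y \<star> (T (inv w) \<star> T s) = Tinv s \<star> (y \<star> T (inv w)) \<star> T s"
    using HH step by (simp add: mult_assoc HH_mult)
  ultimately show ?case
    unfolding Tsw using HH step y
    by (intro bexI[of _ "Tinv s \<star> y"]) (simp_all add: Ts_Tinv HH_mult)
qed

lemma barT_inverse:
  assumes "w \<in> carrier H"
  shows "barT w \<in> HH" "T (inv w) \<star> barT w = T \<one>" "barT w \<star> T (inv w) = T \<one>"
proof -
  obtain y where "y \<in> HH" "T (inv w) \<star> y = T \<one>" "y \<star> T (inv w) = T \<one>"
    using barT_inverse_aux[OF assms] by blast
  moreover from this have "barT w = y"
    unfolding barT_def using hecke_inverse_eq[of "T (inv w)" y] assms by simp
  ultimately show "barT w \<in> HH" "T (inv w) \<star> barT w = T \<one>" "barT w \<star> T (inv w) = T \<one>"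
    by simp_all
qed

lemma barT_unique:
  assumes "w \<in> carrier H" "y \<in> HH" "T (inv w) \<star> y = T \<one>" "y \<star> T (inv w) = T \<one>"
  shows "barT w = y"
  unfolding barT_def using hecke_inverse_eq[of "T (inv w)" y] assms by simp

lemma barT_one: "barT \<one> = T \<one>"
  by (rule barT_unique) auto

lemma barT_step:
  assumes s: "s \<in> gens H" and w: "w \<in> carrier H" and up: "l w < l (s \<otimes> w)"
  shows "barT (s \<otimes> w) = Tinv s \<star> barT w"
proof (rule barT_unique)
  have "inv (s \<otimes> w) = inv w \<otimes> s" using s w by (simp add: inv_mult_group S_inv)
  moreover have "l (inv w) < l (inv w \<otimes> s)"
    using length_right[of s "inv w"] s w up by simp
  ultimately have Tsw: "T (inv (s \<otimes> w)) = T (inv w) \<star> T s"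
    using Tw_Ts_up[of s "inv w"] s w by simp
  note HH = HH_Tinv[OF s] barT_inverse(1)[OF w] HH_T[of "inv w"] HH_T[of s]
  have "T (inv w) \<star> T s \<star> (Tinv s \<star> barT w) = T (inv w) \<star> (T s \<star> Tinv s) \<star> barT w"
    using HH s w by (simp add: mult_assoc HH_mult)
  then show "T (inv (s \<otimes> w)) \<star> (Tinv s \<star> barT w) = T \<one>"
    unfolding Tsw using HH s w by (simp add: Ts_Tinv barT_inverse(2))
  have "Tinv s \<star> barT w \<star> (T (inv w) \<star> T s) = Tinv s \<star> (barT w \<star> T (inv w)) \<star> T s"
    using HH s w by (simp add: mult_assoc HH_mult)
  then show "Tinv s \<star> barT w \<star> T (inv (s \<otimes> w)) = T \<one>"
    unfolding Tsw using HH s w by (simp add: Ts_Tinv barT_inverse(3))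
qed (use s w in \<open>auto intro!: HH_mult HH_Tinv barT_inverse\<close>)

abbreviation bar :: "('w, 'g) hecke_elt \<Rightarrow> ('w, 'g) hecke_elt" where "bar \<equiv> hecke_bar H"

lemma bar_eq: "bar h = (\<Sum>w\<in>carrier H. smul (ring_bar (coef h w)) (barT w))"
  by (simp add: hecke_bar_def barT_def)

lemma HH_bar: "h \<in> HH \<Longrightarrow> bar h \<in> HH"
  unfolding bar_eq by (intro HH_sum HH_smul ring_bar_group_ring coef_A barT_inverse(1))

lemma bar_add: "bar (x + y) = bar x + bar y"
  by (simp add: bar_eq lookup_add ring_bar_add smul_add_left sum.distrib)

lemma bar_diff: "bar (x - y) = bar x - bar y"
  by (simp add: bar_eq lookup_minus ring_bar_diff smul_diff_left sum_subtractf)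

lemma bar_smul: "bar (smul a x) = smul (ring_bar a) (bar x)"
  by (simp add: bar_eq ring_bar_mult smul_sum)

lemma bar_zero [simp]: "bar 0 = 0"
  by (simp add: bar_eq)

lemma bar_sum: "bar (sum f I) = (\<Sum>i\<in>I. bar (f i))"
  by (induction I rule: infinite_finite_induct) (auto simp: bar_add)

lemma bar_T: "w \<in> carrier H \<Longrightarrow> bar (T w) = barT w"
proof -
  assume w: "w \<in> carrier H"
  have "bar (T w) = (\<Sum>x\<in>carrier H. if x = w then barT x else 0)"
    unfolding bar_eq by (auto simp: lookup_single when_def intro!: sum.cong)
  then show ?thesis using w finite_W by simp
qed

lemma bar_Ts_mult:
  assumes s: "s \<in> gens H" and x: "x \<in> HH"
  shows "bar (T s \<star> x) = Tinv s \<star> bar x"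
  using x
proof (induction rule: hecke_linear_induct)
  case (T w)
  show ?case
  proof (cases "l w < l (s \<otimes> w)")
    case True
    then show ?thesis using T s barT_step by (simp add: Ts_Tw_up bar_T)
  next
    case False
    define v where "v = s \<otimes> w"
    have v: "v \<in> carrier H" "w = s \<otimes> v" "l v < l (s \<otimes> v)"
      using False T s length_less_iff[OF s] S_cancel[OF s] by (auto simp: v_def)
    note HH = HH_Tinv[OF s] barT_inverse(1)[OF v(1)]
    have w: "barT w = Tinv s \<star> barT v"
      unfolding v(2) using barT_step[OF s v(1) v(3)] .
    have "T s \<star> T w = T v + smul (\<xi> s) (T w)"
      using Ts_Tw_down[OF s T] False length_less_iff[OF s T] by (simp add: v_def)
    then have "bar (T s \<star> T w) = barT v - smul (\<xi> s) (barT w)"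
      using T v(1) by (simp add: bar_add bar_smul bar_T ring_bar_xi smul_uminus_left)
    also have "\<dots> = (T s \<star> Tinv s - smul (\<xi> s) (Tinv s)) \<star> barT v"
      using HH s xi_A w by (simp add: Ts_Tinv mult_diff_left mult_smul_left HH_smul)
    also have "T s \<star> Tinv s - smul (\<xi> s) (Tinv s) = Tinv s \<star> Tinv s"
      using HH s xi_A by (simp add: Tinv_def[of s] mult_diff_left mult_smul_left HH_smul HH_diff)
    finally show ?thesis
      using HH w T by (simp add: bar_T mult_assoc)
  qed
next
  case (add x z)
  then show ?case
    using s by (simp add: mult_add_right bar_add HH_bar HH_Tinv)
next
  case (smul a x)
  then show ?case
    using s by (simp add: mult_smul_right bar_smul HH_bar HH_Tinv ring_bar_group_ring)
qed

lemma coef_Tinv_mult: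
  assumes s: "s \<in> gens H" and m: "m \<in> HH" and z: "z \<in> carrier H"
  shows "coef (Tinv s \<star> m) z = coef m (s \<otimes> z) - (if l (s \<otimes> z) < l z then 0 else \<xi> s * coef m z)"
  unfolding Tinv_def using assms xi_A
  by (simp add: mult_diff_left mult_smul_left HH_smul lookup_minus coef_Ts_mult)

lemma barT_triangular:
  "w \<in> carrier H \<Longrightarrow> coef (barT w) w = 1 \<and> (\<forall>z\<in>carrier H. coef (barT w) z \<noteq> 0 \<longrightarrow> z = w \<or> l z < l w)"
proof (induction rule: coxeter_induct)
  case one
  then show ?case by (auto simp: barT_one lookup_single when_def split: if_splits)
next
  case (step s w)
  note b = barT_inverse(1)[OF step.hyps(2)]
  have bs: "barT (s \<otimes> w) = Tinv s \<star> barT w"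
    using barT_step[of s w] step by simp
  show ?case
  proof (intro conjI ballI impI)
    show "coef (barT (s \<otimes> w)) (s \<otimes> w) = 1"
      unfolding bs using coef_Tinv_mult[OF step.hyps(1) b, of "s \<otimes> w"] step
      by (simp add: S_cancel)
    fix z assume z: "z \<in> carrier H" "coef (barT (s \<otimes> w)) z \<noteq> 0"
    have "coef (barT w) (s \<otimes> z) \<noteq> 0 \<or> coef (barT w) z \<noteq> 0"
    proof (rule ccontr)
      assume "\<not> ?thesis"
      then show False
        using z(2) unfolding bs coef_Tinv_mult[OF step.hyps(1) b z(1)] by (simp split: if_splits)
    qed
    then consider "coef (barT w) (s \<otimes> z) \<noteq> 0" | "coef (barT w) z \<noteq> 0"
      by blast
    then show "z = s \<otimes> w \<or> l z < l (s \<otimes> w)"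
    proof cases
      case 1
      then consider "s \<otimes> z = w" | "l (s \<otimes> z) < l w"
        using step.IH step.hyps z by auto
      then show ?thesis
      proof cases
        case 1
        then show ?thesis using S_cancel[of s z] step.hyps z by auto
      next
        case 2
        then show ?thesis
          using length_mult_le[of s "s \<otimes> z"] S_cancel[of s z] step.hyps z by simp
      qed
    next
      case 2
      then show ?thesis using step z by auto
    qed
  qed
qed

lemma star_barT:
  assumes w: "w \<in> carrier H"
  shows "star (barT w) = barT (inv w)"
proof (rule barT_unique[symmetric])
  have "star (barT w \<star> T (inv w)) = star (T \<one>)" "star (T (inv w) \<star> barT w) = star (T \<one>)"
    using barT_inverse[OF w] by simp_all
  then show "T (inv (inv w)) \<star> star (barT w) = T \<one>" "star (barT w) \<star> T (inv (inv w)) = T \<one>"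
    using w barT_inverse(1)[OF w] by (simp_all add: star_mult star_T)
qed (use w in \<open>auto intro!: HH_star barT_inverse\<close>)

lemma star_bar:
  assumes h: "h \<in> HH"
  shows "star (bar h) = bar (star h)"
proof -
  have "star (bar h) = (\<Sum>w\<in>carrier H. smul (ring_bar (coef h w)) (barT (inv w)))"
    unfolding bar_eq using h
    by (subst star_sum) (auto simp: star_smul star_barT ring_bar_group_ring coef_A barT_inverse(1) intro!: HH_smul)
  also have "\<dots> = (\<Sum>w\<in>carrier H. smul (ring_bar (coef h (inv w))) (barT w))"
    by (rule sum.reindex_bij_witness[of _ "\<lambda>w. inv w" "\<lambda>w. inv w"]) auto
  also have "\<dots> = bar (star h)"
    unfolding bar_eq by (rule sum.cong) (simp_all add: coef_star)
  finally show ?thesis .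
qed

end

section \<open>The Kazhdan--Lusztig basis\<close>

lemma finite_ex_max:
  fixes f :: "'a \<Rightarrow> nat"
  assumes "finite Z" "Z \<noteq> {}"
  shows "\<exists>z\<in>Z. \<forall>y\<in>Z. f y \<le> f z"
proof -
  have "Max (f ` Z) \<in> f ` Z" using assms by (intro Max_in) auto
  then obtain z where "z \<in> Z" "f z = Max (f ` Z)" by auto
  then show ?thesis using assms by (intro bexI[of _ z]) auto
qed

lemma ring_bar_pos_supp_eq_0:
  assumes "ring_bar a = a" "pos_supp a" shows "a = 0"
proof (rule poly_mapping_eqI)
  fix g
  show "poly_mapping.lookup a g = poly_mapping.lookup 0 g"
  proof (rule ccontr)
    assume "poly_mapping.lookup a g \<noteq> poly_mapping.lookup 0 g"
    then have "g \<in> Poly_Mapping.keys a" by (simp add: in_keys_iff)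
    moreover have "- g \<in> Poly_Mapping.keys a"
      using calculation lookup_ring_bar[of a g] assms(1) by (simp add: in_keys_iff)
    ultimately have "0 < g" "0 < - g"
      using assms(2) unfolding pos_supp_def by blast+
    then show False by simp
  qed
qed

lemma bar_invariant_part:
  fixes a :: "'g::linordered_ab_group_add \<Rightarrow>\<^sub>0 complex"
  assumes "is_subring R" "a \<in> group_ring R"
  shows "\<exists>b\<in>group_ring R. ring_bar b = b \<and> pos_supp (a - b)"
proof -
  define n where "n = (\<Sum>g\<in>{g \<in> Poly_Mapping.keys a. g \<le> 0}. Poly_Mapping.single g (poly_mapping.lookup a g))"
  define n' where "n' = (\<Sum>g\<in>{g \<in> Poly_Mapping.keys a. g < 0}. Poly_Mapping.single g (poly_mapping.lookup a g))"
  have n: "poly_mapping.lookup n k = (if k \<le> 0 then poly_mapping.lookup a k else 0)" for k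
  proof -
    have "poly_mapping.lookup n k = (\<Sum>g\<in>{g \<in> Poly_Mapping.keys a. g \<le> 0}. if g = k then poly_mapping.lookup a g else 0)"
      unfolding n_def lookup_sum lookup_single when_def by (intro sum.cong) auto
    then show ?thesis by (simp add: in_keys_iff)
  qed
  have n': "poly_mapping.lookup n' k = (if k < 0 then poly_mapping.lookup a k else 0)" for k
  proof -
    have "poly_mapping.lookup n' k = (\<Sum>g\<in>{g \<in> Poly_Mapping.keys a. g < 0}. if g = k then poly_mapping.lookup a g else 0)"
      unfolding n'_def lookup_sum lookup_single when_def by (intro sum.cong) auto
    then show ?thesis by (simp add: in_keys_iff)
  qed
  define b where "b = n + ring_bar n'"
  have b: "poly_mapping.lookup b k = (if k \<le> 0 then poly_mapping.lookup a k else poly_mapping.lookup a (- k))" for k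
    by (auto simp: b_def lookup_add n n' lookup_ring_bar)
  have "ring_bar b = b"
    by (rule poly_mapping_eqI) (auto simp: lookup_ring_bar b)
  moreover have "pos_supp (a - b)"
    unfolding pos_supp_def by (auto simp: in_keys_iff lookup_minus b not_le split: if_splits)
  moreover have "b \<in> group_ring R"
    using assms(2) by (auto simp: group_ring_def b)
  ultimately show ?thesis by blast
qed

lemma is_subring_Ints: "is_subring (\<int> :: complex set)"
  by (simp add: is_subring_def)

lemma Ints_subset_subring: "is_subring R \<Longrightarrow> \<int> \<subseteq> (R :: complex set)"
proof
  fix x :: complex assume R: "is_subring R" and "x \<in> \<int>"
  then obtain k where "x = of_int k" by (auto elim: Ints_cases)
  moreover have "of_nat n \<in> R" for n
    by (induction n) (auto intro: is_subring_closed[OF R])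
  ultimately show "x \<in> R"
    using is_subring_closed(3)[OF R] by (cases k rule: int_cases2) auto
qed

lemma group_ring_mono: "R \<subseteq> R' \<Longrightarrow> group_ring R \<subseteq> group_ring R'"
  by (auto simp: group_ring_def)

context hecke
begin

abbreviation AZ :: "('g \<Rightarrow>\<^sub>0 complex) set" where "AZ \<equiv> group_ring \<int>"

lemma subring_AZ: "is_subring AZ"
  by (rule is_subring_group_ring[OF is_subring_Ints])

lemmas AZ_closed = is_subring_closed[OF subring_AZ]

lemma AZ_subset: "a \<in> AZ \<Longrightarrow> a \<in> A"
  using group_ring_mono[OF Ints_subset_subring[OF subring_R]] by blast

lemma eps_AZ: "eps g \<in> AZ"
  by (rule single_group_ring[OF is_subring_Ints]) simp

lemma sign_AZ: "(- 1) ^ n \<in> AZ"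
  by (induction n) (auto intro!: AZ_closed)

lemma sign_A: "(- 1) ^ n \<in> A"
  using AZ_subset sign_AZ by blast

lemma ring_bar_sign: "ring_bar ((- 1) ^ n) = (- 1) ^ n"
  by (induction n) (simp_all add: ring_bar_minus)

definition is_kl :: "'w \<Rightarrow> ('w, 'g) hecke_elt \<Rightarrow> bool" where
  "is_kl w c \<longleftrightarrow> c \<in> HH \<and> bar c = c \<and> (\<forall>z. coef c z \<in> AZ) \<and> coef c w = (- 1) ^ l w \<and>
     (\<forall>z\<in>carrier H. z \<noteq> w \<longrightarrow> pos_supp (coef c z) \<and> (coef c z \<noteq> 0 \<longrightarrow> l z < l w))"

lemma bar_invariant_pos_eq_0:
  assumes h: "h \<in> HH" "bar h = h" and pos: "\<And>z. z \<in> carrier H \<Longrightarrow> pos_supp (coef h z)"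
  shows "h = 0"
proof (rule ccontr)
  assume "h \<noteq> 0"
  define Z where "Z = {z \<in> carrier H. coef h z \<noteq> 0}"
  have "Z \<noteq> {}"
    using hecke_eqI[OF h(1) HH_zero] \<open>h \<noteq> 0\<close> by (auto simp: Z_def)
  moreover have "finite Z" using finite_W by (simp add: Z_def)
  ultimately obtain z where z: "z \<in> Z" "\<And>y. y \<in> Z \<Longrightarrow> l y \<le> l z"
    using finite_ex_max[of Z l] by blast
  then have zW: "z \<in> carrier H" by (simp add: Z_def)
  have "coef h z = coef (bar h) z" using h by simp
  also have "\<dots> = (\<Sum>w\<in>carrier H. if w = z then ring_bar (coef h w) else 0)"
    unfolding bar_eq lookup_sum lookup_smul
  proof (rule sum.cong)
    fix w assume w: "w \<in> carrier H"
    show "ring_bar (coef h w) * coef (barT w) z = (if w = z then ring_bar (coef h w) else 0)"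
    proof (cases "w = z \<or> coef (barT w) z = 0")
      case True
      then show ?thesis using barT_triangular[OF zW] by auto
    next
      case False
      then have "l z < l w" using barT_triangular[OF w] zW by auto
      then have "coef h w = 0" using z(2)[of w] w by (auto simp: Z_def)
      then show ?thesis using False by simp
    qed
  qed simp
  also have "\<dots> = ring_bar (coef h z)" using zW finite_W by simp
  finally have "coef h z = 0"
    using ring_bar_pos_supp_eq_0 pos[OF zW] by metis
  then show False using z by (simp add: Z_def)
qed

lemma is_kl_one: "is_kl \<one> (T \<one>)"
  unfolding is_kl_def by (auto simp: bar_T barT_one lookup_single when_def AZ_closed)

definition is_pre_kl :: "'w \<Rightarrow> nat \<Rightarrow> ('w, 'g) hecke_elt \<Rightarrow> bool" where
  "is_pre_kl w k c \<longleftrightarrow> c \<in> HH \<and> bar c = c \<and> (\<forall>z. coef c z \<in> AZ) \<and> coef c w = (- 1) ^ l w \<and>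
     (\<forall>z\<in>carrier H. z \<noteq> w \<longrightarrow> (k \<le> l z \<longrightarrow> pos_supp (coef c z)) \<and> (coef c z \<noteq> 0 \<longrightarrow> l z < l w))"

text \<open>One correction step of the Kazhdan--Lusztig algorithm: the coefficients at elements of
  length \<open>k\<close> are made positive by subtracting bar-invariant multiples of smaller basis elements.\<close>

lemma pre_kl_step:
  assumes h: "is_pre_kl w (Suc k) h" and w: "w \<in> carrier H" and k: "k < l w"
    and c: "\<And>y. y \<in> carrier H \<Longrightarrow> l y = k \<Longrightarrow> is_kl y (c y)"
  shows "\<exists>h'. is_pre_kl w k h'"
proof -
  define Y where "Y = {y \<in> carrier H. l y = k}"
  have fY: "finite Y" using finite_W by (simp add: Y_def)
  have hd: "h \<in> HH" "bar h = h" "\<And>z. coef h z \<in> AZ" "coef h w = (- 1) ^ l w"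
    "\<And>z. z \<in> carrier H \<Longrightarrow> z \<noteq> w \<Longrightarrow> k < l z \<Longrightarrow> pos_supp (coef h z)"
    "\<And>z. z \<in> carrier H \<Longrightarrow> z \<noteq> w \<Longrightarrow> coef h z \<noteq> 0 \<Longrightarrow> l z < l w"
    using h by (auto simp: is_pre_kl_def Suc_le_eq)
  have cd: "c y \<in> HH" "bar (c y) = c y" "\<And>z. coef (c y) z \<in> AZ" "coef (c y) y = (- 1) ^ k"
    "\<And>z. z \<in> carrier H \<Longrightarrow> z \<noteq> y \<Longrightarrow> coef (c y) z \<noteq> 0 \<Longrightarrow> l z < k" if "y \<in> Y" for y
    using c[of y] that by (auto simp: Y_def is_kl_def)
  have "\<forall>y. \<exists>b. b \<in> AZ \<and> ring_bar b = b \<and> pos_supp (coef h y - b)"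
    using bar_invariant_part[OF is_subring_Ints hd(3)] by blast
  from choice[OF this] obtain b where b: "\<And>y. b y \<in> AZ" "\<And>y. ring_bar (b y) = b y"
    "\<And>y. pos_supp (coef h y - b y)"
    by blast
  define h' where "h' = h - (\<Sum>y\<in>Y. smul ((- 1) ^ k * b y) (c y))"
  have bA: "(- 1) ^ k * b y \<in> AZ" for y
    using b(1) sign_AZ AZ_closed by blast
  have coef: "coef h' z = coef h z - (\<Sum>y\<in>Y. (- 1) ^ k * b y * coef (c y) z)" for z
    by (simp add: h'_def lookup_minus lookup_sum)
  have above: "coef h' z = coef h z" if z: "z \<in> carrier H" "k < l z" for z
  proof -
    have "coef (c y) z = 0" if "y \<in> Y" for y
      using cd(5)[OF that z(1)] z that by (auto simp: Y_def)
    then show ?thesis by (simp add: coef)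
  qed
  have level: "coef h' z = coef h z - b z" if z: "z \<in> carrier H" "l z = k" for z
  proof -
    have "(\<Sum>y\<in>Y. (- 1) ^ k * b y * coef (c y) z) = (\<Sum>y\<in>Y. if y = z then b y else 0)"
    proof (rule sum.cong)
      fix y assume y: "y \<in> Y"
      show "(- 1) ^ k * b y * coef (c y) z = (if y = z then b y else 0)"
        using cd(4)[OF y] cd(5)[OF y z(1)] z by (auto simp: power_mult_distrib[symmetric] mult_ac simp flip: power_add mult_2)
    qed simp
    then show ?thesis using z fY by (simp add: coef Y_def)
  qed
  have "is_pre_kl w k h'"
    unfolding is_pre_kl_def
  proof (intro conjI ballI allI impI)
    show "h' \<in> HH"
      unfolding h'_def using hd cd AZ_subset[OF bA] by (intro HH_diff HH_sum HH_smul)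
    show "bar h' = h'"
      unfolding h'_def by (simp add: bar_diff bar_sum bar_smul ring_bar_mult ring_bar_sign b(2) hd(2) cd(2))
    show "coef h' z \<in> AZ" for z
      unfolding coef using hd(3) cd(3) b(1) sign_AZ by (intro AZ_closed)
    show "coef h' w = (- 1) ^ l w"
      using above[OF w k] hd(4) by simp
    fix z assume z: "z \<in> carrier H" "z \<noteq> w"
    show "pos_supp (coef h' z)" if "k \<le> l z"
      using that above[OF z(1)] level[OF z(1)] hd(5)[OF z] b(3)[of z] by (cases "k = l z") auto
    assume nz: "coef h' z \<noteq> 0"
    show "l z < l w"
    proof (cases "k < l z")
      case True
      then show ?thesis using above[OF z(1)] hd(6)[OF z] nz by simp
    next
      case False
      then show ?thesis using k by simp
    qed
  qed
  then show ?thesis by blast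
qed

lemma is_kl_exists: "w \<in> carrier H \<Longrightarrow> \<exists>c. is_kl w c"
proof (induction "l w" arbitrary: w rule: less_induct)
  case less
  have start: "(\<exists>h. is_pre_kl w (l w) h)" if w1: "w \<noteq> \<one>"
  proof -
    obtain s v where sv: "s \<in> gens H" "v \<in> carrier H" "w = s \<otimes> v" "l w = l v + 1"
      using ex_descent[OF less.prems w1] by blast
    obtain c where c: "is_kl v c"
      using less.hyps[of v] sv by auto
    then have cd: "c \<in> HH" "bar c = c" "\<And>z. coef c z \<in> AZ" "coef c v = (- 1) ^ l v"
      "\<And>z. z \<in> carrier H \<Longrightarrow> z \<noteq> v \<Longrightarrow> coef c z \<noteq> 0 \<Longrightarrow> l z < l v"
      by (auto simp: is_kl_def)
    define h where "h = smul (eps (wt H s)) c - T s \<star> c"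
    have coef: "coef h z = eps (wt H s) * coef c z - (coef c (s \<otimes> z) + (if l (s \<otimes> z) < l z then \<xi> s * coef c z else 0))"
      if "z \<in> carrier H" for z
      using that sv cd by (simp add: h_def lookup_minus coef_Ts_mult)
    have hH: "h \<in> HH"
      unfolding h_def using sv cd by (intro HH_diff HH_smul HH_mult eps_A) auto
    have "bar h = smul (eps (- wt H s)) c - Tinv s \<star> c"
      unfolding h_def using sv cd by (simp add: bar_diff bar_smul bar_Ts_mult)
    also have "Tinv s \<star> c = T s \<star> c - smul (\<xi> s) c"
      unfolding Tinv_def using sv cd xi_A by (simp add: mult_diff_left mult_smul_left HH_smul)
    also have "smul (eps (- wt H s)) c - \<dots> = h"
      by (simp add: h_def \<xi>_def smul_diff_left)
    finally have barh: "bar h = h" .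
    have xiZ: "\<xi> s \<in> AZ" unfolding \<xi>_def by (intro AZ_closed eps_AZ)
    have "is_pre_kl w (l w) h"
      unfolding is_pre_kl_def
    proof (intro conjI ballI allI impI hH barh)
      show "coef h z \<in> AZ" for z
      proof (cases "z \<in> carrier H")
        case True
        then show ?thesis
          unfolding coef[OF True] using cd(3) xiZ eps_AZ by (auto intro!: AZ_closed)
      qed (use coef_outside[OF hH] AZ_closed in simp)
      have "coef c w = 0"
        using cd(5)[of w] sv less.prems by fastforce
      then show "coef h w = (- 1) ^ l w"
        using coef[OF less.prems] sv cd(4) S_cancel[OF sv(1,2)] by simp
      fix z assume z: "z \<in> carrier H" "z \<noteq> w"
      have small: "l z < l w" if nz: "coef h z \<noteq> 0"
      proof -
        have "coef c z \<noteq> 0 \<or> coef c (s \<otimes> z) \<noteq> 0"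
        proof (rule ccontr)
          assume "\<not> ?thesis"
          then show False using nz coef[OF z(1)] by (simp split: if_splits)
        qed
        then consider "z = v" | "l z < l v" | "s \<otimes> z = v" | "l (s \<otimes> z) < l v"
          using cd(5)[OF z(1)] cd(5)[of "s \<otimes> z"] sv z by auto
        then show ?thesis
        proof cases
          case 3
          then show ?thesis using z sv S_cancel[OF sv(1) z(1)] by simp
        next
          case 4
          then show ?thesis
            using length_mult_le[OF sv(1), of "s \<otimes> z"] S_cancel[OF sv(1) z(1)] sv z by simp
        qed (use sv in auto)
      qed
      then show "l z < l w" if "coef h z \<noteq> 0" using that .
      show "pos_supp (coef h z)" if "l w \<le> l z"
        using small that by (cases "coef h z = 0") auto
    qed
    then show ?thesis by blast
  qed
  show ?case
  proof (cases "w = \<one>")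
    case True
    then show ?thesis using is_kl_one by blast
  next
    case False
    have "\<forall>y. \<exists>c. y \<in> carrier H \<and> l y < l w \<longrightarrow> is_kl y c"
      using less.hyps by blast
    from choice[OF this] obtain c where c: "\<And>y. y \<in> carrier H \<Longrightarrow> l y < l w \<Longrightarrow> is_kl y (c y)"
      by blast
    have "0 \<le> l w" by simp
    then have "\<exists>h. is_pre_kl w 0 h"
    proof (induction rule: inc_induct)
      case base
      then show ?case using start[OF False] .
    next
      case (step k)
      then obtain h where "is_pre_kl w (Suc k) h" by blast
      then show ?case
        by (rule pre_kl_step) (use less.prems step c in auto)
    qed
    then show ?thesis by (auto simp: is_pre_kl_def is_kl_def)
  qed
qed

abbreviation KL :: "'w \<Rightarrow> ('w, 'g) hecke_elt" where "KL \<equiv> kl_basis H"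

lemma kl_basis_eqI:
  assumes w: "w \<in> carrier H" and c: "is_kl w c"
  shows "KL w = c"
  unfolding kl_basis_def
proof (rule the_equality)
  have c': "c \<in> HH" "bar c = c" "\<And>z. coef c z \<in> AZ" "coef c w = (- 1) ^ l w"
    "\<And>z. z \<in> carrier H \<Longrightarrow> z \<noteq> w \<Longrightarrow> pos_supp (coef c z)"
    using c by (auto simp: is_kl_def)
  have sum_coef: "coef (smul ((- 1) ^ l w) (T w) + (\<Sum>y\<in>carrier H. smul (p y) (T y))) z =
      (if z = w then (- 1) ^ l w else 0) + p z" if "z \<in> carrier H" for p z
  proof -
    have "coef (\<Sum>y\<in>carrier H. smul (p y) (T y)) z = (\<Sum>y\<in>carrier H. if y = z then p y else 0)"
      unfolding lookup_sum by (rule sum.cong) (auto simp: lookup_single when_def)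
    then show ?thesis
      using that finite_W by (simp add: lookup_add lookup_single when_def)
  qed
  have sum_HH: "smul ((- 1) ^ l w) (T w) + (\<Sum>y\<in>carrier H. smul (p y) (T y)) \<in> HH"
    if "\<forall>y\<in>carrier H. p y \<in> AZ" for p
    using that AZ_subset w sign_A by (intro HH_add HH_sum HH_smul) auto
  show "c \<in> HH \<and> bar c = c \<and> (\<exists>p. (\<forall>y\<in>carrier H. p y \<in> group_ring_pos \<int>) \<and>
      c = smul ((- 1) ^ l w) (T w) + (\<Sum>y\<in>carrier H. smul (p y) (T y)))"
  proof (intro conjI exI[of _ "\<lambda>z. if z = w then 0 else coef c z"])
    show "c = smul ((- 1) ^ l w) (T w) + (\<Sum>y\<in>carrier H. smul (if y = w then 0 else coef c y) (T y))"
      by (rule hecke_eqI[OF c'(1) sum_HH]) (use c' AZ_closed in \<open>auto simp: sum_coef\<close>)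
  qed (use c' AZ_closed in \<open>auto simp: group_ring_pos_iff\<close>)
  fix x assume "x \<in> HH \<and> bar x = x \<and> (\<exists>p. (\<forall>y\<in>carrier H. p y \<in> group_ring_pos \<int>) \<and>
      x = smul ((- 1) ^ l w) (T w) + (\<Sum>y\<in>carrier H. smul (p y) (T y)))"
  then obtain p where x: "x \<in> HH" "bar x = x" "\<And>y. y \<in> carrier H \<Longrightarrow> p y \<in> AZ \<and> pos_supp (p y)"
    "x = smul ((- 1) ^ l w) (T w) + (\<Sum>y\<in>carrier H. smul (p y) (T y))"
    by (auto simp: group_ring_pos_iff)
  have "x - c = 0"
  proof (rule bar_invariant_pos_eq_0)
    show "x - c \<in> HH" "bar (x - c) = x - c" using x c' by (simp_all add: HH_diff bar_diff)
    show "pos_supp (coef (x - c) z)" if z: "z \<in> carrier H" for z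
    proof (cases "z = w")
      case True
      then show ?thesis using x(3)[OF z] c'(4) z by (simp add: lookup_minus x(4) sum_coef)
    next
      case False
      then show ?thesis
        using pos_supp_add[OF conjunct2[OF x(3)[OF z]] pos_supp_uminus[OF c'(5)[OF z False]]] z
        by (simp add: lookup_minus x(4) sum_coef)
    qed
  qed
  then show "x = c" by simp
qed

lemma KL_is_kl: "w \<in> carrier H \<Longrightarrow> is_kl w (KL w)"
  using is_kl_exists kl_basis_eqI by metis

lemma HH_KL: "w \<in> carrier H \<Longrightarrow> KL w \<in> HH"
  and coef_KL_self: "w \<in> carrier H \<Longrightarrow> coef (KL w) w = (- 1) ^ l w"
  and coef_KL_pos: "w \<in> carrier H \<Longrightarrow> z \<in> carrier H \<Longrightarrow> z \<noteq> w \<Longrightarrow> pos_supp (coef (KL w) z)"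
  and coef_KL_less: "w \<in> carrier H \<Longrightarrow> z \<in> carrier H \<Longrightarrow> z \<noteq> w \<Longrightarrow> coef (KL w) z \<noteq> 0 \<Longrightarrow> l z < l w"
  using KL_is_kl[of w] by (simp_all add: is_kl_def)

lemma star_KL:
  assumes w: "w \<in> carrier H"
  shows "star (KL w) = KL (inv w)"
proof (rule kl_basis_eqI[symmetric])
  have k: "is_kl w (KL w)" by (rule KL_is_kl[OF w])
  show "is_kl (inv w) (star (KL w))"
    unfolding is_kl_def
  proof (intro conjI ballI allI impI)
    show "star (KL w) \<in> HH" using HH_KL[OF w] by (rule HH_star)
    show "bar (star (KL w)) = star (KL w)"
      using star_bar[OF HH_KL[OF w]] k by (simp add: is_kl_def)
    show "coef (star (KL w)) z \<in> AZ" for z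
      using k coef_outside[OF HH_star[OF HH_KL[OF w]], of z] AZ_closed
      by (cases "z \<in> carrier H") (auto simp: is_kl_def coef_star)
    show "coef (star (KL w)) (inv w) = (- 1) ^ l (inv w)"
      using w by (simp add: coef_star coef_KL_self)
    fix z assume z: "z \<in> carrier H" "z \<noteq> inv w"
    then have "inv z \<in> carrier H" "inv z \<noteq> w" using w by auto
    then show "pos_supp (coef (star (KL w)) z)" "coef (star (KL w)) z \<noteq> 0 \<Longrightarrow> l z < l (inv w)"
      using coef_KL_pos[OF w] coef_KL_less[OF w, of "inv z"] z w by (auto simp: coef_star)
  qed
qed (use w in simp)

lemma KL_independent:
  assumes a: "(\<Sum>z\<in>carrier H. smul (a z) (KL z)) = 0" and w: "w \<in> carrier H"
  shows "a w = 0"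
proof (rule ccontr)
  assume "a w \<noteq> 0"
  define Z where "Z = {z \<in> carrier H. a z \<noteq> 0}"
  have "Z \<noteq> {}" "finite Z" using w \<open>a w \<noteq> 0\<close> finite_W by (auto simp: Z_def)
  then obtain z where z: "z \<in> Z" "\<And>y. y \<in> Z \<Longrightarrow> l y \<le> l z"
    using finite_ex_max[of Z l] by blast
  then have zW: "z \<in> carrier H" by (simp add: Z_def)
  have "0 = coef (\<Sum>y\<in>carrier H. smul (a y) (KL y)) z" using a by simp
  also have "\<dots> = (\<Sum>y\<in>carrier H. if y = z then a y * (- 1) ^ l y else 0)"
    unfolding lookup_sum lookup_smul
  proof (rule sum.cong)
    fix y assume y: "y \<in> carrier H"
    show "a y * coef (KL y) z = (if y = z then a y * (- 1) ^ l y else 0)"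
    proof (cases "y = z \<or> coef (KL y) z = 0")
      case True
      then show ?thesis using coef_KL_self[OF zW] by auto
    next
      case False
      then have "l z < l y" using coef_KL_less[OF y zW] by auto
      then have "a y = 0" using z(2)[of y] y by (auto simp: Z_def)
      then show ?thesis by auto
    qed
  qed simp
  also have "\<dots> = a z * (- 1) ^ l z" using zW finite_W by simp
  finally show False using z by (simp add: Z_def)
qed

lemma T_expand_KL:
  "z \<in> carrier H \<Longrightarrow> \<exists>q. (\<forall>w. q w \<in> A \<and> pos_supp (q w - (if w = z then (- 1) ^ l z else 0))) \<and>
     T z = (\<Sum>w\<in>carrier H. smul (q w) (KL w))"
proof (induction "l z" arbitrary: z rule: less_induct)
  case less
  have "\<forall>y. \<exists>q. y \<in> carrier H \<and> l y < l z \<longrightarrow>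
      (\<forall>w. q w \<in> A \<and> pos_supp (q w - (if w = y then (- 1) ^ l y else 0))) \<and>
      T y = (\<Sum>w\<in>carrier H. smul (q w) (KL w))"
    using less.hyps by blast
  from choice[OF this] obtain q where "\<forall>y. y \<in> carrier H \<and> l y < l z \<longrightarrow>
      (\<forall>w. q y w \<in> A \<and> pos_supp (q y w - (if w = y then (- 1) ^ l y else 0))) \<and>
      T y = (\<Sum>w\<in>carrier H. smul (q y w) (KL w))"
    by blast
  then have q: "\<And>y w. y \<in> carrier H \<Longrightarrow> l y < l z \<Longrightarrow> q y w \<in> A"
    "\<And>y w. y \<in> carrier H \<Longrightarrow> l y < l z \<Longrightarrow> pos_supp (q y w - (if w = y then (- 1) ^ l y else 0))"
    "\<And>y. y \<in> carrier H \<Longrightarrow> l y < l z \<Longrightarrow> T y = (\<Sum>w\<in>carrier H. smul (q y w) (KL w))"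
    by simp_all
  define Y where "Y = {y \<in> carrier H. l y < l z}"
  have fY: "finite Y" "Y \<subseteq> carrier H" "z \<notin> Y" using finite_W by (auto simp: Y_def)
  have sgn: "smul ((- 1) ^ l z) (smul ((- 1) ^ l z) x) = x" for x :: "('w, 'g) hecke_elt"
    by (simp add: power_mult_distrib[symmetric])
  have "KL z = (\<Sum>y\<in>insert z Y. smul (coef (KL z) y) (T y))"
  proof -
    have "(\<Sum>y\<in>carrier H. smul (coef (KL z) y) (T y)) = (\<Sum>y\<in>insert z Y. smul (coef (KL z) y) (T y))"
    proof (rule sum.mono_neutral_right)
      have "coef (KL z) y = 0" if "y \<in> carrier H - insert z Y" for y
        using coef_KL_less[OF less.prems, of y] that by (auto simp: Y_def)
      then show "\<forall>y\<in>carrier H - insert z Y. smul (coef (KL z) y) (T y) = 0"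
        by simp
    qed (use finite_W less.prems in \<open>auto simp: Y_def\<close>)
    then show ?thesis using hecke_expand[OF HH_KL[OF less.prems]] by simp
  qed
  also have "\<dots> = smul ((- 1) ^ l z) (T z) + (\<Sum>y\<in>Y. smul (coef (KL z) y) (T y))"
    using fY coef_KL_self[OF less.prems] by simp
  finally have "smul ((- 1) ^ l z) (T z) = KL z - (\<Sum>y\<in>Y. smul (coef (KL z) y) (T y))"
    unfolding eq_diff_eq by (rule sym)
  also have "(\<Sum>y\<in>Y. smul (coef (KL z) y) (T y)) = (\<Sum>y\<in>Y. \<Sum>w\<in>carrier H. smul (coef (KL z) y * q y w) (KL w))"
    by (rule sum.cong) (use q(3) in \<open>auto simp: Y_def smul_sum\<close>)
  also have "\<dots> = (\<Sum>w\<in>carrier H. smul (\<Sum>y\<in>Y. coef (KL z) y * q y w) (KL w))"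
    by (subst sum.swap) (simp add: smul_sum_left)
  finally have Tz: "smul ((- 1) ^ l z) (T z) = KL z - (\<Sum>w\<in>carrier H. smul (\<Sum>y\<in>Y. coef (KL z) y * q y w) (KL w))" .
  have "(\<Sum>w\<in>carrier H. smul (if w = z then 1 else 0) (KL w)) = (\<Sum>w\<in>carrier H. if w = z then KL w else 0)"
    by (rule sum.cong) auto
  then have KLz: "(\<Sum>w\<in>carrier H. smul (if w = z then 1 else 0) (KL w)) = KL z"
    using less.prems finite_W by simp
  have *: "smul ((- 1) ^ l z) (T z) =
      (\<Sum>w\<in>carrier H. smul ((if w = z then 1 else 0) - (\<Sum>y\<in>Y. coef (KL z) y * q y w)) (KL w))"
    unfolding smul_diff_left sum_subtractf KLz Tz ..
  define q' where "q' = (\<lambda>w. (- 1) ^ l z * ((if w = z then 1 else 0) - (\<Sum>y\<in>Y. coef (KL z) y * q y w)))"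
  have "T z = (\<Sum>w\<in>carrier H. smul (q' w) (KL w))"
    using arg_cong[OF *, of "smul ((- 1) ^ l z)"] unfolding sgn by (simp add: smul_sum q'_def)
  moreover have "q' w \<in> A" for w
    unfolding q'_def using q(1) HH_KL[OF less.prems]
    by (auto simp: Y_def intro!: A_closed sign_A coef_A)
  moreover have "pos_supp (q' w - (if w = z then (- 1) ^ l z else 0))" for w
  proof -
    have sgn_nn: "nonneg_supp ((- 1) ^ n :: 'g \<Rightarrow>\<^sub>0 complex)" for n
      by (induction n) (simp_all add: nonneg_supp_def in_keys_iff)
    have nn: "nonneg_supp (q y w)" if "y \<in> Y" for y
    proof -
      have "nonneg_supp ((q y w - (if w = y then (- 1) ^ l y else 0)) + (if w = y then (- 1) ^ l y else 0))"
        by (rule nonneg_supp_add[OF pos_supp_imp_nonneg]) (use q(2) that sgn_nn in \<open>auto simp: Y_def\<close>)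
      then show ?thesis by simp
    qed
    have "pos_supp (- (\<Sum>y\<in>Y. coef (KL z) y * q y w) * (- 1) ^ l z)"
      using nn fY coef_KL_pos[OF less.prems]
      by (intro pos_supp_mult_nonneg sgn_nn pos_supp_uminus pos_supp_sum pos_supp_mult_nonneg) auto
    moreover have "q' w - (if w = z then (- 1) ^ l z else 0) = - (\<Sum>y\<in>Y. coef (KL z) y * q y w) * (- 1) ^ l z"
      by (simp add: q'_def algebra_simps)
    ultimately show ?thesis by simp
  qed
  ultimately show ?case by blast
qed

lemma KL_expand_exists:
  assumes h: "h \<in> HH"
  shows "\<exists>c\<in>HH. h = (\<Sum>z\<in>carrier H. smul (coef c z) (KL z))"
  using h
proof (induction rule: hecke_linear_induct)
  case (T z)
  then obtain q where q: "\<And>w. q w \<in> A" "T z = (\<Sum>w\<in>carrier H. smul (q w) (KL w))"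
    using T_expand_KL by blast
  define c where "c = (\<Sum>w\<in>carrier H. smul (q w) (T w))"
  have "c \<in> HH" unfolding c_def using q by (intro HH_sum HH_smul) auto
  moreover have "coef c w = q w" if "w \<in> carrier H" for w
  proof -
    have "coef c w = (\<Sum>x\<in>carrier H. if x = w then q x else 0)"
      unfolding c_def lookup_sum by (rule sum.cong) (auto simp: lookup_single when_def)
    then show ?thesis using that finite_W by simp
  qed
  ultimately show ?case using q by (intro bexI[of _ c]) auto
next
  case (add x y)
  then obtain c c' where "c \<in> HH" "c' \<in> HH" "x = (\<Sum>z\<in>carrier H. smul (coef c z) (KL z))"
    "y = (\<Sum>z\<in>carrier H. smul (coef c' z) (KL z))" by blast
  then show ?case
    by (intro bexI[of _ "c + c'"]) (simp_all add: lookup_add smul_add_left sum.distrib HH_add)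
next
  case (smul a x)
  then obtain c where "c \<in> HH" "x = (\<Sum>z\<in>carrier H. smul (coef c z) (KL z))" by blast
  then show ?case using smul
    by (intro bexI[of _ "smul a c"]) (simp_all add: smul_sum HH_smul)
qed

abbreviation kl :: "('w, 'g) hecke_elt \<Rightarrow> 'w \<Rightarrow> 'g \<Rightarrow>\<^sub>0 complex" where
  "kl h w \<equiv> coef (kl_coords H h) w"

lemma kl_coords_eq:
  assumes "c \<in> HH" "h = (\<Sum>z\<in>carrier H. smul (coef c z) (KL z))"
  shows "kl_coords H h = c"
  unfolding kl_coords_def
proof (rule the_equality)
  fix c' assume c': "c' \<in> HH \<and> h = (\<Sum>z\<in>carrier H. smul (coef c' z) (KL z))"
  then have "(\<Sum>z\<in>carrier H. smul (coef c' z - coef c z) (KL z)) = 0"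
    using assms by (simp add: smul_diff_left sum_subtractf)
  then show "c' = c"
    using KL_independent[of "\<lambda>z. coef c' z - coef c z"] c' assms by (intro hecke_eqI) auto
qed (use assms in simp)

lemma HH_kl_coords: "h \<in> HH \<Longrightarrow> kl_coords H h \<in> HH"
  and kl_expand: "h \<in> HH \<Longrightarrow> h = (\<Sum>z\<in>carrier H. smul (kl h z) (KL z))"
  using KL_expand_exists kl_coords_eq by metis+

lemma kl_A: "h \<in> HH \<Longrightarrow> kl h w \<in> A"
  using HH_kl_coords coef_A by blast

lemma kl_coords_add: "x \<in> HH \<Longrightarrow> y \<in> HH \<Longrightarrow> kl_coords H (x + y) = kl_coords H x + kl_coords H y"
  by (rule kl_coords_eq)
    (use kl_expand[of x] kl_expand[of y] in \<open>auto simp: HH_add HH_kl_coords lookup_add smul_add_left sum.distrib\<close>)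

lemma kl_coords_smul: "a \<in> A \<Longrightarrow> x \<in> HH \<Longrightarrow> kl_coords H (smul a x) = smul a (kl_coords H x)"
  using arg_cong[OF kl_expand[of x], of "smul a"]
  by (intro kl_coords_eq) (simp_all add: HH_smul HH_kl_coords smul_sum)

lemma kl_coords_zero [simp]: "kl_coords H 0 = 0"
  by (rule kl_coords_eq) auto

lemma kl_coords_sum: "(\<And>i. i \<in> I \<Longrightarrow> f i \<in> HH) \<Longrightarrow> kl_coords H (sum f I) = (\<Sum>i\<in>I. kl_coords H (f i))"
  by (induction I rule: infinite_finite_induct) (auto simp: kl_coords_add HH_sum)

lemma kl_coords_KL:
  assumes "w \<in> carrier H" shows "kl_coords H (KL w) = T w"
proof (rule kl_coords_eq)
  have "(\<Sum>z\<in>carrier H. smul (coef (T w) z) (KL z)) = (\<Sum>z\<in>carrier H. if z = w then KL z else 0)"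
    by (rule sum.cong) (auto simp: lookup_single when_def)
  then show "KL w = (\<Sum>z\<in>carrier H. smul (coef (T w) z) (KL z))"
    using assms finite_W by simp
qed (use assms in simp)

lemma kl_T_pos:
  assumes z: "z \<in> carrier H" and w: "w \<in> carrier H"
  shows "pos_supp (kl (T z) w - (if w = z then (- 1) ^ l z else 0))"
proof -
  obtain q where q: "\<And>w. pos_supp (q w - (if w = z then (- 1) ^ l z else 0))"
    "T z = (\<Sum>w\<in>carrier H. smul (q w) (KL w))"
    using T_expand_KL[OF z] by blast
  have "(\<Sum>w\<in>carrier H. smul (kl (T z) w - q w) (KL w)) = 0"
    unfolding smul_diff_left sum_subtractf q(2)[symmetric] kl_expand[OF HH_T[OF z], symmetric] by simp
  then have "kl (T z) w = q w"
    using KL_independent[of "\<lambda>w. kl (T z) w - q w"] w by simp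
  then show ?thesis using q(1) by simp
qed

lemma kl_eq_sum:
  assumes "h \<in> HH"
  shows "kl h w = (\<Sum>z\<in>carrier H. coef h z * kl (T z) w)"
proof -
  have "kl_coords H h = (\<Sum>z\<in>carrier H. smul (coef h z) (kl_coords H (T z)))"
    using kl_coords_sum[of "carrier H" "\<lambda>z. smul (coef h z) (T z)"] hecke_expand[OF assms] coef_A[OF assms]
    by (simp add: HH_smul kl_coords_smul)
  then show ?thesis by (simp add: lookup_sum)
qed

lemma hcoef_A: "x \<in> carrier H \<Longrightarrow> y \<in> carrier H \<Longrightarrow> hcoef H x y z \<in> A"
  unfolding hcoef_def by (intro kl_A HH_mult HH_KL)

lemma lr_le_refl: "lr_le H x x"
  by (simp add: lr_le_def)

lemma lr_le_trans: "lr_le H x y \<Longrightarrow> lr_le H y z \<Longrightarrow> lr_le H x z"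
  unfolding lr_le_def by (rule rtranclp_trans)

lemma lr_le_hcoef:
  assumes "x \<in> carrier H" "w \<in> carrier H" "y \<in> carrier H"
  shows "hcoef H x w y \<noteq> 0 \<Longrightarrow> lr_le H y w" "hcoef H w x y \<noteq> 0 \<Longrightarrow> lr_le H y w"
  using assms unfolding lr_le_def lr_step_def by (auto intro!: r_into_rtranclp)

end

section \<open>Schur relations and leading coefficients\<close>

lemma to_fract_sum: "to_fract (sum f I) = (\<Sum>i\<in>I. to_fract (f i))"
  by (induction I rule: infinite_finite_induct) (simp_all add: to_fract_add)

lemma to_fract_of_nat: "to_fract (of_nat n) = of_nat n"
  by (induction n) (simp_all add: to_fract_add)

lemma has_leading_uminus:
  assumes "is_subfield F" "has_leading F x r g"
  shows "has_leading F (- x) (- r) g"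
proof -
  obtain p q where pq: "r \<in> F" "r \<noteq> 0" "p \<in> group_ring_pos F" "q \<in> group_ring_pos F"
    "x = Fract (Poly_Mapping.single g r * (1 + p)) (1 + q)"
    using assms(2) by (auto simp: has_leading_def)
  have "- x = Fract (Poly_Mapping.single g (- r) * (1 + p)) (1 + q)"
    unfolding pq(5) by (simp add: single_uminus)
  then show ?thesis
    unfolding has_leading_def using pq is_subring_closed(3)[OF is_subfield_subring[OF assms(1)]] by auto
qed

lemma valuation_ring_uminus:
  assumes R: "is_subring R" and x: "x \<in> valuation_ring R"
  shows "- x \<in> valuation_ring R"
proof -
  obtain a b where ab: "x = Fract a b" "a \<in> group_ring R" "b \<in> group_ring R" "b \<noteq> 0"
    using x by (auto simp: valuation_ring_def fraction_field_def)
  have "- x = Fract (- a) b" using ab by simp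
  then have "- x \<in> fraction_field R"
    unfolding fraction_field_def using ab is_subring_closed(3)[OF is_subring_group_ring[OF R]] by blast
  then show ?thesis
    using x has_leading_uminus[OF is_subfield_fraction_subfield[OF R]]
    unfolding valuation_ring_def by fastforce
qed

locale leading_coefficients = hecke H
  for H :: "('w, 'g::linordered_ab_group_add) hecke_data" (structure) +
  fixes \<Lambda> :: "'l set" and d :: "'l \<Rightarrow> nat" and E :: "'l \<Rightarrow> 'w \<Rightarrow> complex mat"
    and \<rho> :: "'l \<Rightarrow> 'w \<Rightarrow> ('g \<Rightarrow>\<^sub>0 complex) fract mat"
    and a :: "'l \<Rightarrow> 'g" and f :: "'l \<Rightarrow> real" and c :: "'l \<Rightarrow> 'w \<Rightarrow> complex mat"
  assumes splitting_field: "splitting_field H"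
    and irreps_indexed: "irreps_indexed_by H \<Lambda> d E"
    and afforded: "\<And>\<mu>. \<mu> \<in> \<Lambda> \<Longrightarrow> afforded_by_specialisation H (d \<mu>) (E \<mu>) (\<rho> \<mu>)"
    and schur: "\<And>\<mu>. \<mu> \<in> \<Lambda> \<Longrightarrow> schur_invariants H (d \<mu>) (\<rho> \<mu>) (a \<mu>) (f \<mu>)"
    and bal: "\<And>\<mu>. \<mu> \<in> \<Lambda> \<Longrightarrow> balanced H (d \<mu>) (a \<mu>) (\<rho> \<mu>)"
    and c_def: "c = (\<lambda>\<mu>. leading_matrix H (d \<mu>) (a \<mu>) (\<rho> \<mu>))"
begin

sublocale irr: group_irreps H \<Lambda> d E
  by unfold_locales (simp_all add: finite_W subring_R splitting_field irreps_indexed)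

abbreviation entries :: "('l \<times> nat \<times> nat) set" where
  "entries \<equiv> SIGMA \<mu>:\<Lambda>. {..<d \<mu>} \<times> {..<d \<mu>}"

lemma finite_entries: "finite entries"
  using irr.finite_Lambda by auto

definition r :: "'l \<Rightarrow> 'w \<Rightarrow> nat \<Rightarrow> nat \<Rightarrow> ('g \<Rightarrow>\<^sub>0 complex) fract" where
  "r \<mu> w i j = \<rho> \<mu> w $$ (i, j)"

definition R :: "'l \<Rightarrow> ('w, 'g) hecke_elt \<Rightarrow> nat \<Rightarrow> nat \<Rightarrow> ('g \<Rightarrow>\<^sub>0 complex) fract" where
  "R \<mu> h i j = (\<Sum>w\<in>carrier H. to_fract (coef h w) * r \<mu> w i j)"

lemma rep: "\<mu> \<in> \<Lambda> \<Longrightarrow> hecke_mrep H (d \<mu>) (\<rho> \<mu>)"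
  using afforded[of \<mu>] by (simp add: afforded_by_specialisation_def)

lemma rho_carrier: "\<mu> \<in> \<Lambda> \<Longrightarrow> w \<in> carrier H \<Longrightarrow> \<rho> \<mu> w \<in> carrier_mat (d \<mu>) (d \<mu>)"
  using rep[of \<mu>] mats_overD(1) by (auto simp: hecke_mrep_def)

lemma r_one: "\<mu> \<in> \<Lambda> \<Longrightarrow> i < d \<mu> \<Longrightarrow> j < d \<mu> \<Longrightarrow> r \<mu> \<one> i j = (if i = j then 1 else 0)"
  using rep[of \<mu>] by (simp add: hecke_mrep_def r_def)

lemma R_T_mult_T:
  assumes "\<mu> \<in> \<Lambda>" "x \<in> carrier H" "y \<in> carrier H" "i < d \<mu>" "j < d \<mu>"
  shows "R \<mu> (T x \<star> T y) i j = (\<Sum>k<d \<mu>. r \<mu> x i k * r \<mu> y k j)"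
proof -
  have "(\<rho> \<mu> x * \<rho> \<mu> y) $$ (i, j) = R \<mu> (T x \<star> T y) i j"
    using rep[OF assms(1)] assms(2-5) by (simp add: hecke_mrep_def R_def r_def)
  then show ?thesis
    using rho_carrier[OF assms(1,2)] rho_carrier[OF assms(1,3)] assms(4,5)
    by (simp add: scalar_prod_def atLeast0LessThan r_def)
qed

lemma R_T:
  assumes "w \<in> carrier H" shows "R \<mu> (T w) i j = r \<mu> w i j"
proof -
  have "R \<mu> (T w) i j = (\<Sum>x\<in>carrier H. if x = w then r \<mu> x i j else 0)"
    unfolding R_def by (rule sum.cong) (auto simp: lookup_single when_def)
  then show ?thesis using assms finite_W by simp
qed

lemma R_add: "R \<mu> (x + y) i j = R \<mu> x i j + R \<mu> y i j"
  by (simp add: R_def lookup_add to_fract_add distrib_right sum.distrib)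

lemma R_smul: "R \<mu> (smul b x) i j = to_fract b * R \<mu> x i j"
  by (simp add: R_def to_fract_mult sum_distrib_left mult.assoc)

lemma R_mult:
  assumes \<mu>: "\<mu> \<in> \<Lambda>" and ij: "i < d \<mu>" "j < d \<mu>" and x: "x \<in> HH" and y: "y \<in> HH"
  shows "R \<mu> (x \<star> y) i j = (\<Sum>k<d \<mu>. R \<mu> x i k * R \<mu> y k j)"
  using x
proof (induction rule: hecke_linear_induct)
  case (T w)
  show ?case
    using y
  proof (induction rule: hecke_linear_induct)
    case (T v)
    then show ?case using R_T_mult_T[OF \<mu> _ _ ij] \<open>w \<in> carrier H\<close> by (simp add: R_T)
  next
    case (add y z)
    then show ?case
      using T by (simp add: mult_add_right R_add distrib_left sum.distrib)
  next
    case (smul b y)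
    then show ?case
      using T by (simp add: mult_smul_right R_smul sum_distrib_left mult_ac)
  qed
next
  case (add x z)
  then show ?case
    using y by (simp add: mult_add_left R_add distrib_right sum.distrib)
next
  case (smul b x)
  then show ?case
    using y by (simp add: mult_smul_left R_smul sum_distrib_left mult_ac)
qed

text \<open>The trace form of \<open>\<Oplus>\<^sub>\<mu> d\<^sub>\<mu> \<rho>\<^sup>\<mu>\<close> specialises to a multiple of the trace form of the
  group algebra, so it is nondegenerate; hence the matrix coefficients are linearly independent.\<close>

lemma matrix_units:
  assumes t: "(\<mu>, i, j) \<in> entries"
  shows "\<exists>n. \<forall>\<nu>\<in>\<Lambda>. \<forall>k<d \<nu>. \<forall>m<d \<nu>.
    (\<Sum>w\<in>carrier H. n w * r \<nu> w k m) = (if \<mu> = \<nu> \<and> i = k \<and> j = m then 1 else 0)"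
proof -
  have "\<forall>\<mu> w. \<exists>t. \<mu> \<in> \<Lambda> \<and> w \<in> carrier H \<longrightarrow> mtrace (\<rho> \<mu> w) = to_fract t \<and> mtrace (E \<mu> w) = theta1 t"
    using afforded unfolding afforded_by_specialisation_def by blast
  then obtain tr where tr: "\<And>\<mu> w. \<mu> \<in> \<Lambda> \<Longrightarrow> w \<in> carrier H \<Longrightarrow> mtrace (\<rho> \<mu> w) = to_fract (tr \<mu> w)"
    "\<And>\<mu> w. \<mu> \<in> \<Lambda> \<Longrightarrow> w \<in> carrier H \<Longrightarrow> mtrace (E \<mu> w) = theta1 (tr \<mu> w)"
    by metis
  define \<tau> where "\<tau> = (\<lambda>z. \<Sum>\<mu>\<in>\<Lambda>. of_nat (d \<mu>) * tr \<mu> z)"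
  have theta1_of_nat: "theta1 (of_nat n) = of_nat n" for n
    by (induction n) (simp_all add: theta1_add)
  have \<tau>1: "theta1 (\<tau> z) = (if z = \<one> then irr.order_W else 0)" if "z \<in> carrier H" for z
    using irr.sum_dim_character[OF that] tr(2)[OF _ that]
    by (simp add: \<tau>_def theta1_sum theta1_mult theta1_of_nat)
  have \<tau>: "to_fract (\<tau> z) = (\<Sum>\<mu>\<in>\<Lambda>. \<Sum>i<d \<mu>. of_nat (d \<mu>) * r \<mu> z i i)" if "z \<in> carrier H" for z
    unfolding \<tau>_def to_fract_sum
  proof (rule sum.cong)
    fix \<mu> assume \<mu>: "\<mu> \<in> \<Lambda>"
    have "dim_row (\<rho> \<mu> z) = d \<mu>" using rho_carrier[OF \<mu> that] by blast
    then show "to_fract (of_nat (d \<mu>) * tr \<mu> z) = (\<Sum>i<d \<mu>. of_nat (d \<mu>) * r \<mu> z i i)"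
      using tr(1)[OF \<mu> that] by (simp add: to_fract_mult to_fract_of_nat mtrace_def r_def flip: sum_distrib_left)
  qed simp
  define G where "G = (\<lambda>x y. \<Sum>z\<in>carrier H. coef (T x \<star> T (inv y)) z * \<tau> z)"
  have G1: "theta1 (G x y) = (if x = y then irr.order_W else 0)" if "x \<in> carrier H" "y \<in> carrier H" for x y
  proof -
    have "theta1 (G x y) = (\<Sum>z\<in>carrier H. (if z = x \<otimes> inv y then 1 else 0) * theta1 (\<tau> z))"
      unfolding G_def theta1_sum theta1_mult by (rule sum.cong) (use that theta1_coef_T_mult in auto)
    also have "\<dots> = (if x \<otimes> inv y = \<one> then irr.order_W else 0)"
      using that finite_W by (simp add: sum_delta_mult \<tau>1)
    also have "x \<otimes> inv y = \<one> \<longleftrightarrow> x = y"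
      using that by (metis inv_closed inv_inv inv_equality r_inv)
    finally show ?thesis by simp
  qed
  have G: "to_fract (G x y) = (\<Sum>\<mu>\<in>\<Lambda>. \<Sum>i<d \<mu>. \<Sum>k<d \<mu>. r \<mu> x i k * (of_nat (d \<mu>) * r \<mu> (inv y) k i))"
    if "x \<in> carrier H" "y \<in> carrier H" for x y
  proof -
    have "to_fract (G x y) = (\<Sum>z\<in>carrier H. \<Sum>\<mu>\<in>\<Lambda>. \<Sum>i<d \<mu>.
        of_nat (d \<mu>) * (to_fract (coef (T x \<star> T (inv y)) z) * r \<mu> z i i))"
      unfolding G_def to_fract_sum
      by (rule sum.cong) (simp_all add: to_fract_mult \<tau> sum_distrib_left mult_ac)
    also have "\<dots> = (\<Sum>\<mu>\<in>\<Lambda>. \<Sum>i<d \<mu>. of_nat (d \<mu>) * R \<mu> (T x \<star> T (inv y)) i i)"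
      by (simp add: sum.swap[of _ "carrier H"] R_def sum_distrib_left)
    also have "\<dots> = (\<Sum>\<mu>\<in>\<Lambda>. \<Sum>i<d \<mu>. \<Sum>k<d \<mu>. r \<mu> x i k * (of_nat (d \<mu>) * r \<mu> (inv y) k i))"
      by (intro sum.cong refl) (use that in \<open>auto simp: R_T_mult_T sum_distrib_left mult_ac\<close>)
    finally show ?thesis .
  qed
  obtain J where J: "\<And>x z. x \<in> carrier H \<Longrightarrow> z \<in> carrier H \<Longrightarrow>
      (\<Sum>y\<in>carrier H. to_fract (G x y) * J y z) = (if x = z then 1 else 0)"
    using specialisation_imp_invertible[OF finite_W comm_ring_hom_theta1 irr.order_W_neq_0, of G] G1 by blast
  define M where "M = (\<lambda>x (\<mu>, i, k). r \<mu> x i k)"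
  define N where "N = (\<lambda>(\<mu>, i, k) z. \<Sum>y\<in>carrier H. of_nat (d \<mu>) * r \<mu> (inv y) k i * J y z)"
  have MN: "(\<Sum>t\<in>entries. M x t * N t z) = (if x = z then 1 else 0)"
    if "x \<in> carrier H" "z \<in> carrier H" for x z
  proof -
    have "(\<Sum>t\<in>entries. M x t * N t z) = (\<Sum>\<mu>\<in>\<Lambda>. \<Sum>i<d \<mu>. \<Sum>k<d \<mu>. \<Sum>y\<in>carrier H.
        r \<mu> x i k * (of_nat (d \<mu>) * r \<mu> (inv y) k i) * J y z)"
      using irr.finite_Lambda by (simp add: sum_matrix_entries M_def N_def sum_distrib_left mult.assoc)
    also have "\<dots> = (\<Sum>y\<in>carrier H. to_fract (G x y) * J y z)"
      using that by (simp add: sum.swap[of _ "carrier H"] G sum_distrib_right)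
    finally show ?thesis using J that by simp
  qed
  have "(\<Sum>w\<in>carrier H. N (\<mu>, i, j) w * M w (\<nu>, k, m)) = (if (\<mu>, i, j) = (\<nu>, k, m) then 1 else 0)"
    if "\<nu> \<in> \<Lambda>" "k < d \<nu>" "m < d \<nu>" for \<nu> k m
    by (rule left_inverse_imp_right_inverse[OF finite_W finite_entries irr.card_matrix_entries[symmetric] MN])
      (use t that in auto)
  then show ?thesis
    by (intro exI[of _ "N (\<mu>, i, j)"]) (auto simp: M_def)
qed

lemma intertwiner_gen:
  assumes \<mu>\<nu>: "\<mu> \<in> \<Lambda>" "\<nu> \<in> \<Lambda>" and jk: "j < d \<mu>" "k < d \<nu>" and iq: "i < d \<mu>" "q < d \<nu>"
    and s: "s \<in> gens H"
  defines "P \<equiv> \<lambda>p q. \<Sum>w\<in>carrier H. r \<mu> w p j * r \<nu> (inv w) k q"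
  shows "(\<Sum>p<d \<mu>. r \<mu> s i p * P p q) = (\<Sum>p<d \<nu>. P i p * r \<nu> s p q)"
proof -
  define x where "x = (\<lambda>w. to_fract (if l (s \<otimes> w) < l w then \<xi> s else 0))"
  have "(\<Sum>p<d \<mu>. r \<mu> s i p * P p q) = (\<Sum>w\<in>carrier H. (\<Sum>p<d \<mu>. r \<mu> s i p * r \<mu> w p j) * r \<nu> (inv w) k q)"
    unfolding P_def by (simp add: sum_distrib_left sum_distrib_right sum.swap[of _ "carrier H"] mult.assoc)
  also have "\<dots> = (\<Sum>w\<in>carrier H. (r \<mu> (s \<otimes> w) i j + x w * r \<mu> w i j) * r \<nu> (inv w) k q)"
    by (intro sum.cong refl)
      (use \<mu>\<nu> jk iq s in \<open>simp add: R_T_mult_T[symmetric] Ts_Tw R_add R_smul R_T x_def\<close>)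
  also have "\<dots> = (\<Sum>w\<in>carrier H. r \<mu> (s \<otimes> w) i j * r \<nu> (inv w) k q) +
      (\<Sum>w\<in>carrier H. r \<mu> w i j * (x w * r \<nu> (inv w) k q))"
    by (simp add: distrib_right distrib_left sum.distrib mult_ac)
  also have "(\<Sum>w\<in>carrier H. r \<mu> (s \<otimes> w) i j * r \<nu> (inv w) k q) =
      (\<Sum>w\<in>carrier H. r \<mu> w i j * r \<nu> (inv w \<otimes> s) k q)"
    by (rule sum.reindex_bij_witness[of _ "\<lambda>w. s \<otimes> w" "\<lambda>w. s \<otimes> w"])
      (use s in \<open>auto simp: S_cancel inv_mult_group S_inv S_cancel_right\<close>)
  also have "\<dots> + (\<Sum>w\<in>carrier H. r \<mu> w i j * (x w * r \<nu> (inv w) k q)) =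
      (\<Sum>w\<in>carrier H. r \<mu> w i j * (r \<nu> (inv w \<otimes> s) k q + x w * r \<nu> (inv w) k q))"
    by (simp add: distrib_left sum.distrib)
  also have "\<dots> = (\<Sum>w\<in>carrier H. r \<mu> w i j * (\<Sum>p<d \<nu>. r \<nu> (inv w) k p * r \<nu> s p q))"
  proof (intro sum.cong refl)
    fix w assume w: "w \<in> carrier H"
    have "(\<Sum>p<d \<nu>. r \<nu> (inv w) k p * r \<nu> s p q) = R \<nu> (T (inv w) \<star> T s) k q"
      using \<mu>\<nu> jk iq s w by (simp add: R_T_mult_T)
    also have "\<dots> = r \<nu> (inv w \<otimes> s) k q + x w * r \<nu> (inv w) k q"
      using s w Tw_Ts[of s "inv w"] length_right[of s "inv w"] by (simp add: R_add R_smul R_T x_def)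
    finally show "r \<mu> w i j * (r \<nu> (inv w \<otimes> s) k q + x w * r \<nu> (inv w) k q) =
        r \<mu> w i j * (\<Sum>p<d \<nu>. r \<nu> (inv w) k p * r \<nu> s p q)" by simp
  qed
  also have "\<dots> = (\<Sum>p<d \<nu>. P i p * r \<nu> s p q)"
    unfolding P_def by (simp add: sum_distrib_left sum_distrib_right sum.swap[of _ "carrier H"] mult.assoc)
  finally show ?thesis .
qed

lemma intertwiner:
  assumes \<mu>\<nu>: "\<mu> \<in> \<Lambda>" "\<nu> \<in> \<Lambda>" and jk: "j < d \<mu>" "k < d \<nu>" and x: "x \<in> carrier H"
    and iq: "i < d \<mu>" "q < d \<nu>"
  defines "P \<equiv> \<lambda>p q. \<Sum>w\<in>carrier H. r \<mu> w p j * r \<nu> (inv w) k q"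
  shows "(\<Sum>p<d \<mu>. r \<mu> x i p * P p q) = (\<Sum>p<d \<nu>. P i p * r \<nu> x p q)"
  using x iq
proof (induction arbitrary: i q rule: coxeter_induct)
  case one
  then show ?case
    using \<mu>\<nu> by (simp add: r_one sum_delta_mult)
next
  case (step s x)
  have rsx: "r \<kappa> (s \<otimes> x) i p = (\<Sum>k<d \<kappa>. r \<kappa> s i k * r \<kappa> x k p)" if "\<kappa> \<in> \<Lambda>" "i < d \<kappa>" "p < d \<kappa>" for \<kappa> i p
    using step.hyps that R_T_mult_T[of \<kappa> s x i p] by (simp add: Ts_Tw_up R_T)
  have "(\<Sum>p<d \<mu>. r \<mu> (s \<otimes> x) i p * P p q) = (\<Sum>p<d \<mu>. (\<Sum>m<d \<mu>. r \<mu> s i m * r \<mu> x m p) * P p q)"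
    by (rule sum.cong) (use rsx \<mu>\<nu> step.prems in auto)
  also have "\<dots> = (\<Sum>m<d \<mu>. r \<mu> s i m * (\<Sum>p<d \<mu>. r \<mu> x m p * P p q))"
    unfolding sum_distrib_left sum_distrib_right by (subst sum.swap) (simp add: mult.assoc)
  also have "\<dots> = (\<Sum>m<d \<mu>. r \<mu> s i m * (\<Sum>p<d \<nu>. P m p * r \<nu> x p q))"
    by (rule sum.cong) (use step in auto)
  also have "\<dots> = (\<Sum>p<d \<nu>. (\<Sum>m<d \<mu>. r \<mu> s i m * P m p) * r \<nu> x p q)"
    unfolding sum_distrib_left sum_distrib_right by (subst sum.swap) (simp add: mult.assoc)
  also have "\<dots> = (\<Sum>p<d \<nu>. (\<Sum>m<d \<nu>. P i m * r \<nu> s m p) * r \<nu> x p q)"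
    by (rule sum.cong) (use intertwiner_gen[OF \<mu>\<nu> jk step.prems(1) _ step.hyps(1)] in \<open>auto simp: P_def\<close>)
  also have "\<dots> = (\<Sum>m<d \<nu>. P i m * (\<Sum>p<d \<nu>. r \<nu> s m p * r \<nu> x p q))"
    unfolding sum_distrib_left sum_distrib_right by (subst sum.swap) (simp add: mult.assoc)
  also have "\<dots> = (\<Sum>m<d \<nu>. P i m * r \<nu> (s \<otimes> x) m q)"
    by (rule sum.cong) (use rsx \<mu>\<nu> step.prems in auto)
  finally show ?case .
qed

lemma intertwiner_scalar:
  assumes \<mu>\<nu>: "\<mu> \<in> \<Lambda>" "\<nu> \<in> \<Lambda>" and jk: "j < d \<mu>" "k < d \<nu>" and pq: "p < d \<mu>" "q < d \<nu>"
    and i: "i < d \<mu>"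
  defines "P \<equiv> \<lambda>p q. \<Sum>w\<in>carrier H. r \<mu> w p j * r \<nu> (inv w) k q"
  shows "P p q = (if \<mu> = \<nu> \<and> p = q then P i i else 0)"
proof -
  obtain n where n: "\<And>\<nu> k m. \<nu> \<in> \<Lambda> \<Longrightarrow> k < d \<nu> \<Longrightarrow> m < d \<nu> \<Longrightarrow>
    (\<Sum>w\<in>carrier H. n w * r \<nu> w k m) = (if \<mu> = \<nu> \<and> i = k \<and> p = m then 1 else 0)"
    using matrix_units[of \<mu> i p] \<mu>\<nu> i pq by auto
  have "P p q = (\<Sum>p'<d \<mu>. (if p = p' then 1 else 0) * P p' q)"
    using pq by (simp add: sum_delta_mult)
  also have "\<dots> = (\<Sum>p'<d \<mu>. (\<Sum>w\<in>carrier H. n w * r \<mu> w i p') * P p' q)"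
    by (rule sum.cong) (use n \<mu>\<nu> i in auto)
  also have "\<dots> = (\<Sum>w\<in>carrier H. n w * (\<Sum>p'<d \<mu>. r \<mu> w i p' * P p' q))"
    unfolding sum_distrib_left sum_distrib_right by (subst sum.swap) (simp add: mult.assoc)
  also have "\<dots> = (\<Sum>w\<in>carrier H. n w * (\<Sum>p'<d \<nu>. P i p' * r \<nu> w p' q))"
    by (rule sum.cong) (use intertwiner[OF \<mu>\<nu> jk _ i pq(2)] in \<open>auto simp: P_def\<close>)
  also have "\<dots> = (\<Sum>p'<d \<nu>. P i p' * (\<Sum>w\<in>carrier H. n w * r \<nu> w p' q))"
    unfolding sum_distrib_left by (subst sum.swap) (simp add: mult_ac)
  also have "\<dots> = (\<Sum>p'<d \<nu>. P i p' * (if \<mu> = \<nu> \<and> i = p' \<and> p = q then 1 else 0))"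
    by (rule sum.cong) (use n \<mu>\<nu> pq in auto)
  also have "\<dots> = (if \<mu> = \<nu> \<and> p = q then P i i else 0)"
    using i by (auto simp: sum_delta_mult)
  finally show ?thesis .
qed

definition schur_elt :: "'l \<Rightarrow> 'g \<Rightarrow>\<^sub>0 complex" where
  "schur_elt \<mu> = (SOME c. c \<in> A \<and>
     (\<Sum>w\<in>carrier H. mtrace (\<rho> \<mu> w) * mtrace (\<rho> \<mu> (inv w))) = of_nat (d \<mu>) * to_fract c \<and>
     (\<exists>p. (\<forall>g\<in>Poly_Mapping.keys p. - (a \<mu> + a \<mu>) < g) \<and>
        c = Poly_Mapping.single (- (a \<mu> + a \<mu>)) (complex_of_real (f \<mu>)) + p))"

lemma schur_elt:
  assumes "\<mu> \<in> \<Lambda>"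
  shows "(\<Sum>w\<in>carrier H. mtrace (\<rho> \<mu> w) * mtrace (\<rho> \<mu> (inv w))) = of_nat (d \<mu>) * to_fract (schur_elt \<mu>)"
    and "\<exists>p. (\<forall>g\<in>Poly_Mapping.keys p. - (a \<mu> + a \<mu>) < g) \<and>
        schur_elt \<mu> = Poly_Mapping.single (- (a \<mu> + a \<mu>)) (complex_of_real (f \<mu>)) + p"
proof -
  have "\<exists>c. c \<in> A \<and>
     (\<Sum>w\<in>carrier H. mtrace (\<rho> \<mu> w) * mtrace (\<rho> \<mu> (inv w))) = of_nat (d \<mu>) * to_fract c \<and>
     (\<exists>p. (\<forall>g\<in>Poly_Mapping.keys p. - (a \<mu> + a \<mu>) < g) \<and>
        c = Poly_Mapping.single (- (a \<mu> + a \<mu>)) (complex_of_real (f \<mu>)) + p)"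
    using schur[OF assms] unfolding schur_invariants_def by blast
  from someI_ex[OF this] show
    "(\<Sum>w\<in>carrier H. mtrace (\<rho> \<mu> w) * mtrace (\<rho> \<mu> (inv w))) = of_nat (d \<mu>) * to_fract (schur_elt \<mu>)"
    "\<exists>p. (\<forall>g\<in>Poly_Mapping.keys p. - (a \<mu> + a \<mu>) < g) \<and>
        schur_elt \<mu> = Poly_Mapping.single (- (a \<mu> + a \<mu>)) (complex_of_real (f \<mu>)) + p"
    unfolding schur_elt_def by blast+
qed

lemma f_pos: "\<mu> \<in> \<Lambda> \<Longrightarrow> 0 < f \<mu>"
  using schur[of \<mu>] by (simp add: schur_invariants_def)

lemma schur_elt_neq_0:
  assumes "\<mu> \<in> \<Lambda>" shows "schur_elt \<mu> \<noteq> 0"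
proof
  assume z: "schur_elt \<mu> = 0"
  obtain p where p: "\<forall>g\<in>Poly_Mapping.keys p. - (a \<mu> + a \<mu>) < g"
    "schur_elt \<mu> = Poly_Mapping.single (- (a \<mu> + a \<mu>)) (complex_of_real (f \<mu>)) + p"
    using schur_elt(2)[OF assms] by blast
  have "- (a \<mu> + a \<mu>) \<notin> Poly_Mapping.keys p" using p(1) by blast
  then have "poly_mapping.lookup (schur_elt \<mu>) (- (a \<mu> + a \<mu>)) = complex_of_real (f \<mu>)"
    unfolding p(2) by (simp add: lookup_add in_keys_iff)
  then show False using z f_pos[OF assms] by simp
qed

theorem Schur_relations:
  assumes \<mu>\<nu>: "\<mu> \<in> \<Lambda>" "\<nu> \<in> \<Lambda>" and ij: "i < d \<mu>" "j < d \<mu>" "k < d \<nu>" "m < d \<nu>"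
  shows "(\<Sum>w\<in>carrier H. r \<mu> w i j * r \<nu> (inv w) k m) =
    (if \<mu> = \<nu> \<and> i = m \<and> j = k then to_fract (schur_elt \<mu>) else 0)"
proof -
  define S where "S = (\<lambda>i j k m. \<Sum>w\<in>carrier H. r \<mu> w i j * r \<mu> (inv w) k m)"
  have S1: "S i j k m = (if i = m then S 0 j k 0 else 0)" if "i < d \<mu>" "j < d \<mu>" "k < d \<mu>" "m < d \<mu>" for i j k m
    using intertwiner_scalar[OF \<mu>\<nu>(1) \<mu>\<nu>(1) that(2,3,1,4) irr.d_pos[OF \<mu>\<nu>(1)]] by (simp add: S_def)
  have S2: "S i j k m = S k m i j" for i j k m
    unfolding S_def by (rule sum.reindex_bij_witness[of _ "\<lambda>w. inv w" "\<lambda>w. inv w"]) auto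
  have S3: "S i j k m = (if i = m \<and> j = k then S 0 0 0 0 else 0)"
    if "i < d \<mu>" "j < d \<mu>" "k < d \<mu>" "m < d \<mu>" for i j k m
    using S1[OF that] S2[of 0 j k 0] S1[of k 0 0 j] irr.d_pos[OF \<mu>\<nu>(1)] that by auto
  have "of_nat (d \<mu>) * to_fract (schur_elt \<mu>) = (\<Sum>w\<in>carrier H. (\<Sum>i<d \<mu>. r \<mu> w i i) * (\<Sum>k<d \<mu>. r \<mu> (inv w) k k))"
    unfolding schur_elt(1)[OF \<mu>\<nu>(1), symmetric]
  proof (rule sum.cong)
    fix w assume w: "w \<in> carrier H"
    have "dim_row (\<rho> \<mu> w) = d \<mu>" "dim_row (\<rho> \<mu> (inv w)) = d \<mu>"
      using rho_carrier[OF \<mu>\<nu>(1)] w inv_closed by blast+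
    then show "mtrace (\<rho> \<mu> w) * mtrace (\<rho> \<mu> (inv w)) = (\<Sum>i<d \<mu>. r \<mu> w i i) * (\<Sum>k<d \<mu>. r \<mu> (inv w) k k)"
      by (simp add: mtrace_def r_def)
  qed simp
  also have "\<dots> = (\<Sum>i<d \<mu>. \<Sum>k<d \<mu>. S i i k k)"
    by (simp add: sum_product S_def sum.swap[of _ "carrier H"])
  also have "\<dots> = (\<Sum>i<d \<mu>. \<Sum>k<d \<mu>. if i = k then S 0 0 0 0 else 0)"
    by (intro sum.cong refl) (simp add: S3)
  also have "\<dots> = of_nat (d \<mu>) * S 0 0 0 0" by simp
  finally have "of_nat (d \<mu>) * (to_fract (schur_elt \<mu>) - S 0 0 0 0) = 0"
    by (simp add: right_diff_distrib)
  moreover have "(of_nat (d \<mu>) :: ('g \<Rightarrow>\<^sub>0 complex) fract) \<noteq> 0"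
    unfolding to_fract_of_nat[symmetric] to_fract_eq_0_iff using irr.d_pos[OF \<mu>\<nu>(1)] by simp
  ultimately have S0: "S 0 0 0 0 = to_fract (schur_elt \<mu>)" by simp
  show ?thesis
  proof (cases "\<mu> = \<nu>")
    case True
    then show ?thesis using S3[of i j k m] ij S0 by (simp add: S_def)
  next
    case False
    then show ?thesis
      using intertwiner_scalar[OF \<mu>\<nu> ij(2,3,1,4) irr.d_pos[OF \<mu>\<nu>(1)]] by simp
  qed
qed

theorem dual_Schur_relations:
  assumes xy: "x \<in> carrier H" "y \<in> carrier H"
  shows "(\<Sum>\<mu>\<in>\<Lambda>. \<Sum>i<d \<mu>. \<Sum>j<d \<mu>. inverse (to_fract (schur_elt \<mu>)) * r \<mu> x i j * r \<mu> (inv y) j i) =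
    (if x = y then 1 else 0)"
proof -
  define M where "M = (\<lambda>(\<mu>, i, j) y. inverse (to_fract (schur_elt \<mu>)) * r \<mu> (inv y) j i)"
  define N where "N = (\<lambda>x (\<mu>, i, j). r \<mu> x i j)"
  have MN: "(\<Sum>y\<in>carrier H. M t y * N y t') = (if t = t' then 1 else 0)" if tt': "t \<in> entries" "t' \<in> entries" for t t'
  proof -
    obtain \<mu> i j where t: "t = (\<mu>, i, j)" "\<mu> \<in> \<Lambda>" "i < d \<mu>" "j < d \<mu>" using tt'(1) by auto
    obtain \<nu> k m where t': "t' = (\<nu>, k, m)" "\<nu> \<in> \<Lambda>" "k < d \<nu>" "m < d \<nu>" using tt'(2) by auto
    have "(\<Sum>y\<in>carrier H. M t y * N y t') =
        inverse (to_fract (schur_elt \<mu>)) * (\<Sum>y\<in>carrier H. r \<nu> y k m * r \<mu> (inv y) j i)"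
      unfolding t t' M_def N_def by (simp add: sum_distrib_left mult_ac)
    then show ?thesis
      using Schur_relations[OF t'(2) t(2) t'(3,4) t(4,3)] schur_elt_neq_0[OF t(2)] t t' by auto
  qed
  have "(\<Sum>t\<in>entries. N x t * M t y) = (if x = y then 1 else 0)"
    by (rule left_inverse_imp_right_inverse[OF finite_entries finite_W irr.card_matrix_entries MN]) (use xy in auto)
  then show ?thesis
    using irr.finite_Lambda by (simp add: sum_matrix_entries M_def N_def mult_ac)
qed

definition cl :: "'l \<Rightarrow> 'w \<Rightarrow> nat \<Rightarrow> nat \<Rightarrow> complex" where
  "cl \<mu> w i j = c \<mu> w $$ (i, j)"

lemma c_carrier: "c \<mu> w \<in> carrier_mat (d \<mu>) (d \<mu>)"
  by (simp add: c_def leading_matrix_def)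

lemma residue_r:
  assumes "\<mu> \<in> \<Lambda>" "w \<in> carrier H" "i < d \<mu>" "j < d \<mu>"
  shows "residue_eq ((- 1) ^ l w * to_fract (eps (a \<mu>)) * r \<mu> w i j) (cl \<mu> w i j)"
proof -
  have "to_fract (eps (a \<mu>)) * r \<mu> w i j \<in> valuation_ring (coeffs H)"
    using bal[OF assms(1)] assms by (simp add: balanced_def r_def)
  then have "(- 1) ^ l w * (to_fract (eps (a \<mu>)) * r \<mu> w i j) \<in> valuation_ring (coeffs H)"
    using valuation_ring_uminus[OF subring_R] by (cases "even (l w)") auto
  then have "residue_eq ((- 1) ^ l w * to_fract (eps (a \<mu>)) * r \<mu> w i j)
      (constant_term (coeffs H) ((- 1) ^ l w * to_fract (eps (a \<mu>)) * r \<mu> w i j))"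
    by (intro constant_term_residue) (simp add: mult.assoc)
  moreover have "c \<mu> w $$ (i, j) = constant_term (coeffs H) ((- 1) ^ l w * to_fract (eps (a \<mu>)) * r \<mu> w i j)"
    unfolding c_def using assms by (simp add: leading_matrix_def r_def)
  ultimately show ?thesis
    by (simp add: cl_def)
qed

theorem leading_orthogonality:
  assumes \<mu>\<nu>: "\<mu> \<in> \<Lambda>" "\<nu> \<in> \<Lambda>" and ij: "i < d \<mu>" "j < d \<mu>" "k < d \<nu>" "m < d \<nu>"
  shows "(\<Sum>w\<in>carrier H. cl \<mu> w i j * cl \<nu> (inv w) k m) =
    (if \<mu> = \<nu> \<and> i = m \<and> j = k then complex_of_real (f \<mu>) else 0)"
proof -
  define b where "b = (\<lambda>\<mu> w i j. (- 1) ^ l w * to_fract (eps (a \<mu>)) * r \<mu> w i j)"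
  have res1: "residue_eq (\<Sum>w\<in>carrier H. b \<mu> w i j * b \<nu> (inv w) k m) (\<Sum>w\<in>carrier H. cl \<mu> w i j * cl \<nu> (inv w) k m)"
    unfolding b_def by (intro residue_eq_sum residue_eq_mult residue_r) (use assms in auto)
  have eqn: "(\<Sum>w\<in>carrier H. b \<mu> w i j * b \<nu> (inv w) k m) =
      to_fract (eps (a \<mu>)) * to_fract (eps (a \<nu>)) * (\<Sum>w\<in>carrier H. r \<mu> w i j * r \<nu> (inv w) k m)"
    unfolding sum_distrib_left
  proof (rule sum.cong)
    fix w assume w: "w \<in> carrier H"
    have "((- 1) ^ l w :: ('g \<Rightarrow>\<^sub>0 complex) fract) * (- 1) ^ l w = 1"
      by (simp add: power_mult_distrib[symmetric])
    then show "b \<mu> w i j * b \<nu> (inv w) k m =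
        to_fract (eps (a \<mu>)) * to_fract (eps (a \<nu>)) * (r \<mu> w i j * r \<nu> (inv w) k m)"
      using w by (simp add: b_def mult_ac)
  qed simp
  have res2: "residue_eq (to_fract (eps (a \<mu>)) * to_fract (eps (a \<nu>)) * (\<Sum>w\<in>carrier H. r \<mu> w i j * r \<nu> (inv w) k m))
      (if \<mu> = \<nu> \<and> i = m \<and> j = k then complex_of_real (f \<mu>) else 0)"
  proof (cases "\<mu> = \<nu> \<and> i = m \<and> j = k")
    case False
    then have "(\<Sum>w\<in>carrier H. r \<mu> w i j * r \<nu> (inv w) k m) = 0"
      by (subst Schur_relations[OF \<mu>\<nu> ij]) (use False in auto)
    then show ?thesis
      unfolding if_not_P[OF False] by (simp add: residue_eq_0)
  next
    case True
    obtain p where p: "\<forall>g\<in>Poly_Mapping.keys p. - (a \<mu> + a \<mu>) < g"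
      "schur_elt \<mu> = Poly_Mapping.single (- (a \<mu> + a \<mu>)) (complex_of_real (f \<mu>)) + p"
      using schur_elt(2)[OF \<mu>\<nu>(1)] by blast
    define q where "q = eps (a \<mu> + a \<mu>) * p"
    have q: "pos_supp q"
      unfolding pos_supp_def
    proof
      fix g assume "g \<in> Poly_Mapping.keys q"
      then obtain h where "h \<in> Poly_Mapping.keys p" "g = a \<mu> + a \<mu> + h"
        unfolding q_def using keys_mult[of "eps (a \<mu> + a \<mu>)" p] by (auto split: if_splits)
      moreover from this have "0 < h + (a \<mu> + a \<mu>)"
        using p(1) diff_less_eq[of 0 "a \<mu> + a \<mu>" h] by simp
      ultimately show "0 < g" by (simp only: add.commute)
    qed
    have eq: "eps (a \<mu>) * eps (a \<mu>) * schur_elt \<mu> = Poly_Mapping.single 0 (complex_of_real (f \<mu>)) + q"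
      unfolding p(2) q_def by (simp add: distrib_left mult_single)
    have "residue_eq (to_fract (eps (a \<mu>) * eps (a \<mu>) * schur_elt \<mu>))
        (poly_mapping.lookup (eps (a \<mu>) * eps (a \<mu>) * schur_elt \<mu>) 0)"
      by (rule residue_eq_to_fract)
        (unfold eq, intro nonneg_supp_add nonneg_supp_single pos_supp_imp_nonneg q, simp)
    moreover have "poly_mapping.lookup (eps (a \<mu>) * eps (a \<mu>) * schur_elt \<mu>) 0 = complex_of_real (f \<mu>)"
      unfolding eq using pos_supp_lookup_0[OF q] by (simp add: lookup_add)
    ultimately show ?thesis
      using True Schur_relations[OF \<mu>\<nu> ij] by (simp add: to_fract_mult)
  qed
  show ?thesis
    by (rule residue_eq_unique[OF res1]) (unfold eqn, rule res2)
qed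

theorem dual_leading_orthogonality:
  assumes xy: "x \<in> carrier H" "y \<in> carrier H"
  shows "(\<Sum>\<mu>\<in>\<Lambda>. \<Sum>i<d \<mu>. \<Sum>j<d \<mu>. inverse (complex_of_real (f \<mu>)) * cl \<mu> x i j * cl \<mu> (inv y) j i) =
    (if x = y then 1 else 0)"
proof -
  define M where "M = (\<lambda>(\<mu>, i, j) y. inverse (complex_of_real (f \<mu>)) * cl \<mu> (inv y) j i)"
  define N where "N = (\<lambda>x (\<mu>, i, j). cl \<mu> x i j)"
  have MN: "(\<Sum>y\<in>carrier H. M t y * N y t') = (if t = t' then 1 else 0)" if tt': "t \<in> entries" "t' \<in> entries" for t t'
  proof -
    obtain \<mu> i j where t: "t = (\<mu>, i, j)" "\<mu> \<in> \<Lambda>" "i < d \<mu>" "j < d \<mu>" using tt'(1) by auto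
    obtain \<nu> k m where t': "t' = (\<nu>, k, m)" "\<nu> \<in> \<Lambda>" "k < d \<nu>" "m < d \<nu>" using tt'(2) by auto
    have "(\<Sum>y\<in>carrier H. M t y * N y t') =
        inverse (complex_of_real (f \<mu>)) * (\<Sum>y\<in>carrier H. cl \<nu> y k m * cl \<mu> (inv y) j i)"
      unfolding t t' M_def N_def by (simp add: sum_distrib_left mult_ac)
    then show ?thesis
      using leading_orthogonality[OF t'(2) t(2) t'(3,4) t(4,3)] f_pos[OF t(2)] t t' by auto
  qed
  have "(\<Sum>t\<in>entries. N x t * M t y) = (if x = y then 1 else 0)"
    by (rule left_inverse_imp_right_inverse[OF finite_entries finite_W irr.card_matrix_entries MN]) (use xy in auto)
  then show ?thesis
    using irr.finite_Lambda by (simp add: sum_matrix_entries M_def N_def mult_ac)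
qed

end

section \<open>Leading coefficients and two-sided cells\<close>

abbreviation (input) const :: "'a::zero \<Rightarrow> 'g::zero \<Rightarrow>\<^sub>0 'a" where "const \<equiv> Poly_Mapping.single 0"

lemma residue_eq_0_imp: "residue_eq (0 :: ('g::linordered_ab_group_add \<Rightarrow>\<^sub>0 complex) fract) s \<Longrightarrow> s = 0"
  using residue_eq_unique residue_eq_0 by blast

lemma sum_if_const: "(\<Sum>x\<in>A. if P then g x else 0) = (if P then sum g A else 0)"
  by simp

lemma const_mult: "const (x * y) = const x * const y" for x y :: "'a::semiring_0"
  by (simp add: mult_single)

lemma const_sum: "const (sum f I) = (\<Sum>i\<in>I. const (f i))"
  by (induction I rule: infinite_finite_induct) (simp_all add: single_add)

lemma is_subring_hull: "is_subring (is_subring hull X)"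
  unfolding hull_def is_subring_def by auto

lemma det_closed:
  fixes R :: "'a::comm_ring_1 set"
  assumes R: "is_subring R" and A: "A \<in> carrier_mat n n" "\<And>i j. i < n \<Longrightarrow> j < n \<Longrightarrow> A $$ (i, j) \<in> R"
  shows "det A \<in> R"
proof -
  note cl = is_subring_closed[OF R]
  have "signof p * (\<Prod>i = 0..<n. A $$ (i, p i)) \<in> R" if p: "p permutes {0..<n}" for p
  proof -
    have "p i < n" if "i \<in> {0..<n}" for i
      using permutes_in_image[OF p, of i] that by simp
    then have "(\<Prod>i = 0..<n. A $$ (i, p i)) \<in> R"
      using A(2) by (intro cl) auto
    moreover have "signof p \<in> R"
      using cl(2) cl(3)[OF cl(2)] by (simp add: sign_def)
    ultimately show ?thesis by (rule cl(5)[rotated])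
  qed
  then show ?thesis
    unfolding det_def'[OF A(1)] by (intro cl(7)) auto
qed

context hecke
begin

lemma kl_mult:
  assumes h: "h \<in> HH" and m: "m \<in> HH"
  shows "kl (h \<star> m) y = (\<Sum>u\<in>carrier H. \<Sum>z\<in>carrier H. kl h u * kl m z * hcoef H u z y)"
proof -
  have "h \<star> m = (\<Sum>u\<in>carrier H. smul (kl h u) (KL u)) \<star> (\<Sum>z\<in>carrier H. smul (kl m z) (KL z))"
    using kl_expand[OF h] kl_expand[OF m] by simp
  also have "\<dots> = (\<Sum>z\<in>carrier H. \<Sum>u\<in>carrier H. smul (kl h u * kl m z) (KL u \<star> KL z))"
    using kl_A[OF h] kl_A[OF m]
    by (simp add: mult_sum_left mult_sum_right HH_smul HH_sum HH_KL mult_smul_left mult_smul_right HH_mult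
        smul_sum mult.commute)
  also have "\<dots> = (\<Sum>u\<in>carrier H. \<Sum>z\<in>carrier H. smul (kl h u * kl m z) (KL u \<star> KL z))"
    by (rule sum.swap)
  finally have "kl_coords H (h \<star> m) =
      (\<Sum>u\<in>carrier H. \<Sum>z\<in>carrier H. smul (kl h u * kl m z) (kl_coords H (KL u \<star> KL z)))"
    using kl_A[OF h] kl_A[OF m]
    by (simp add: kl_coords_sum kl_coords_smul HH_smul HH_sum HH_KL HH_mult A_closed(5))
  then show ?thesis
    by (simp add: lookup_sum hcoef_def)
qed

definition below_span :: "'w \<Rightarrow> ('w, 'g) hecke_elt set" where
  "below_span x = {m \<in> HH. \<forall>y\<in>carrier H. kl m y \<noteq> 0 \<longrightarrow> lr_le H y x}"

lemma below_span_mult: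
  assumes m: "m \<in> below_span x" and h: "h \<in> HH"
  shows "h \<star> m \<in> below_span x" "m \<star> h \<in> below_span x"
proof -
  have m': "m \<in> HH" "\<And>y. y \<in> carrier H \<Longrightarrow> kl m y \<noteq> 0 \<Longrightarrow> lr_le H y x"
    using m by (auto simp: below_span_def)
  show "h \<star> m \<in> below_span x"
    unfolding below_span_def
  proof (intro CollectI conjI ballI impI HH_mult h m'(1))
    fix y assume y: "y \<in> carrier H" "kl (h \<star> m) y \<noteq> 0"
    then obtain u z where uz: "u \<in> carrier H" "z \<in> carrier H" "kl h u * kl m z * hcoef H u z y \<noteq> 0"
      unfolding kl_mult[OF h m'(1)] by (meson sum.neutral)
    then have "lr_le H y z" "lr_le H z x"
      using lr_le_hcoef(1)[of u z y] m'(2) y by auto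
    then show "lr_le H y x" by (rule lr_le_trans)
  qed
  show "m \<star> h \<in> below_span x"
    unfolding below_span_def
  proof (intro CollectI conjI ballI impI HH_mult h m'(1))
    fix y assume y: "y \<in> carrier H" "kl (m \<star> h) y \<noteq> 0"
    then obtain u z where uz: "u \<in> carrier H" "z \<in> carrier H" "kl m u * kl h z * hcoef H u z y \<noteq> 0"
      unfolding kl_mult[OF m'(1) h] by (meson sum.neutral)
    then have "lr_le H y u" "lr_le H u x"
      using lr_le_hcoef(2)[of z u y] m'(2) y by auto
    then show "lr_le H y x" by (rule lr_le_trans)
  qed
qed

lemma KL_below_span: "x \<in> carrier H \<Longrightarrow> KL x \<in> below_span x"
  unfolding below_span_def by (auto simp: HH_KL kl_coords_KL lookup_single when_def lr_le_refl)

end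

context leading_coefficients
begin

lemma residue_combination:
  assumes \<mu>: "\<mu> \<in> \<Lambda>" "i < d \<mu>" "j < d \<mu>" and x: "x \<in> carrier H"
    and p: "\<And>w. w \<in> carrier H \<Longrightarrow> pos_supp (p w - (if w = x then (- 1) ^ l w else 0))"
  shows "residue_eq (to_fract (eps (a \<mu>)) * (\<Sum>w\<in>carrier H. to_fract (p w) * r \<mu> w i j)) (cl \<mu> x i j)"
proof -
  have sq: "((- 1) ^ n :: 'b::comm_ring_1) * (- 1) ^ n = 1" for n
    by (simp add: power_mult_distrib[symmetric])
  have tfs: "to_fract ((- 1) ^ n :: 'g \<Rightarrow>\<^sub>0 complex) = (- 1) ^ n" for n
    by (induction n) (simp_all add: to_fract_uminus)
  have res: "residue_eq (to_fract ((- 1) ^ l w * p w)) (if w = x then 1 else 0)" if w: "w \<in> carrier H" for w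
  proof -
    define q where "q = (- 1) ^ l w * (p w - (if w = x then (- 1) ^ l w else 0))"
    have q: "pos_supp q"
      using p[OF w] pos_supp_uminus[OF p[OF w]] unfolding q_def by (cases "even (l w)") auto
    have eq: "(- 1) ^ l w * p w = const (if w = x then 1 else 0) + q"
      unfolding q_def by (simp add: right_diff_distrib sq)
    show ?thesis
      using residue_eq_to_fract[of "(- 1) ^ l w * p w"] pos_supp_lookup_0[OF q] unfolding eq
      by (simp add: lookup_add nonneg_supp_add nonneg_supp_single pos_supp_imp_nonneg q split: if_splits)
  qed
  have "residue_eq (\<Sum>w\<in>carrier H. to_fract ((- 1) ^ l w * p w) * ((- 1) ^ l w * to_fract (eps (a \<mu>)) * r \<mu> w i j))
      (\<Sum>w\<in>carrier H. (if w = x then 1 else 0) * cl \<mu> w i j)"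
    by (intro residue_eq_sum residue_eq_mult res residue_r) (use \<mu> in auto)
  moreover have "(\<Sum>w\<in>carrier H. (if w = x then 1 else 0) * cl \<mu> w i j) = cl \<mu> x i j"
    using x finite_W by (simp add: sum_delta_mult)
  moreover have "(\<Sum>w\<in>carrier H. to_fract ((- 1) ^ l w * p w) * ((- 1) ^ l w * to_fract (eps (a \<mu>)) * r \<mu> w i j)) =
      to_fract (eps (a \<mu>)) * (\<Sum>w\<in>carrier H. to_fract (p w) * r \<mu> w i j)"
    unfolding sum_distrib_left
  proof (rule sum.cong)
    fix w
    have "to_fract ((- 1) ^ l w * p w) * ((- 1) ^ l w * to_fract (eps (a \<mu>)) * r \<mu> w i j) =
        ((- 1) ^ l w * (- 1) ^ l w) * (to_fract (eps (a \<mu>)) * (to_fract (p w) * r \<mu> w i j))"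
      by (simp only: to_fract_mult tfs mult_ac)
    then show "to_fract ((- 1) ^ l w * p w) * ((- 1) ^ l w * to_fract (eps (a \<mu>)) * r \<mu> w i j) =
        to_fract (eps (a \<mu>)) * (to_fract (p w) * r \<mu> w i j)"
      unfolding sq by simp
  qed simp
  ultimately show ?thesis by simp
qed

lemma kl_dual:
  assumes h: "h \<in> HH" and w: "w \<in> carrier H"
  shows "to_fract (kl h w) = (\<Sum>\<mu>\<in>\<Lambda>. \<Sum>i<d \<mu>. \<Sum>j<d \<mu>. inverse (to_fract (schur_elt \<mu>)) * R \<mu> h i j *
    (\<Sum>z\<in>carrier H. to_fract (kl (T z) w) * r \<mu> (inv z) j i))"
proof -
  have "to_fract (coef h z) = (\<Sum>\<mu>\<in>\<Lambda>. \<Sum>i<d \<mu>. \<Sum>j<d \<mu>. inverse (to_fract (schur_elt \<mu>)) * R \<mu> h i j * r \<mu> (inv z) j i)"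
    if z: "z \<in> carrier H" for z
  proof -
    have "to_fract (coef h z) = (\<Sum>x\<in>carrier H. to_fract (coef h x) * (if x = z then 1 else 0))"
      using z finite_W by (simp add: sum_delta_mult)
    also have "\<dots> = (\<Sum>x\<in>carrier H. \<Sum>\<mu>\<in>\<Lambda>. \<Sum>i<d \<mu>. \<Sum>j<d \<mu>.
        inverse (to_fract (schur_elt \<mu>)) * (to_fract (coef h x) * r \<mu> x i j) * r \<mu> (inv z) j i)"
      by (rule sum.cong) (use z in \<open>auto simp: dual_Schur_relations[symmetric] sum_distrib_left mult_ac\<close>)
    also have "\<dots> = (\<Sum>\<mu>\<in>\<Lambda>. \<Sum>i<d \<mu>. \<Sum>j<d \<mu>. inverse (to_fract (schur_elt \<mu>)) * R \<mu> h i j * r \<mu> (inv z) j i)"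
      by (simp add: sum.swap[of _ "carrier H"] R_def sum_distrib_left sum_distrib_right)
    finally show ?thesis .
  qed
  then have "to_fract (kl h w) = (\<Sum>z\<in>carrier H. \<Sum>\<mu>\<in>\<Lambda>. \<Sum>i<d \<mu>. \<Sum>j<d \<mu>.
      inverse (to_fract (schur_elt \<mu>)) * R \<mu> h i j * (to_fract (kl (T z) w) * r \<mu> (inv z) j i))"
    unfolding kl_eq_sum[OF h] to_fract_sum to_fract_mult
    by (intro sum.cong refl) (simp add: sum_distrib_left sum_distrib_right mult_ac)
  then show ?thesis
    by (simp add: sum.swap[of _ "carrier H"] sum_distrib_left)
qed

text \<open>If \<open>w\<close> does not lie below \<open>x\<close>, the coefficient of \<open>KL w\<close> vanishes on the two-sided ideal
  generated by \<open>KL x\<close>. Since \<open>R \<mu>\<close> maps onto the full matrix algebra, this forces one of the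
  matrices \<open>R \<mu> (KL x)\<close> and \<open>\<Sum>z. kl (T z) w * \<rho> \<mu> (inv z)\<close> to be zero; their leading
  coefficients are those of \<open>x\<close> and of the inverse of \<open>w\<close>.\<close>

lemma leading_coefficients_lr_le:
  assumes \<mu>: "\<mu> \<in> \<Lambda>" and x: "x \<in> carrier H" and w: "w \<in> carrier H"
    and pq: "p < d \<mu>" "q < d \<mu>" "cl \<mu> x p q \<noteq> 0"
    and ij: "i < d \<mu>" "j < d \<mu>" "cl \<mu> (inv w) j i \<noteq> 0"
  shows "lr_le H w x"
proof (rule ccontr)
  assume nle: "\<not> lr_le H w x"
  define X where "X = R \<mu> (KL x)"
  define N where "N = (\<lambda>\<nu> j i. \<Sum>z\<in>carrier H. to_fract (kl (T z) w) * r \<nu> (inv z) j i)"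
  have "residue_eq (to_fract (eps (a \<mu>)) * X p q) (cl \<mu> x p q)"
    unfolding X_def R_def
  proof (rule residue_combination[OF \<mu> pq(1,2) x])
    fix w assume "w \<in> carrier H"
    then show "pos_supp (coef (KL x) w - (if w = x then (- 1) ^ l w else 0))"
      using coef_KL_pos[OF x] coef_KL_self[OF x] by auto
  qed
  then have X0: "X p q \<noteq> 0"
    using pq(3) residue_eq_0_imp by fastforce
  have "residue_eq (to_fract (eps (a \<mu>)) * (\<Sum>z\<in>carrier H. to_fract (kl (T (inv z)) w) * r \<mu> z j i)) (cl \<mu> (inv w) j i)"
  proof (rule residue_combination[OF \<mu> ij(2,1)])
    fix z assume z: "z \<in> carrier H"
    have iff: "w = inv z \<longleftrightarrow> z = inv w" using z w by auto
    have "pos_supp (kl (T (inv z)) w - (if w = inv z then (- 1) ^ l (inv z) else 0))"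
      using kl_T_pos[of "inv z" w] z w by blast
    then show "pos_supp (kl (T (inv z)) w - (if z = inv w then (- 1) ^ l z else 0))"
      unfolding iff length_inv[OF z] .
  qed (use w in simp)
  moreover have "(\<Sum>z\<in>carrier H. to_fract (kl (T (inv z)) w) * r \<mu> z j i) = N \<mu> j i"
    unfolding N_def by (rule sum.reindex_bij_witness[of _ "\<lambda>z. inv z" "\<lambda>z. inv z"]) auto
  ultimately have N0: "N \<mu> j i \<noteq> 0"
    using ij(3) residue_eq_0_imp by fastforce
  obtain n1 where n1: "\<And>\<nu> k m. \<nu> \<in> \<Lambda> \<Longrightarrow> k < d \<nu> \<Longrightarrow> m < d \<nu> \<Longrightarrow>
      (\<Sum>u\<in>carrier H. n1 u * r \<nu> u k m) = (if \<mu> = \<nu> \<and> i = k \<and> p = m then 1 else 0)"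
    using matrix_units[of \<mu> i p] \<mu> ij pq by auto
  obtain n2 where n2: "\<And>\<nu> k m. \<nu> \<in> \<Lambda> \<Longrightarrow> k < d \<nu> \<Longrightarrow> m < d \<nu> \<Longrightarrow>
      (\<Sum>u\<in>carrier H. n2 u * r \<nu> u k m) = (if \<mu> = \<nu> \<and> q = k \<and> j = m then 1 else 0)"
    using matrix_units[of \<mu> q j] \<mu> ij pq by auto
  define cc where "cc = (\<lambda>\<nu>. inverse (to_fract (schur_elt \<nu>)))"
  have zero: "(\<Sum>\<nu>\<in>\<Lambda>. \<Sum>i<d \<nu>. \<Sum>j<d \<nu>. \<Sum>q<d \<nu>. \<Sum>p<d \<nu>.
      cc \<nu> * N \<nu> j i * R \<nu> (KL x) p q * r \<nu> u i p * r \<nu> v q j) = 0"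
    if u: "u \<in> carrier H" and v: "v \<in> carrier H" for u v
  proof -
    define h where "h = T u \<star> KL x \<star> T v"
    have "h \<in> below_span x"
      unfolding h_def using u v x by (intro below_span_mult KL_below_span HH_T)
    then have "h \<in> HH" "kl h w = 0"
      using nle w by (auto simp: below_span_def)
    then have "0 = (\<Sum>\<nu>\<in>\<Lambda>. \<Sum>i<d \<nu>. \<Sum>j<d \<nu>. cc \<nu> * R \<nu> h i j * N \<nu> j i)"
      using kl_dual[of h w] w by (simp add: N_def cc_def)
    also have "\<dots> = (\<Sum>\<nu>\<in>\<Lambda>. \<Sum>i<d \<nu>. \<Sum>j<d \<nu>. \<Sum>q<d \<nu>. \<Sum>p<d \<nu>.
        cc \<nu> * N \<nu> j i * R \<nu> (KL x) p q * r \<nu> u i p * r \<nu> v q j)"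
    proof (intro sum.cong refl)
      fix \<nu> i j assume \<nu>: "\<nu> \<in> \<Lambda>" "i \<in> {..<d \<nu>}" "j \<in> {..<d \<nu>}"
      then have "R \<nu> h i j = (\<Sum>q<d \<nu>. (\<Sum>p<d \<nu>. r \<nu> u i p * R \<nu> (KL x) p q) * r \<nu> v q j)"
        unfolding h_def using u v x by (simp add: R_mult R_T HH_mult HH_KL)
      then show "cc \<nu> * R \<nu> h i j * N \<nu> j i = (\<Sum>q<d \<nu>. \<Sum>p<d \<nu>.
          cc \<nu> * N \<nu> j i * R \<nu> (KL x) p q * r \<nu> u i p * r \<nu> v q j)"
        by (simp add: sum_distrib_left sum_distrib_right mult_ac)
    qed
    finally show ?thesis by simp
  qed
  have zero1: "(\<Sum>\<nu>\<in>\<Lambda>. \<Sum>i<d \<nu>. \<Sum>j<d \<nu>. \<Sum>q<d \<nu>. \<Sum>p<d \<nu>.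
      cc \<nu> * N \<nu> j i * R \<nu> (KL x) p q * (\<Sum>u\<in>carrier H. n1 u * r \<nu> u i p) * r \<nu> v q j) = 0"
    if v: "v \<in> carrier H" for v
  proof -
    have "0 = (\<Sum>u\<in>carrier H. n1 u * (\<Sum>\<nu>\<in>\<Lambda>. \<Sum>i<d \<nu>. \<Sum>j<d \<nu>. \<Sum>q<d \<nu>. \<Sum>p<d \<nu>.
        cc \<nu> * N \<nu> j i * R \<nu> (KL x) p q * r \<nu> u i p * r \<nu> v q j))"
      using zero v by simp
    also have "\<dots> = (\<Sum>u\<in>carrier H. \<Sum>\<nu>\<in>\<Lambda>. \<Sum>i<d \<nu>. \<Sum>j<d \<nu>. \<Sum>q<d \<nu>. \<Sum>p<d \<nu>.
        cc \<nu> * N \<nu> j i * R \<nu> (KL x) p q * (n1 u * r \<nu> u i p) * r \<nu> v q j)"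
      unfolding sum_distrib_left by (intro sum.cong refl) (simp only: mult_ac)
    also have "\<dots> = (\<Sum>\<nu>\<in>\<Lambda>. \<Sum>i<d \<nu>. \<Sum>j<d \<nu>. \<Sum>q<d \<nu>. \<Sum>p<d \<nu>.
        cc \<nu> * N \<nu> j i * R \<nu> (KL x) p q * (\<Sum>u\<in>carrier H. n1 u * r \<nu> u i p) * r \<nu> v q j)"
      by (simp only: sum.swap[of _ "carrier H"] sum_distrib_left sum_distrib_right)
    finally show ?thesis by simp
  qed
  have "0 = (\<Sum>v\<in>carrier H. n2 v * (\<Sum>\<nu>\<in>\<Lambda>. \<Sum>i<d \<nu>. \<Sum>j<d \<nu>. \<Sum>q<d \<nu>. \<Sum>p<d \<nu>.
      cc \<nu> * N \<nu> j i * R \<nu> (KL x) p q * (\<Sum>u\<in>carrier H. n1 u * r \<nu> u i p) * r \<nu> v q j))"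
    using zero1 by simp
  also have "\<dots> = (\<Sum>v\<in>carrier H. n2 v * (\<Sum>\<nu>\<in>\<Lambda>. \<Sum>i'<d \<nu>. \<Sum>j<d \<nu>. \<Sum>q<d \<nu>. \<Sum>p'<d \<nu>.
      cc \<nu> * N \<nu> j i' * R \<nu> (KL x) p' q * (if \<mu> = \<nu> \<and> i = i' \<and> p = p' then 1 else 0) * r \<nu> v q j))"
    by (intro sum.cong refl arg_cong2[where f = "(*)"]) (simp add: n1)
  also have "\<dots> = (\<Sum>v\<in>carrier H. \<Sum>\<nu>\<in>\<Lambda>. \<Sum>i'<d \<nu>. \<Sum>j<d \<nu>. \<Sum>q<d \<nu>. \<Sum>p'<d \<nu>.
      cc \<nu> * N \<nu> j i' * R \<nu> (KL x) p' q * ((if \<mu> = \<nu> \<and> i = i' \<and> p = p' then 1 else 0) * (n2 v * r \<nu> v q j)))"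
    unfolding sum_distrib_left by (intro sum.cong refl) (simp only: mult_ac)
  also have "\<dots> = (\<Sum>\<nu>\<in>\<Lambda>. \<Sum>i'<d \<nu>. \<Sum>j<d \<nu>. \<Sum>q<d \<nu>. \<Sum>p'<d \<nu>.
      cc \<nu> * N \<nu> j i' * R \<nu> (KL x) p' q * ((if \<mu> = \<nu> \<and> i = i' \<and> p = p' then 1 else 0) *
        (\<Sum>v\<in>carrier H. n2 v * r \<nu> v q j)))"
    by (simp only: sum.swap[of _ "carrier H"] sum_distrib_left)
  also have "\<dots> = (\<Sum>\<nu>\<in>\<Lambda>. \<Sum>i'<d \<nu>. \<Sum>j'<d \<nu>. \<Sum>q'<d \<nu>. \<Sum>p'<d \<nu>.
      cc \<nu> * N \<nu> j' i' * R \<nu> (KL x) p' q' *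
        ((if \<mu> = \<nu> \<and> i = i' \<and> p = p' then 1 else 0) * (if \<mu> = \<nu> \<and> q = q' \<and> j = j' then 1 else 0)))"
    by (intro sum.cong refl) (simp add: n2)
  also have "\<dots> = (\<Sum>\<nu>\<in>\<Lambda>. if \<nu> = \<mu> then cc \<mu> * N \<mu> j i * X p q else 0)"
  proof (intro sum.cong refl)
    fix \<nu>
    show "(\<Sum>i'<d \<nu>. \<Sum>j'<d \<nu>. \<Sum>q'<d \<nu>. \<Sum>p'<d \<nu>. cc \<nu> * N \<nu> j' i' * R \<nu> (KL x) p' q' *
        ((if \<mu> = \<nu> \<and> i = i' \<and> p = p' then 1 else 0) * (if \<mu> = \<nu> \<and> q = q' \<and> j = j' then 1 else 0))) =
        (if \<nu> = \<mu> then cc \<mu> * N \<mu> j i * X p q else 0)"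
    proof (cases "\<nu> = \<mu>")
      case True
      have "(\<Sum>i'<d \<mu>. \<Sum>j'<d \<mu>. \<Sum>q'<d \<mu>. \<Sum>p'<d \<mu>. cc \<mu> * N \<mu> j' i' * R \<mu> (KL x) p' q' *
        ((if i = i' \<and> p = p' then 1 else 0) * (if q = q' \<and> j = j' then 1 else 0))) =
        (\<Sum>i'<d \<mu>. \<Sum>j'<d \<mu>. \<Sum>q'<d \<mu>. \<Sum>p'<d \<mu>. if i' = i then (if j' = j then (if q' = q then
          (if p' = p then cc \<mu> * N \<mu> j' i' * R \<mu> (KL x) p' q' else 0) else 0) else 0) else 0)"
        by (intro sum.cong refl) auto
      also have "\<dots> = cc \<mu> * N \<mu> j i * X p q"
        using ij pq by (simp add: sum_if_const X_def)
      finally show ?thesis using True by simp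
    next
      case False
      then show ?thesis by (auto intro!: sum.neutral)
    qed
  qed
  also have "\<dots> = cc \<mu> * N \<mu> j i * X p q"
    using \<mu> irr.finite_Lambda by simp
  finally show False
    using X0 N0 schur_elt_neq_0[OF \<mu>] by (simp add: cc_def)
qed

end

section \<open>The cellular basis\<close>

locale cellular_setup = leading_coefficients H \<Lambda> d E \<rho> a f c
  for H :: "('w, 'g::linordered_ab_group_add) hecke_data" (structure)
    and \<Lambda> :: "'l set" and d E \<rho> a f c +
  fixes B :: "'l \<Rightarrow> complex mat"
  assumes good: "L_good H \<Lambda> f"
    and P15: "P15_tilde H (gamma_tilde \<Lambda> d f c)"
    and c_ZW: "\<And>\<mu> w. \<mu> \<in> \<Lambda> \<Longrightarrow> w \<in> carrier H \<Longrightarrow> c \<mu> w \<in> mats_over (ZWof H) (d \<mu>)"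
    and B_ZW: "\<And>\<mu>. \<mu> \<in> \<Lambda> \<Longrightarrow> B \<mu> \<in> mats_over (ZWof H) (d \<mu>)"
    and B_pos: "\<And>\<mu>. \<mu> \<in> \<Lambda> \<Longrightarrow> sym_pos_def (d \<mu>) (B \<mu>)"
    and B_inv: "\<And>\<mu> w. \<mu> \<in> \<Lambda> \<Longrightarrow> w \<in> carrier H \<Longrightarrow>
                  B \<mu> * c \<mu> (inv\<^bsub>H\<^esub> w) = transpose_mat (c \<mu> w) * B \<mu>"
    and B_det: "\<And>\<mu>. \<mu> \<in> \<Lambda> \<Longrightarrow> \<exists>r\<in>coeffs H. det (B \<mu>) * r = 1"
begin

abbreviation R0 :: "complex set" where "R0 \<equiv> coeffs H"

lemmas R0_closed = is_subring_closed[OF subring_R]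

lemma ZW_subring: "is_subring (ZWof H)"
  unfolding ZW_def by (rule is_subring_hull)

lemmas ZW_closed = is_subring_closed[OF ZW_subring]

lemma ZW_subset: "x \<in> ZWof H \<Longrightarrow> x \<in> R0"
  using good by (auto simp: L_good_def)

lemma inverse_f_R0: "\<mu> \<in> \<Lambda> \<Longrightarrow> inverse (complex_of_real (f \<mu>)) \<in> R0"
  using good by (simp add: L_good_def)

lemma f_neq_0: "\<mu> \<in> \<Lambda> \<Longrightarrow> complex_of_real (f \<mu>) \<noteq> 0"
  using f_pos[of \<mu>] by simp

definition \<beta> :: "'l \<Rightarrow> nat \<Rightarrow> nat \<Rightarrow> complex" where "\<beta> \<mu> i j = B \<mu> $$ (i, j)"

lemma B_carrier: "\<mu> \<in> \<Lambda> \<Longrightarrow> B \<mu> \<in> carrier_mat (d \<mu>) (d \<mu>)"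
  using B_ZW mats_overD(1) by blast

lemma beta_ZW: "\<mu> \<in> \<Lambda> \<Longrightarrow> i < d \<mu> \<Longrightarrow> j < d \<mu> \<Longrightarrow> \<beta> \<mu> i j \<in> ZWof H"
  unfolding \<beta>_def using B_ZW mats_overD(2) by blast

lemma cl_ZW: "\<mu> \<in> \<Lambda> \<Longrightarrow> w \<in> carrier H \<Longrightarrow> i < d \<mu> \<Longrightarrow> j < d \<mu> \<Longrightarrow> cl \<mu> w i j \<in> ZWof H"
  unfolding cl_def using c_ZW mats_overD(2) by blast

lemma beta_sym:
  assumes "\<mu> \<in> \<Lambda>" "i < d \<mu>" "j < d \<mu>"
  shows "\<beta> \<mu> i j = \<beta> \<mu> j i"
proof -
  have "transpose_mat (B \<mu>) = B \<mu>" using B_pos[OF assms(1)] by (simp add: sym_pos_def_def)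
  then have "B \<mu> $$ (i, j) = transpose_mat (B \<mu>) $$ (i, j)" by simp
  then show ?thesis using B_carrier[OF assms(1)] assms by (simp add: \<beta>_def)
qed

lemma beta_cl:
  assumes "\<mu> \<in> \<Lambda>" "w \<in> carrier H" "t < d \<mu>" "s < d \<mu>"
  shows "(\<Sum>u<d \<mu>. \<beta> \<mu> t u * cl \<mu> (inv w) u s) = (\<Sum>u<d \<mu>. cl \<mu> w u t * \<beta> \<mu> u s)"
proof -
  have "(B \<mu> * c \<mu> (inv w)) $$ (t, s) = (transpose_mat (c \<mu> w) * B \<mu>) $$ (t, s)"
    using B_inv[OF assms(1,2)] by simp
  then show ?thesis
    using B_carrier[OF assms(1)] c_carrier[of \<mu> w] c_carrier[of \<mu> "inv w"] assms
    by (simp add: scalar_prod_def atLeast0LessThan \<beta>_def cl_def)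
qed

lemma beta_inverse:
  assumes \<mu>: "\<mu> \<in> \<Lambda>"
  shows "\<exists>g. (\<forall>i<d \<mu>. \<forall>j<d \<mu>. g i j \<in> R0) \<and>
    (\<forall>i<d \<mu>. \<forall>j<d \<mu>. (\<Sum>k<d \<mu>. g i k * \<beta> \<mu> k j) = (if i = j then 1 else 0))"
proof -
  obtain b where b: "b \<in> R0" "det (B \<mu>) * b = 1" using B_det[OF \<mu>] by blast
  define N where "N = b \<cdot>\<^sub>m adj_mat (B \<mu>)"
  note Bc = B_carrier[OF \<mu>]
  have adj: "adj_mat (B \<mu>) \<in> carrier_mat (d \<mu>) (d \<mu>)" "adj_mat (B \<mu>) * B \<mu> = det (B \<mu>) \<cdot>\<^sub>m 1\<^sub>m (d \<mu>)"
    using adj_mat[OF Bc] by auto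
  have "N * B \<mu> = b \<cdot>\<^sub>m (adj_mat (B \<mu>) * B \<mu>)"
    unfolding N_def using adj(1) Bc by (rule mult_smult_assoc_mat)
  also have "\<dots> = 1\<^sub>m (d \<mu>)"
    unfolding adj(2) by (rule eq_matI) (use b(2) in \<open>auto simp: mult.commute\<close>)
  finally have NB: "N * B \<mu> = 1\<^sub>m (d \<mu>)" .
  have Nc: "N \<in> carrier_mat (d \<mu>) (d \<mu>)" using adj by (simp add: N_def)
  have "N $$ (i, j) \<in> R0" if ij: "i < d \<mu>" "j < d \<mu>" for i j
  proof -
    define M where "M = mat_delete (B \<mu>) j i"
    have Mc: "M \<in> carrier_mat (d \<mu> - 1) (d \<mu> - 1)"
      unfolding M_def using mat_delete_carrier[OF Bc] .
    have "M $$ (k, m) \<in> R0" if "k < d \<mu> - 1" "m < d \<mu> - 1" for k m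
    proof -
      have "M $$ (k, m) = \<beta> \<mu> (if k < j then k else Suc k) (if m < i then m else Suc m)"
        unfolding M_def mat_delete_def \<beta>_def using that Bc by simp
      also have "\<dots> \<in> ZWof H" using that by (intro beta_ZW[OF \<mu>]) auto
      finally show ?thesis by (rule ZW_subset)
    qed
    then have "det M \<in> R0" by (rule det_closed[OF subring_R Mc])
    moreover have "(- 1) ^ n \<in> R0" for n
      by (induction n) (auto intro!: R0_closed)
    ultimately have "cofactor (B \<mu>) j i \<in> R0"
      unfolding cofactor_def M_def[symmetric] by (intro R0_closed)
    then show ?thesis
      unfolding N_def adj_mat_def using ij Bc b(1) by (auto intro: R0_closed)
  qed
  moreover have "(\<Sum>k<d \<mu>. N $$ (i, k) * \<beta> \<mu> k j) = (if i = j then 1 else 0)" if ij: "i < d \<mu>" "j < d \<mu>" for i j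
  proof -
    have "(N * B \<mu>) $$ (i, j) = (\<Sum>k<d \<mu>. N $$ (i, k) * \<beta> \<mu> k j)"
      using ij Nc Bc by (simp add: scalar_prod_def atLeast0LessThan \<beta>_def)
    then show ?thesis using NB ij by simp
  qed
  ultimately show ?thesis by (intro exI[of _ "\<lambda>i j. N $$ (i, j)"]) blast
qed

definition \<beta>inv :: "'l \<Rightarrow> nat \<Rightarrow> nat \<Rightarrow> complex" where
  "\<beta>inv \<mu> = (SOME g. (\<forall>i<d \<mu>. \<forall>j<d \<mu>. g i j \<in> R0) \<and>
    (\<forall>i<d \<mu>. \<forall>j<d \<mu>. (\<Sum>k<d \<mu>. g i k * \<beta> \<mu> k j) = (if i = j then 1 else 0)))"

lemma betainv:
  assumes "\<mu> \<in> \<Lambda>" "i < d \<mu>" "j < d \<mu>"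
  shows "\<beta>inv \<mu> i j \<in> R0" "(\<Sum>k<d \<mu>. \<beta>inv \<mu> i k * \<beta> \<mu> k j) = (if i = j then 1 else 0)"
  using someI_ex[OF beta_inverse[OF assms(1)]] assms(2,3) unfolding \<beta>inv_def by blast+

lemma c_neq_0_iff: "c \<mu> w \<noteq> 0\<^sub>m (d \<mu>) (d \<mu>) \<longleftrightarrow> (\<exists>i<d \<mu>. \<exists>j<d \<mu>. cl \<mu> w i j \<noteq> 0)"
proof -
  have "c \<mu> w = 0\<^sub>m (d \<mu>) (d \<mu>)" if "\<forall>i<d \<mu>. \<forall>j<d \<mu>. cl \<mu> w i j = 0"
    using that c_carrier[of \<mu> w] by (intro eq_matI) (auto simp: cl_def)
  moreover have "cl \<mu> w i j = 0" if "c \<mu> w = 0\<^sub>m (d \<mu>) (d \<mu>)" "i < d \<mu>" "j < d \<mu>" for i j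
    unfolding cl_def that(1) using that by simp
  ultimately show ?thesis by blast
qed

lemma cl_inv_neq_0:
  assumes \<mu>: "\<mu> \<in> \<Lambda>" and w: "w \<in> carrier H" and ij: "i < d \<mu>" "j < d \<mu>" "cl \<mu> (inv w) i j \<noteq> 0"
  shows "\<exists>p<d \<mu>. \<exists>q<d \<mu>. cl \<mu> w p q \<noteq> 0"
proof (rule ccontr)
  assume neg: "\<not> ?thesis"
  have z: "(\<Sum>u<d \<mu>. \<beta> \<mu> t u * cl \<mu> (inv w) u j) = 0" if "t < d \<mu>" for t
    unfolding beta_cl[OF \<mu> w that ij(2)] using neg that by (intro sum.neutral) auto
  have "cl \<mu> (inv w) i j = (\<Sum>u<d \<mu>. (if i = u then 1 else 0) * cl \<mu> (inv w) u j)"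
    using ij by (simp add: sum_delta_mult)
  also have "\<dots> = (\<Sum>u<d \<mu>. (\<Sum>t<d \<mu>. \<beta>inv \<mu> i t * \<beta> \<mu> t u) * cl \<mu> (inv w) u j)"
    by (rule sum.cong) (use betainv(2)[OF \<mu> ij(1)] in auto)
  also have "\<dots> = (\<Sum>t<d \<mu>. \<beta>inv \<mu> i t * (\<Sum>u<d \<mu>. \<beta> \<mu> t u * cl \<mu> (inv w) u j))"
    unfolding sum_distrib_left sum_distrib_right by (subst sum.swap) (simp add: mult.assoc)
  also have "\<dots> = 0" using z by simp
  finally show False using ij by simp
qed

lemma c_inv_neq_0_iff:
  assumes \<mu>: "\<mu> \<in> \<Lambda>" and w: "w \<in> carrier H"
  shows "c \<mu> (inv w) \<noteq> 0\<^sub>m (d \<mu>) (d \<mu>) \<longleftrightarrow> c \<mu> w \<noteq> 0\<^sub>m (d \<mu>) (d \<mu>)"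
  unfolding c_neq_0_iff using cl_inv_neq_0[OF \<mu> w] cl_inv_neq_0[OF \<mu>, of "inv w"] w
  by (metis inv_closed inv_inv)

lemma lr_equiv_refl: "lr_equiv H x x"
  by (simp add: lr_equiv_def lr_le_refl)

lemma lr_equiv_sym: "lr_equiv H x y \<Longrightarrow> lr_equiv H y x"
  by (simp add: lr_equiv_def)

lemma lr_equiv_trans: "lr_equiv H x y \<Longrightarrow> lr_equiv H y z \<Longrightarrow> lr_equiv H x z"
  unfolding lr_equiv_def using lr_le_trans by blast

lemma c_neq_0_lr_equiv:
  assumes \<mu>: "\<mu> \<in> \<Lambda>" and xy: "x \<in> carrier H" "y \<in> carrier H"
    and c: "c \<mu> x \<noteq> 0\<^sub>m (d \<mu>) (d \<mu>)" "c \<mu> y \<noteq> 0\<^sub>m (d \<mu>) (d \<mu>)"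
  shows "lr_equiv H x y"
proof -
  have "lr_le H v u" if uv: "u \<in> carrier H" "v \<in> carrier H" "c \<mu> u \<noteq> 0\<^sub>m (d \<mu>) (d \<mu>)" "c \<mu> v \<noteq> 0\<^sub>m (d \<mu>) (d \<mu>)" for u v
  proof -
    obtain p q where pq: "p < d \<mu>" "q < d \<mu>" "cl \<mu> u p q \<noteq> 0" using uv(3) c_neq_0_iff by blast
    obtain i j where ij: "j < d \<mu>" "i < d \<mu>" "cl \<mu> (inv v) j i \<noteq> 0"
      using uv(4) c_inv_neq_0_iff[OF \<mu> uv(2)] c_neq_0_iff by blast
    show ?thesis using leading_coefficients_lr_le[OF \<mu> uv(1,2) pq ij(2,1,3)] .
  qed
  then show ?thesis using assms by (simp add: lr_equiv_def)
qed

abbreviation edge :: "'w \<Rightarrow> 'w \<Rightarrow> bool" where "edge \<equiv> block_edge H \<Lambda> d c"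
abbreviation block :: "'l \<Rightarrow> 'w set" where "block \<equiv> block_of H \<Lambda> d c"

lemma edge_star_lr_equiv: "edge\<^sup>*\<^sup>* x y \<Longrightarrow> lr_equiv H x y"
proof (induction rule: rtranclp_induct)
  case (step y z)
  then have "lr_equiv H y z" unfolding block_edge_def using c_neq_0_lr_equiv by blast
  then show ?case using step lr_equiv_trans by blast
qed (rule lr_equiv_refl)

lemma edge_star_sym: "edge\<^sup>*\<^sup>* x y \<Longrightarrow> edge\<^sup>*\<^sup>* y x"
proof (induction rule: rtranclp_induct)
  case (step y z)
  then have "edge z y" by (auto simp: block_edge_def)
  then show ?case using step by (meson converse_rtranclp_into_rtranclp)
qed simp

lemma ex_c_neq_0: "\<mu> \<in> \<Lambda> \<Longrightarrow> \<exists>w\<in>carrier H. c \<mu> w \<noteq> 0\<^sub>m (d \<mu>) (d \<mu>)"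
proof (rule ccontr)
  assume \<mu>: "\<mu> \<in> \<Lambda>" and "\<not> ?thesis"
  then have "cl \<mu> w 0 0 = 0" if "w \<in> carrier H" for w
    using that c_neq_0_iff irr.d_pos[OF \<mu>] by blast
  then have "(\<Sum>w\<in>carrier H. cl \<mu> w 0 0 * cl \<mu> (inv w) 0 0) = 0" by simp
  then show False
    using leading_orthogonality[OF \<mu> \<mu>, of 0 0 0 0] irr.d_pos[OF \<mu>] f_pos[OF \<mu>] by simp
qed

lemma block_eq:
  assumes \<mu>: "\<mu> \<in> \<Lambda>" and w: "w \<in> carrier H" "c \<mu> w \<noteq> 0\<^sub>m (d \<mu>) (d \<mu>)"
  shows "block \<mu> = {y \<in> carrier H. edge\<^sup>*\<^sup>* w y}"
  unfolding block_of_def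
proof (rule the_equality)
  show "{y \<in> carrier H. edge\<^sup>*\<^sup>* w y} \<in> L_blocks H \<Lambda> d c \<and>
      (\<exists>v\<in>{y \<in> carrier H. edge\<^sup>*\<^sup>* w y}. c \<mu> v \<noteq> 0\<^sub>m (d \<mu>) (d \<mu>))"
    unfolding L_blocks_def using w by blast
  fix X assume "X \<in> L_blocks H \<Lambda> d c \<and> (\<exists>v\<in>X. c \<mu> v \<noteq> 0\<^sub>m (d \<mu>) (d \<mu>))"
  then obtain x v where X: "X = {y \<in> carrier H. edge\<^sup>*\<^sup>* x y}" "v \<in> X" "c \<mu> v \<noteq> 0\<^sub>m (d \<mu>) (d \<mu>)"
    by (auto simp: L_blocks_def)
  have "edge\<^sup>*\<^sup>* v w"
  proof (cases "v = w")
    case False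
    then have "edge v w" unfolding block_edge_def using \<mu> w X by blast
    then show ?thesis by simp
  qed simp
  then have xw: "edge\<^sup>*\<^sup>* x w" using X by (auto intro: rtranclp_trans)
  then show "X = {y \<in> carrier H. edge\<^sup>*\<^sup>* w y}"
    unfolding X(1) using edge_star_sym[OF xw] by (auto intro: rtranclp_trans)
qed

lemma block_subset: "\<mu> \<in> \<Lambda> \<Longrightarrow> block \<mu> \<subseteq> carrier H"
  using ex_c_neq_0 block_eq by fastforce

lemma in_block: "\<mu> \<in> \<Lambda> \<Longrightarrow> w \<in> carrier H \<Longrightarrow> c \<mu> w \<noteq> 0\<^sub>m (d \<mu>) (d \<mu>) \<Longrightarrow> w \<in> block \<mu>"
  using block_eq by simp

lemma block_nonempty: "\<mu> \<in> \<Lambda> \<Longrightarrow> \<exists>w. w \<in> block \<mu>"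
  using ex_c_neq_0 in_block by blast

lemma block_lr_equiv:
  assumes "\<mu> \<in> \<Lambda>" "x \<in> block \<mu>" "y \<in> block \<mu>"
  shows "lr_equiv H x y"
proof -
  obtain w where w: "w \<in> carrier H" "c \<mu> w \<noteq> 0\<^sub>m (d \<mu>) (d \<mu>)" using ex_c_neq_0[OF assms(1)] by blast
  have "lr_equiv H w x" "lr_equiv H w y"
    using assms(2,3) edge_star_lr_equiv unfolding block_eq[OF assms(1) w] by auto
  then show ?thesis using lr_equiv_sym lr_equiv_trans by blast
qed

abbreviation le\<Lambda> :: "'l \<Rightarrow> 'l \<Rightarrow> bool" where "le\<Lambda> \<equiv> lambda_le H \<Lambda> d c"

lemma lambda_le_strict:
  assumes "\<mu> \<in> \<Lambda>" "\<nu> \<in> \<Lambda>" "\<mu> \<noteq> \<nu>" "le\<Lambda> \<mu> \<nu>" "x \<in> block \<mu>" "y \<in> block \<nu>"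
  shows "lr_le H x y \<and> \<not> lr_equiv H x y"
proof -
  obtain x' y' where xy: "x' \<in> block \<mu>" "y' \<in> block \<nu>" "lr_le H x' y'" "\<not> lr_equiv H x' y'"
    using assms(3,4) by (auto simp: lambda_le_def)
  have "lr_equiv H x x'" "lr_equiv H y' y"
    using block_lr_equiv assms xy by blast+
  then show ?thesis
    using xy(3,4) unfolding lr_equiv_def by (meson lr_le_trans)
qed

lemma lambda_partial_order: "partial_order_on \<Lambda> {(\<mu>, \<nu>). \<mu> \<in> \<Lambda> \<and> \<nu> \<in> \<Lambda> \<and> le\<Lambda> \<mu> \<nu>}"
  unfolding partial_order_on_def preorder_on_def
proof (intro conjI)
  show "refl_on \<Lambda> {(\<mu>, \<nu>). \<mu> \<in> \<Lambda> \<and> \<nu> \<in> \<Lambda> \<and> le\<Lambda> \<mu> \<nu>}"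
    by (auto simp: refl_on_def lambda_le_def)
  show "trans {(\<mu>, \<nu>). \<mu> \<in> \<Lambda> \<and> \<nu> \<in> \<Lambda> \<and> le\<Lambda> \<mu> \<nu>}"
  proof (rule transI, clarify)
    fix \<mu> \<nu> \<kappa> assume L: "\<mu> \<in> \<Lambda>" "\<nu> \<in> \<Lambda>" "\<kappa> \<in> \<Lambda>" "le\<Lambda> \<mu> \<nu>" "le\<Lambda> \<nu> \<kappa>"
    show "le\<Lambda> \<mu> \<kappa>"
    proof (cases "\<mu> = \<nu> \<or> \<nu> = \<kappa>")
      case False
      obtain x y z where xyz: "x \<in> block \<mu>" "y \<in> block \<nu>" "z \<in> block \<kappa>"
        using block_nonempty L by metis
      have "lr_le H x y \<and> \<not> lr_equiv H x y" "lr_le H y z"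
        using lambda_le_strict L False xyz by blast+
      then have "lr_le H x z \<and> \<not> lr_equiv H x z"
        unfolding lr_equiv_def using lr_le_trans by blast
      then show ?thesis unfolding lambda_le_def using xyz by blast
    qed (use L in auto)
  qed
  show "antisym {(\<mu>, \<nu>). \<mu> \<in> \<Lambda> \<and> \<nu> \<in> \<Lambda> \<and> le\<Lambda> \<mu> \<nu>}"
  proof (rule antisymI, clarify)
    fix \<mu> \<nu> assume L: "\<mu> \<in> \<Lambda>" "\<nu> \<in> \<Lambda>" "le\<Lambda> \<mu> \<nu>" "le\<Lambda> \<nu> \<mu>"
    show "\<mu> = \<nu>"
    proof (rule ccontr)
      assume "\<mu> \<noteq> \<nu>"
      obtain x y where "x \<in> block \<mu>" "y \<in> block \<nu>"
        using block_nonempty L by metis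
      then have "lr_le H x y \<and> \<not> lr_equiv H x y" "lr_le H y x"
        using lambda_le_strict L \<open>\<mu> \<noteq> \<nu>\<close> by blast+
      then show False by (simp add: lr_equiv_def)
    qed
  qed
qed (auto)

definition cell_coef :: "'l \<Rightarrow> nat \<Rightarrow> nat \<Rightarrow> 'w \<Rightarrow> complex" where
  "cell_coef \<mu> s t w = (\<Sum>u<d \<mu>. \<beta> \<mu> t u * cl \<mu> (inv w) u s)"

definition cell_elt :: "'l \<Rightarrow> nat \<Rightarrow> nat \<Rightarrow> ('w, 'g) hecke_elt" where
  "cell_elt \<mu> s t = (\<Sum>w\<in>carrier H. smul (const (cell_coef \<mu> s t w)) (KL w))"

lemma cell_coef_ZW: "\<mu> \<in> \<Lambda> \<Longrightarrow> w \<in> carrier H \<Longrightarrow> s < d \<mu> \<Longrightarrow> t < d \<mu> \<Longrightarrow> cell_coef \<mu> s t w \<in> ZWof H"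
  unfolding cell_coef_def by (auto intro!: ZW_closed beta_ZW cl_ZW)

lemma cell_coef_eq_0:
  assumes "\<mu> \<in> \<Lambda>" "w \<in> carrier H" "s < d \<mu>" "c \<mu> w = 0\<^sub>m (d \<mu>) (d \<mu>)"
  shows "cell_coef \<mu> s t w = 0"
proof -
  have "cl \<mu> (inv w) u s = 0" if "u < d \<mu>" for u
    using c_inv_neq_0_iff[OF assms(1,2)] c_neq_0_iff assms(3,4) that by blast
  then show ?thesis by (simp add: cell_coef_def)
qed

lemma const_A: "x \<in> R0 \<Longrightarrow> const x \<in> A"
  by (rule single_A)

lemma const_cell_coef_A: "\<mu> \<in> \<Lambda> \<Longrightarrow> w \<in> carrier H \<Longrightarrow> s < d \<mu> \<Longrightarrow> t < d \<mu> \<Longrightarrow> const (cell_coef \<mu> s t w) \<in> A"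
  using cell_coef_ZW ZW_subset const_A by blast

lemma HH_cell_elt: "\<mu> \<in> \<Lambda> \<Longrightarrow> s < d \<mu> \<Longrightarrow> t < d \<mu> \<Longrightarrow> cell_elt \<mu> s t \<in> HH"
  unfolding cell_elt_def by (auto intro!: HH_sum HH_smul HH_KL const_cell_coef_A)

lemma kl_sum_KL:
  assumes "\<And>w. w \<in> carrier H \<Longrightarrow> b w \<in> A" and y: "y \<in> carrier H"
  shows "kl (\<Sum>w\<in>carrier H. smul (b w) (KL w)) y = b y"
proof -
  have "kl (\<Sum>w\<in>carrier H. smul (b w) (KL w)) y = (\<Sum>w\<in>carrier H. b w * coef (T w) y)"
    using assms by (simp add: kl_coords_sum kl_coords_smul kl_coords_KL HH_smul HH_KL lookup_sum)
  also have "\<dots> = (\<Sum>w\<in>carrier H. b w * (if w = y then 1 else 0))"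
    by (rule sum.cong) (auto simp: lookup_single when_def)
  finally show ?thesis using y finite_W by (simp add: sum_delta_mult)
qed

lemma kl_cell_elt: "\<mu> \<in> \<Lambda> \<Longrightarrow> s < d \<mu> \<Longrightarrow> t < d \<mu> \<Longrightarrow> y \<in> carrier H \<Longrightarrow> kl (cell_elt \<mu> s t) y = const (cell_coef \<mu> s t y)"
  unfolding cell_elt_def by (rule kl_sum_KL) (auto intro: const_cell_coef_A)

lemma star_cell_elt:
  assumes \<mu>: "\<mu> \<in> \<Lambda>" and st: "s < d \<mu>" "t < d \<mu>"
  shows "star (cell_elt \<mu> s t) = cell_elt \<mu> t s"
proof -
  have "star (cell_elt \<mu> s t) = (\<Sum>w\<in>carrier H. smul (const (cell_coef \<mu> s t w)) (KL (inv w)))"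
    unfolding cell_elt_def using const_cell_coef_A[OF \<mu> _ st]
    by (subst star_sum) (auto simp: star_smul star_KL HH_KL HH_smul)
  also have "\<dots> = (\<Sum>w\<in>carrier H. smul (const (cell_coef \<mu> s t (inv w))) (KL w))"
    by (rule sum.reindex_bij_witness[of _ "\<lambda>w. inv w" "\<lambda>w. inv w"]) auto
  also have "\<dots> = cell_elt \<mu> t s"
    unfolding cell_elt_def
  proof (rule sum.cong)
    fix w assume w: "w \<in> carrier H"
    have "cell_coef \<mu> t s w = (\<Sum>u<d \<mu>. cl \<mu> w u s * \<beta> \<mu> u t)"
      unfolding cell_coef_def using beta_cl[OF \<mu> w st] .
    also have "\<dots> = cell_coef \<mu> s t (inv w)"
      unfolding cell_coef_def by (rule sum.cong) (use beta_sym[OF \<mu>] st w in \<open>auto simp: mult.commute\<close>)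
    finally show "smul (const (cell_coef \<mu> s t (inv w))) (KL w) = smul (const (cell_coef \<mu> t s w)) (KL w)" by simp
  qed simp
  finally show ?thesis .
qed

definition dual_coef :: "'l \<Rightarrow> nat \<Rightarrow> nat \<Rightarrow> 'w \<Rightarrow> complex" where
  "dual_coef \<mu> s t y = inverse (complex_of_real (f \<mu>)) * (\<Sum>j<d \<mu>. cl \<mu> y s j * \<beta>inv \<mu> j t)"

lemma dual_coef_R0: "\<mu> \<in> \<Lambda> \<Longrightarrow> y \<in> carrier H \<Longrightarrow> s < d \<mu> \<Longrightarrow> t < d \<mu> \<Longrightarrow> dual_coef \<mu> s t y \<in> R0"
  unfolding dual_coef_def by (auto intro!: R0_closed inverse_f_R0 betainv(1) ZW_subset[OF cl_ZW])

lemma dual_coef_neq_0: "dual_coef \<mu> s t y \<noteq> 0 \<Longrightarrow> s < d \<mu> \<Longrightarrow> c \<mu> y \<noteq> 0\<^sub>m (d \<mu>) (d \<mu>)"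
proof (rule ccontr)
  assume nz: "dual_coef \<mu> s t y \<noteq> 0" and s: "s < d \<mu>" and "\<not> c \<mu> y \<noteq> 0\<^sub>m (d \<mu>) (d \<mu>)"
  then have "cl \<mu> y s j = 0" if "j < d \<mu>" for j
    using c_neq_0_iff that by blast
  then show False using nz by (simp add: dual_coef_def)
qed

lemma dual_coef_cell_coef:
  assumes y: "y \<in> carrier H" and w: "w \<in> carrier H"
  shows "(\<Sum>\<mu>\<in>\<Lambda>. \<Sum>s<d \<mu>. \<Sum>t<d \<mu>. dual_coef \<mu> s t y * cell_coef \<mu> s t w) = (if y = w then 1 else 0)"
  unfolding dual_leading_orthogonality[OF y w, symmetric]
proof (rule sum.cong[OF refl], rule sum.cong[OF refl])
  fix \<mu> s assume \<mu>: "\<mu> \<in> \<Lambda>" and s: "s \<in> {..<d \<mu>}"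
  let ?f = "inverse (complex_of_real (f \<mu>))"
  have "(\<Sum>t<d \<mu>. dual_coef \<mu> s t y * cell_coef \<mu> s t w) =
      (\<Sum>t<d \<mu>. \<Sum>j<d \<mu>. \<Sum>u<d \<mu>. ?f * cl \<mu> y s j * ((\<beta>inv \<mu> j t * \<beta> \<mu> t u) * cl \<mu> (inv w) u s))"
    by (intro sum.cong refl) (simp add: dual_coef_def cell_coef_def sum_product sum_distrib_left mult_ac)
  also have "\<dots> = (\<Sum>j<d \<mu>. \<Sum>u<d \<mu>. \<Sum>t<d \<mu>. ?f * cl \<mu> y s j * ((\<beta>inv \<mu> j t * \<beta> \<mu> t u) * cl \<mu> (inv w) u s))"
    by (subst sum.swap) (intro sum.cong refl sum.swap)
  also have "\<dots> = (\<Sum>j<d \<mu>. \<Sum>u<d \<mu>. ?f * cl \<mu> y s j * ((\<Sum>t<d \<mu>. \<beta>inv \<mu> j t * \<beta> \<mu> t u) * cl \<mu> (inv w) u s))"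
    by (simp only: sum_distrib_left sum_distrib_right)
  also have "\<dots> = (\<Sum>j<d \<mu>. \<Sum>u<d \<mu>. (if j = u then 1 else 0) * (?f * cl \<mu> y s j * cl \<mu> (inv w) u s))"
    by (intro sum.cong refl) (simp add: betainv(2)[OF \<mu>])
  also have "\<dots> = (\<Sum>j<d \<mu>. ?f * cl \<mu> y s j * cl \<mu> (inv w) j s)"
    by (intro sum.cong refl) (simp add: sum_delta_mult)
  finally show "(\<Sum>t<d \<mu>. dual_coef \<mu> s t y * cell_coef \<mu> s t w) = (\<Sum>j<d \<mu>. ?f * cl \<mu> y s j * cl \<mu> (inv w) j s)" .
qed

lemma cell_coef_dual_coef:
  assumes "(\<mu>, s, t) \<in> entries" "(\<nu>, s', t') \<in> entries"
  shows "(\<Sum>w\<in>carrier H. cell_coef \<mu> s t w * dual_coef \<nu> s' t' w) = (if (\<mu>, s, t) = (\<nu>, s', t') then 1 else 0)"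
proof -
  define M where "M = (\<lambda>y (\<mu>, s, t). dual_coef \<mu> s t y)"
  define N where "N = (\<lambda>(\<mu>, s, t) w. cell_coef \<mu> s t w)"
  have "(\<Sum>x\<in>entries. M y x * N x w) = (if y = w then 1 else 0)" if "y \<in> carrier H" "w \<in> carrier H" for y w
    using dual_coef_cell_coef[OF that] irr.finite_Lambda by (simp add: sum_matrix_entries M_def N_def)
  from left_inverse_imp_right_inverse[OF finite_W finite_entries irr.card_matrix_entries[symmetric] this assms]
  show ?thesis by (simp add: M_def N_def)
qed

definition cell_fam :: "'l \<times> nat \<times> nat \<Rightarrow> ('w, 'g) hecke_elt" where
  "cell_fam = (\<lambda>(\<mu>, s, t). cell_elt \<mu> s t)"

definition coef_fam :: "'l \<times> nat \<times> nat \<Rightarrow> 'w \<Rightarrow> complex" where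
  "coef_fam = (\<lambda>(\<mu>, s, t). cell_coef \<mu> s t)"

definition dual_fam :: "'l \<times> nat \<times> nat \<Rightarrow> 'w \<Rightarrow> complex" where
  "dual_fam = (\<lambda>(\<mu>, s, t). dual_coef \<mu> s t)"

lemma coef_fam_dual_fam: "x \<in> entries \<Longrightarrow> y \<in> entries \<Longrightarrow> (\<Sum>w\<in>carrier H. coef_fam x w * dual_fam y w) = (if x = y then 1 else 0)"
  unfolding coef_fam_def dual_fam_def using cell_coef_dual_coef by (cases x; cases y) auto

lemma dual_fam_coef_fam: "y \<in> carrier H \<Longrightarrow> w \<in> carrier H \<Longrightarrow> (\<Sum>x\<in>entries. dual_fam x y * coef_fam x w) = (if y = w then 1 else 0)"
  using dual_coef_cell_coef irr.finite_Lambda by (simp add: sum_matrix_entries coef_fam_def dual_fam_def)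

lemma dual_fam_R0: "x \<in> entries \<Longrightarrow> y \<in> carrier H \<Longrightarrow> dual_fam x y \<in> R0"
  by (auto simp: dual_fam_def dual_coef_R0)

lemma HH_cell_fam: "x \<in> entries \<Longrightarrow> cell_fam x \<in> HH"
  by (auto simp: cell_fam_def HH_cell_elt)

lemma kl_cell_fam: "x \<in> entries \<Longrightarrow> y \<in> carrier H \<Longrightarrow> kl (cell_fam x) y = const (coef_fam x y)"
  by (auto simp: cell_fam_def coef_fam_def kl_cell_elt)

lemma KL_eq_sum_cell_fam:
  assumes y: "y \<in> carrier H"
  shows "KL y = (\<Sum>x\<in>entries. smul (const (dual_fam x y)) (cell_fam x))"
proof -
  have "(\<Sum>x\<in>entries. smul (const (dual_fam x y)) (cell_fam x)) =
      (\<Sum>x\<in>entries. \<Sum>w\<in>carrier H. smul (const (dual_fam x y * coef_fam x w)) (KL w))"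
    by (intro sum.cong refl) (auto simp: cell_fam_def coef_fam_def cell_elt_def smul_sum const_mult)
  also have "\<dots> = (\<Sum>w\<in>carrier H. smul (const (\<Sum>x\<in>entries. dual_fam x y * coef_fam x w)) (KL w))"
    by (subst sum.swap) (simp add: const_sum smul_sum_left)
  also have "\<dots> = (\<Sum>w\<in>carrier H. if y = w then KL w else 0)"
    by (intro sum.cong refl) (simp add: dual_fam_coef_fam y)
  finally show ?thesis using y finite_W by simp
qed

lemma cell_fam_expand:
  assumes h: "h \<in> HH"
  shows "h = (\<Sum>x\<in>entries. smul (\<Sum>y\<in>carrier H. kl h y * const (dual_fam x y)) (cell_fam x))"
proof -
  have "h = (\<Sum>y\<in>carrier H. smul (kl h y) (KL y))" by (rule kl_expand[OF h])
  also have "\<dots> = (\<Sum>y\<in>carrier H. \<Sum>x\<in>entries. smul (kl h y * const (dual_fam x y)) (cell_fam x))"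
  proof (rule sum.cong[OF refl])
    fix y assume "y \<in> carrier H"
    then show "smul (kl h y) (KL y) = (\<Sum>x\<in>entries. smul (kl h y * const (dual_fam x y)) (cell_fam x))"
      by (subst KL_eq_sum_cell_fam) (simp_all add: smul_sum)
  qed
  also have "\<dots> = (\<Sum>x\<in>entries. smul (\<Sum>y\<in>carrier H. kl h y * const (dual_fam x y)) (cell_fam x))"
    by (subst sum.swap) (simp add: smul_sum_left)
  finally show ?thesis .
qed

lemma cell_fam_independent:
  assumes b: "(\<Sum>x\<in>entries. smul (b x) (cell_fam x)) = 0" "\<And>x. x \<in> entries \<Longrightarrow> b x \<in> A" and y: "y \<in> entries"
  shows "b y = 0"
proof -
  have z: "(\<Sum>x\<in>entries. b x * const (coef_fam x w)) = 0" if w: "w \<in> carrier H" for w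
  proof -
    have "0 = kl (\<Sum>x\<in>entries. smul (b x) (cell_fam x)) w" using b(1) by simp
    also have "\<dots> = (\<Sum>x\<in>entries. b x * const (coef_fam x w))"
      using b(2) w by (simp add: kl_coords_sum kl_coords_smul HH_smul HH_cell_fam lookup_sum kl_cell_fam)
    finally show ?thesis by simp
  qed
  have "0 = (\<Sum>w\<in>carrier H. const (dual_fam y w) * (\<Sum>x\<in>entries. b x * const (coef_fam x w)))"
    using z by simp
  also have "\<dots> = (\<Sum>x\<in>entries. b x * const (\<Sum>w\<in>carrier H. coef_fam x w * dual_fam y w))"
    unfolding sum_distrib_left const_sum by (subst sum.swap) (simp add: const_mult mult_ac)
  also have "\<dots> = (\<Sum>x\<in>entries. if x = y then b x else 0)"
    by (intro sum.cong refl) (simp add: coef_fam_dual_fam y)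
  also have "\<dots> = b y" using y finite_entries by simp
  finally show ?thesis by simp
qed

lemma inj_cell_fam: "inj_on cell_fam entries"
proof (rule inj_onI, rule ccontr)
  fix x y assume xy: "x \<in> entries" "y \<in> entries" "cell_fam x = cell_fam y" "x \<noteq> y"
  have "coef_fam x w = coef_fam y w" if "w \<in> carrier H" for w
    using kl_cell_fam[OF xy(1) that] kl_cell_fam[OF xy(2) that] xy(3) by (metis lookup_single_eq)
  then have "(\<Sum>w\<in>carrier H. coef_fam x w * dual_fam y w) = (\<Sum>w\<in>carrier H. coef_fam y w * dual_fam y w)"
    by simp
  then show False using coef_fam_dual_fam[OF xy(1,2)] coef_fam_dual_fam[OF xy(2,2)] xy(4) by simp
qed

lemma sum_in_hspan:
  assumes I: "I \<subseteq> entries" and b: "\<And>x. x \<in> I \<Longrightarrow> b x \<in> A"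
  shows "(\<Sum>x\<in>I. smul (b x) (cell_fam x)) \<in> hspan H (cell_fam ` I)"
proof -
  have inj: "inj_on cell_fam I" using inj_cell_fam I inj_on_subset by blast
  define g where "g = the_inv_into I cell_fam"
  have g: "g (cell_fam x) = x" if "x \<in> I" for x
    unfolding g_def using the_inv_into_f_f[OF inj that] .
  have "(\<Sum>x\<in>I. smul (b x) (cell_fam x)) = (\<Sum>h\<in>cell_fam ` I. smul (b (g h)) h)"
    using sum.reindex[OF inj, of "\<lambda>h. smul (b (g h)) h"] g by simp
  moreover have "finite (cell_fam ` I)" using finite_subset[OF I finite_entries] by simp
  moreover have "\<forall>h\<in>cell_fam ` I. b (g h) \<in> A" using g b by auto
  ultimately show ?thesis
    unfolding hspan_def by (intro CollectI exI[of _ "cell_fam ` I"] exI[of _ "\<lambda>h. b (g h)"]) simp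
qed

lemma basis_cell_fam: "is_A_basis H (cell_fam ` entries)"
  unfolding is_A_basis_def
proof (intro conjI equalityI subsetI allI impI)
  fix h assume "h \<in> hspan H (cell_fam ` entries)"
  then obtain X r' where "h = (\<Sum>b\<in>X. smul (r' b) b)" "X \<subseteq> cell_fam ` entries" "\<forall>b\<in>X. r' b \<in> A"
    by (auto simp: hspan_def)
  then show "h \<in> HH" using HH_cell_fam by (auto intro!: HH_sum HH_smul)
next
  fix h assume h: "h \<in> HH"
  have "(\<Sum>y\<in>carrier H. kl h y * const (dual_fam x y)) \<in> A" if "x \<in> entries" for x
    using kl_A[OF h] const_A[OF dual_fam_R0[OF that]] by (intro A_closed)
  then have "(\<Sum>x\<in>entries. smul (\<Sum>y\<in>carrier H. kl h y * const (dual_fam x y)) (cell_fam x)) \<in> hspan H (cell_fam ` entries)"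
    by (rule sum_in_hspan[OF subset_refl])
  then show "h \<in> hspan H (cell_fam ` entries)"
    unfolding cell_fam_expand[OF h, symmetric] .
next
  fix X r' assume "finite X \<and> X \<subseteq> cell_fam ` entries \<and> (\<forall>b\<in>X. r' b \<in> A) \<and> (\<Sum>b\<in>X. smul (r' b) b) = 0"
  then have X: "X \<subseteq> cell_fam ` entries" "\<forall>b\<in>X. r' b \<in> A" "(\<Sum>b\<in>X. smul (r' b) b) = 0" by auto
  define b where "b = (\<lambda>x. if cell_fam x \<in> X then r' (cell_fam x) else 0)"
  have "(\<Sum>x\<in>entries. smul (b x) (cell_fam x)) = (\<Sum>h\<in>cell_fam ` entries. smul (if h \<in> X then r' h else 0) h)"
    using sum.reindex[OF inj_cell_fam, of "\<lambda>h. smul (if h \<in> X then r' h else 0) h"] by (simp add: b_def)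
  also have "\<dots> = (\<Sum>h\<in>X. smul (r' h) h)"
    by (rule sum.mono_neutral_cong_right) (use X finite_entries in auto)
  finally have "(\<Sum>x\<in>entries. smul (b x) (cell_fam x)) = 0" using X by simp
  then have "b x = 0" if "x \<in> entries" for x
    using cell_fam_independent[of b x] that X A_closed(1) by (auto simp: b_def)
  then show "\<forall>h\<in>X. r' h = 0" using X(1) by (force simp: b_def)
qed

end

context cellular_setup
begin

abbreviation \<gamma> :: "'w \<Rightarrow> 'w \<Rightarrow> 'w \<Rightarrow> complex" where "\<gamma> \<equiv> gamma_tilde \<Lambda> d f c"

lemma gamma_eq:
  "\<gamma> x y z = (\<Sum>\<mu>\<in>\<Lambda>. \<Sum>i<d \<mu>. \<Sum>j<d \<mu>. \<Sum>k<d \<mu>.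
    inverse (complex_of_real (f \<mu>)) * cl \<mu> x i j * cl \<mu> y j k * cl \<mu> z k i)"
  by (simp add: gamma_tilde_def cl_def)

lemma inverse_f: "\<mu> \<in> \<Lambda> \<Longrightarrow> inverse (complex_of_real (f \<mu>)) * complex_of_real (f \<mu>) = 1"
  using f_neq_0 by simp

lemma gamma_sum_left:
  assumes \<mu>: "\<mu> \<in> \<Lambda>" and pb: "p < d \<mu>" "b < d \<mu>"
  shows "(\<Sum>w\<in>carrier H. \<gamma> w y z * cl \<mu> (inv w) p b) = (\<Sum>k<d \<mu>. cl \<mu> y p k * cl \<mu> z k b)"
proof -
  have "(\<Sum>w\<in>carrier H. \<gamma> w y z * cl \<mu> (inv w) p b) =
      (\<Sum>w\<in>carrier H. \<Sum>\<nu>\<in>\<Lambda>. \<Sum>i<d \<nu>. \<Sum>j<d \<nu>. \<Sum>k<d \<nu>.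
        inverse (complex_of_real (f \<nu>)) * (cl \<nu> w i j * cl \<mu> (inv w) p b) * (cl \<nu> y j k * cl \<nu> z k i))"
    unfolding gamma_eq sum_distrib_right by (intro sum.cong refl) (simp only: mult_ac)
  also have "\<dots> = (\<Sum>\<nu>\<in>\<Lambda>. \<Sum>i<d \<nu>. \<Sum>j<d \<nu>. \<Sum>k<d \<nu>.
      inverse (complex_of_real (f \<nu>)) * (\<Sum>w\<in>carrier H. cl \<nu> w i j * cl \<mu> (inv w) p b) * (cl \<nu> y j k * cl \<nu> z k i))"
    by (simp only: sum.swap[of _ "carrier H"] sum_distrib_left sum_distrib_right)
  also have "\<dots> = (\<Sum>\<nu>\<in>\<Lambda>. \<Sum>i<d \<nu>. \<Sum>j<d \<nu>. \<Sum>k<d \<nu>.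
      if \<nu> = \<mu> then (if i = b then (if j = p then cl \<mu> y p k * cl \<mu> z k b else 0) else 0) else 0)"
    by (intro sum.cong refl) (auto simp: leading_orthogonality \<mu> pb inverse_f)
  also have "\<dots> = (\<Sum>k<d \<mu>. cl \<mu> y p k * cl \<mu> z k b)"
    using \<mu> pb irr.finite_Lambda by (simp add: sum_if_const)
  finally show ?thesis .
qed

lemma gamma_sum_middle:
  assumes \<mu>: "\<mu> \<in> \<Lambda>" and pq: "p < d \<mu>" "q < d \<mu>"
  shows "(\<Sum>w\<in>carrier H. \<gamma> x w z * cl \<mu> (inv w) q p) = (\<Sum>i<d \<mu>. cl \<mu> x i p * cl \<mu> z q i)"
proof -
  have "(\<Sum>w\<in>carrier H. \<gamma> x w z * cl \<mu> (inv w) q p) =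
      (\<Sum>w\<in>carrier H. \<Sum>\<nu>\<in>\<Lambda>. \<Sum>i<d \<nu>. \<Sum>j<d \<nu>. \<Sum>k<d \<nu>.
        inverse (complex_of_real (f \<nu>)) * (cl \<nu> w j k * cl \<mu> (inv w) q p) * (cl \<nu> x i j * cl \<nu> z k i))"
    unfolding gamma_eq sum_distrib_right by (intro sum.cong refl) (simp only: mult_ac)
  also have "\<dots> = (\<Sum>\<nu>\<in>\<Lambda>. \<Sum>i<d \<nu>. \<Sum>j<d \<nu>. \<Sum>k<d \<nu>.
      inverse (complex_of_real (f \<nu>)) * (\<Sum>w\<in>carrier H. cl \<nu> w j k * cl \<mu> (inv w) q p) * (cl \<nu> x i j * cl \<nu> z k i))"
    by (simp only: sum.swap[of _ "carrier H"] sum_distrib_left sum_distrib_right)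
  also have "\<dots> = (\<Sum>\<nu>\<in>\<Lambda>. \<Sum>i<d \<nu>. \<Sum>j<d \<nu>. \<Sum>k<d \<nu>.
      if \<nu> = \<mu> then (if j = p then (if k = q then cl \<mu> x i p * cl \<mu> z q i else 0) else 0) else 0)"
    by (intro sum.cong refl) (auto simp: leading_orthogonality \<mu> pq inverse_f)
  also have "\<dots> = (\<Sum>i<d \<mu>. cl \<mu> x i p * cl \<mu> z q i)"
    using \<mu> pq irr.finite_Lambda by (simp add: sum_if_const)
  finally show ?thesis .
qed

definition \<Phi> :: "'l \<Rightarrow> 'w \<Rightarrow> 'w \<Rightarrow> nat \<Rightarrow> nat \<Rightarrow> 'g \<Rightarrow>\<^sub>0 complex" where
  "\<Phi> \<mu> x y i j = (\<Sum>w\<in>carrier H. hcoef H x w y * const (cl \<mu> (inv w) i j))"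

lemma cl_inv_eq_0:
  assumes \<mu>: "\<mu> \<in> \<Lambda>" and y: "y \<in> carrier H" and v: "v \<in> block \<mu>" and ne: "\<not> lr_equiv H y v"
    and ij: "i < d \<mu>" "j < d \<mu>"
  shows "cl \<mu> (inv y) i j = 0"
proof (rule ccontr)
  assume "cl \<mu> (inv y) i j \<noteq> 0"
  then have "c \<mu> y \<noteq> 0\<^sub>m (d \<mu>) (d \<mu>)"
    using c_inv_neq_0_iff[OF \<mu> y] c_neq_0_iff ij by blast
  then have "y \<in> block \<mu>" by (rule in_block[OF \<mu> y])
  then show False using block_lr_equiv[OF \<mu> _ v] ne by blast
qed

lemma P15_Phi:
  assumes \<mu>: "\<mu> \<in> \<Lambda>" and x: "x \<in> carrier H" and y: "y \<in> carrier H" and v: "v \<in> block \<mu>" "lr_equiv H y v"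
    and x': "x' \<in> carrier H" and pb: "p < d \<mu>" "b < d \<mu>"
  shows "(\<Sum>k<d \<mu>. const (cl \<mu> x' p k) * \<Phi> \<mu> x y k b) = (\<Sum>u\<in>carrier H. \<Phi> \<mu> x u p b * const (\<gamma> u x' (inv y)))"
proof -
  have eq: "(\<Sum>u\<in>carrier H. const (\<gamma> w x' (inv u)) * hcoef H x u y) * const (cl \<mu> (inv w) p b) =
      (\<Sum>u\<in>carrier H. hcoef H x w u * const (\<gamma> u x' (inv y))) * const (cl \<mu> (inv w) p b)"
    if w: "w \<in> carrier H" for w
  proof (cases "lr_equiv H w y")
    case True
    then show ?thesis using P15 x x' y w unfolding P15_tilde_def by simp
  next
    case False
    then have "\<not> lr_equiv H w v" using v(2) lr_equiv_sym lr_equiv_trans by blast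
    then show ?thesis using cl_inv_eq_0[OF \<mu> w v(1) _ pb] by simp
  qed
  have "(\<Sum>k<d \<mu>. const (cl \<mu> x' p k) * \<Phi> \<mu> x y k b) =
      (\<Sum>u\<in>carrier H. const (\<Sum>k<d \<mu>. cl \<mu> x' p k * cl \<mu> (inv u) k b) * hcoef H x u y)"
    by (simp add: \<Phi>_def sum_distrib_left sum_distrib_right const_sum const_mult
        sum.swap[of _ "carrier H"] mult_ac)
  also have "\<dots> = (\<Sum>u\<in>carrier H. const (\<Sum>w\<in>carrier H. \<gamma> w x' (inv u) * cl \<mu> (inv w) p b) * hcoef H x u y)"
    by (simp add: gamma_sum_left[OF \<mu> pb])
  also have "\<dots> = (\<Sum>w\<in>carrier H. (\<Sum>u\<in>carrier H. const (\<gamma> w x' (inv u)) * hcoef H x u y) * const (cl \<mu> (inv w) p b))"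
    unfolding const_sum const_mult sum_distrib_right by (subst sum.swap) (simp only: mult_ac)
  also have "\<dots> = (\<Sum>w\<in>carrier H. (\<Sum>u\<in>carrier H. hcoef H x w u * const (\<gamma> u x' (inv y))) * const (cl \<mu> (inv w) p b))"
    by (rule sum.cong) (simp_all add: eq)
  also have "\<dots> = (\<Sum>u\<in>carrier H. \<Phi> \<mu> x u p b * const (\<gamma> u x' (inv y)))"
    unfolding \<Phi>_def sum_distrib_right by (subst sum.swap) (simp only: mult_ac)
  finally show ?thesis .
qed

definition \<rho>cell :: "'l \<Rightarrow> 'w \<Rightarrow> nat \<Rightarrow> nat \<Rightarrow> 'g \<Rightarrow>\<^sub>0 complex" where
  "\<rho>cell \<mu> x k b = const (inverse (complex_of_real (f \<mu>))) * (\<Sum>u\<in>carrier H. const (cl \<mu> u k 0) * \<Phi> \<mu> x u 0 b)"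

text \<open>Combining the relations \<open>P15_Phi\<close> over \<open>x'\<close> with coefficients that turn \<open>cl \<mu> x'\<close> into the
  matrix unit \<open>(0, q)\<close> isolates a single row of \<open>\<Phi>\<close>.\<close>

lemma Phi_factor:
  assumes \<mu>: "\<mu> \<in> \<Lambda>" and x: "x \<in> carrier H" and y: "y \<in> carrier H" and v: "v \<in> block \<mu>" "lr_equiv H y v"
    and qb: "q < d \<mu>" "b < d \<mu>"
  shows "\<Phi> \<mu> x y q b = (\<Sum>k<d \<mu>. const (cl \<mu> (inv y) q k) * \<rho>cell \<mu> x k b)"
proof -
  let ?f = "complex_of_real (f \<mu>)"
  have d0: "0 < d \<mu>" by (rule irr.d_pos[OF \<mu>])
  have "const ?f * \<Phi> \<mu> x y q b = (\<Sum>k<d \<mu>. (if k = q then 1 else 0) * (const ?f * \<Phi> \<mu> x y k b))"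
    using qb by (simp add: sum_delta_mult)
  also have "\<dots> = (\<Sum>k<d \<mu>. const (\<Sum>x'\<in>carrier H. cl \<mu> x' 0 k * cl \<mu> (inv x') q 0) * \<Phi> \<mu> x y k b)"
    by (intro sum.cong refl) (auto simp: leading_orthogonality[OF \<mu> \<mu> d0 _ qb(1) d0])
  also have "\<dots> = (\<Sum>x'\<in>carrier H. const (cl \<mu> (inv x') q 0) * (\<Sum>k<d \<mu>. const (cl \<mu> x' 0 k) * \<Phi> \<mu> x y k b))"
    unfolding const_sum const_mult sum_distrib_right sum_distrib_left by (subst sum.swap) (simp only: mult_ac)
  also have "\<dots> = (\<Sum>x'\<in>carrier H. const (cl \<mu> (inv x') q 0) * (\<Sum>u\<in>carrier H. \<Phi> \<mu> x u 0 b * const (\<gamma> u x' (inv y))))"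
    by (rule sum.cong) (simp_all add: P15_Phi[OF \<mu> x y v _ d0 qb(2)])
  also have "\<dots> = (\<Sum>u\<in>carrier H. \<Phi> \<mu> x u 0 b * const (\<Sum>x'\<in>carrier H. \<gamma> u x' (inv y) * cl \<mu> (inv x') q 0))"
    unfolding const_sum const_mult sum_distrib_left by (subst sum.swap) (simp only: mult_ac)
  also have "\<dots> = (\<Sum>u\<in>carrier H. \<Phi> \<mu> x u 0 b * const (\<Sum>k<d \<mu>. cl \<mu> u k 0 * cl \<mu> (inv y) q k))"
    by (simp add: gamma_sum_middle[OF \<mu> d0 qb(1)])
  also have "\<dots> = (\<Sum>k<d \<mu>. const (cl \<mu> (inv y) q k) * (\<Sum>u\<in>carrier H. const (cl \<mu> u k 0) * \<Phi> \<mu> x u 0 b))"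
    unfolding const_sum const_mult sum_distrib_left by (subst sum.swap) (simp only: mult_ac)
  finally have *: "const ?f * \<Phi> \<mu> x y q b =
      (\<Sum>k<d \<mu>. const (cl \<mu> (inv y) q k) * (\<Sum>u\<in>carrier H. const (cl \<mu> u k 0) * \<Phi> \<mu> x u 0 b))" .
  have "\<Phi> \<mu> x y q b = const (inverse ?f) * (const ?f * \<Phi> \<mu> x y q b)"
    using f_neq_0[OF \<mu>] by (simp add: mult.assoc[symmetric] const_mult[symmetric])
  also have "\<dots> = (\<Sum>k<d \<mu>. const (cl \<mu> (inv y) q k) * \<rho>cell \<mu> x k b)"
    unfolding * \<rho>cell_def sum_distrib_left by (simp only: mult_ac)
  finally show ?thesis .
qed

lemma Phi_A: "\<mu> \<in> \<Lambda> \<Longrightarrow> x \<in> carrier H \<Longrightarrow> i < d \<mu> \<Longrightarrow> j < d \<mu> \<Longrightarrow> y \<in> carrier H \<Longrightarrow> \<Phi> \<mu> x y i j \<in> A"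
  unfolding \<Phi>_def by (auto intro!: A_closed hcoef_A const_A ZW_subset[OF cl_ZW])

lemma rhocell_A:
  assumes "\<mu> \<in> \<Lambda>" "x \<in> carrier H" "k < d \<mu>" "b < d \<mu>"
  shows "\<rho>cell \<mu> x k b \<in> A"
  unfolding \<rho>cell_def using assms irr.d_pos
  by (auto intro!: A_closed Phi_A const_A inverse_f_R0 ZW_subset[OF cl_ZW])

definition rep_coef :: "'l \<Rightarrow> ('w, 'g) hecke_elt \<Rightarrow> nat \<Rightarrow> nat \<Rightarrow> 'g \<Rightarrow>\<^sub>0 complex" where
  "rep_coef \<mu> h k s = (\<Sum>x\<in>carrier H. kl h x * \<rho>cell \<mu> x k s)"

lemma rep_coef_A: "\<mu> \<in> \<Lambda> \<Longrightarrow> h \<in> HH \<Longrightarrow> k < d \<mu> \<Longrightarrow> s < d \<mu> \<Longrightarrow> rep_coef \<mu> h k s \<in> A"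
  unfolding rep_coef_def by (auto intro!: A_closed kl_A rhocell_A)

lemma kl_mult_cell_elt:
  assumes \<mu>: "\<mu> \<in> \<Lambda>" and h: "h \<in> HH" and st: "s < d \<mu>" "t < d \<mu>" and y: "y \<in> carrier H"
  shows "kl (h \<star> cell_elt \<mu> s t) y = (\<Sum>x\<in>carrier H. kl h x * (\<Sum>w\<in>carrier H. hcoef H x w y * const (cell_coef \<mu> s t w)))"
  unfolding kl_mult[OF h HH_cell_elt[OF \<mu> st]] sum_distrib_left
  by (intro sum.cong refl) (simp add: kl_cell_elt[OF \<mu> st] mult_ac)

lemma sum_hcoef_cell_coef:
  assumes "s < d \<mu>"
  shows "(\<Sum>w\<in>carrier H. hcoef H x w y * const (cell_coef \<mu> s t w)) = (\<Sum>u<d \<mu>. const (\<beta> \<mu> t u) * \<Phi> \<mu> x y u s)"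
  unfolding cell_coef_def \<Phi>_def const_sum const_mult sum_distrib_left by (subst sum.swap) (simp only: mult_ac)

lemma kl_cell_difference:
  assumes \<mu>: "\<mu> \<in> \<Lambda>" and h: "h \<in> HH" and st: "s < d \<mu>" "t < d \<mu>" and y: "y \<in> carrier H"
    and v: "v \<in> block \<mu>"
    and nz: "kl (h \<star> cell_elt \<mu> s t - (\<Sum>s'<d \<mu>. smul (rep_coef \<mu> h s' s) (cell_elt \<mu> s' t))) y \<noteq> 0"
  shows "lr_le H y v \<and> \<not> lr_equiv H y v"
proof -
  have diff: "kl (h \<star> cell_elt \<mu> s t - (\<Sum>s'<d \<mu>. smul (rep_coef \<mu> h s' s) (cell_elt \<mu> s' t))) y =
      kl (h \<star> cell_elt \<mu> s t) y - (\<Sum>s'<d \<mu>. rep_coef \<mu> h s' s * const (cell_coef \<mu> s' t y))"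
  proof -
    define S where "S = (\<Sum>s'<d \<mu>. smul (rep_coef \<mu> h s' s) (cell_elt \<mu> s' t))"
    have S: "S \<in> HH" unfolding S_def using \<mu> h st by (auto intro!: HH_sum HH_smul HH_cell_elt rep_coef_A)
    have m: "h \<star> cell_elt \<mu> s t \<in> HH" by (rule HH_mult[OF h HH_cell_elt[OF \<mu> st]])
    have "kl_coords H (h \<star> cell_elt \<mu> s t - S) + kl_coords H S = kl_coords H (h \<star> cell_elt \<mu> s t)"
      using kl_coords_add[OF HH_diff[OF m S] S] by simp
    then have "kl (h \<star> cell_elt \<mu> s t - S) y = kl (h \<star> cell_elt \<mu> s t) y - kl S y"
      by (metis add_diff_cancel_right' lookup_minus)
    moreover have "kl S y = (\<Sum>s'<d \<mu>. rep_coef \<mu> h s' s * const (cell_coef \<mu> s' t y))"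
    proof -
      have "kl_coords H S = (\<Sum>s'<d \<mu>. kl_coords H (smul (rep_coef \<mu> h s' s) (cell_elt \<mu> s' t)))"
        unfolding S_def by (rule kl_coords_sum) (use \<mu> h st in \<open>auto intro!: HH_smul HH_cell_elt rep_coef_A\<close>)
      also have "\<dots> = (\<Sum>s'<d \<mu>. smul (rep_coef \<mu> h s' s) (kl_coords H (cell_elt \<mu> s' t)))"
        by (rule sum.cong[OF refl], rule kl_coords_smul) (use \<mu> h st in \<open>auto intro!: HH_cell_elt rep_coef_A\<close>)
      finally show ?thesis
        using \<mu> st y by (simp add: lookup_sum kl_cell_elt)
    qed
    ultimately show ?thesis by (simp add: S_def)
  qed
  have ne: "\<not> lr_equiv H y v"
  proof
    assume eqv: "lr_equiv H y v"
    have "kl (h \<star> cell_elt \<mu> s t) y = (\<Sum>x\<in>carrier H. kl h x * (\<Sum>u<d \<mu>. const (\<beta> \<mu> t u) *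
        (\<Sum>k<d \<mu>. const (cl \<mu> (inv y) u k) * \<rho>cell \<mu> x k s)))"
      unfolding kl_mult_cell_elt[OF \<mu> h st y] sum_hcoef_cell_coef[OF st(1)]
      by (intro sum.cong refl arg_cong2[where f = "(*)"]) (simp add: Phi_factor[OF \<mu> _ y v eqv _ st(1)])
    also have "\<dots> = (\<Sum>x\<in>carrier H. \<Sum>u<d \<mu>. \<Sum>k<d \<mu>.
        kl h x * \<rho>cell \<mu> x k s * (const (\<beta> \<mu> t u) * const (cl \<mu> (inv y) u k)))"
      unfolding sum_distrib_left by (intro sum.cong refl) (simp only: mult_ac)
    also have "\<dots> = (\<Sum>x\<in>carrier H. \<Sum>k<d \<mu>. \<Sum>u<d \<mu>.
        kl h x * \<rho>cell \<mu> x k s * (const (\<beta> \<mu> t u) * const (cl \<mu> (inv y) u k)))"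
      by (rule sum.cong[OF refl], rule sum.swap)
    also have "\<dots> = (\<Sum>k<d \<mu>. rep_coef \<mu> h k s * const (cell_coef \<mu> k t y))"
      unfolding rep_coef_def cell_coef_def const_sum const_mult sum_distrib_left sum_distrib_right
      by (subst sum.swap) (rule sum.cong[OF refl], rule sum.swap)
    finally show False using nz diff by simp
  qed
  have "(\<Sum>s'<d \<mu>. rep_coef \<mu> h s' s * const (cell_coef \<mu> s' t y)) = 0"
  proof (rule sum.neutral, rule ballI)
    fix s' assume "s' \<in> {..<d \<mu>}"
    then have "cell_coef \<mu> s' t y = 0"
      unfolding cell_coef_def using cl_inv_eq_0[OF \<mu> y v ne] by simp
    then show "rep_coef \<mu> h s' s * const (cell_coef \<mu> s' t y) = 0" by simp
  qed
  then have "kl (h \<star> cell_elt \<mu> s t) y \<noteq> 0" using nz diff by simp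
  then obtain x where x: "x \<in> carrier H" "kl h x * (\<Sum>w\<in>carrier H. hcoef H x w y * const (cell_coef \<mu> s t w)) \<noteq> 0"
    unfolding kl_mult_cell_elt[OF \<mu> h st y] by (rule sum.not_neutral_contains_not_neutral)
  then have "(\<Sum>w\<in>carrier H. hcoef H x w y * const (cell_coef \<mu> s t w)) \<noteq> 0" by auto
  then obtain w where w: "w \<in> carrier H" "hcoef H x w y * const (cell_coef \<mu> s t w) \<noteq> 0"
    by (rule sum.not_neutral_contains_not_neutral)
  then have "lr_le H y w" using lr_le_hcoef(1)[OF x(1) w(1) y] by auto
  moreover have "w \<in> block \<mu>"
    using w cell_coef_eq_0[OF \<mu> w(1) st(1), of t] by (intro in_block[OF \<mu> w(1)]) auto
  ultimately have "lr_le H y v"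
    using block_lr_equiv[OF \<mu> _ v] lr_le_trans unfolding lr_equiv_def by blast
  then show ?thesis using ne by blast
qed

lemma cell_relation:
  assumes \<mu>: "\<mu> \<in> \<Lambda>" and h: "h \<in> HH" and st: "s < d \<mu>" "t < d \<mu>"
  shows "h \<star> cell_elt \<mu> s t - (\<Sum>s'<d \<mu>. smul (rep_coef \<mu> h s' s) (cell_elt \<mu> s' t))
    \<in> hspan H {cell_elt \<nu> s'' t'' | \<nu> s'' t''. \<nu> \<in> \<Lambda> \<and> le\<Lambda> \<nu> \<mu> \<and> \<nu> \<noteq> \<mu> \<and> s'' \<in> {..<d \<nu>} \<and> t'' \<in> {..<d \<nu>}}"
proof -
  define \<Delta> where "\<Delta> = h \<star> cell_elt \<mu> s t - (\<Sum>s'<d \<mu>. smul (rep_coef \<mu> h s' s) (cell_elt \<mu> s' t))"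
  have \<Delta>: "\<Delta> \<in> HH"
    unfolding \<Delta>_def using \<mu> h st by (auto intro!: HH_diff HH_mult HH_sum HH_smul HH_cell_elt rep_coef_A)
  define I where "I = {x \<in> entries. le\<Lambda> (fst x) \<mu> \<and> fst x \<noteq> \<mu>}"
  define b where "b = (\<lambda>x. \<Sum>y\<in>carrier H. kl \<Delta> y * const (dual_fam x y))"
  have bA: "b x \<in> A" if "x \<in> entries" for x
    unfolding b_def using kl_A[OF \<Delta>] const_A[OF dual_fam_R0[OF that]] by (intro A_closed)
  have b0: "b x = 0" if x: "x \<in> entries" "x \<notin> I" for x
  proof (rule ccontr)
    assume "b x \<noteq> 0"
    then obtain y where y: "y \<in> carrier H" "kl \<Delta> y * const (dual_fam x y) \<noteq> 0"
      unfolding b_def by (rule sum.not_neutral_contains_not_neutral)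
    obtain \<nu> s' t' where x': "x = (\<nu>, s', t')" "\<nu> \<in> \<Lambda>" "s' < d \<nu>" "t' < d \<nu>" using x(1) by auto
    have "dual_coef \<nu> s' t' y \<noteq> 0" using y(2) by (auto simp: x' dual_fam_def)
    then have yb: "y \<in> block \<nu>"
      using dual_coef_neq_0[of \<nu> s' t' y] x' y(1) in_block by blast
    obtain v where v: "v \<in> block \<mu>" using block_nonempty[OF \<mu>] by blast
    have "kl \<Delta> y \<noteq> 0" using y(2) by auto
    then have yv: "lr_le H y v \<and> \<not> lr_equiv H y v"
      unfolding \<Delta>_def by (rule kl_cell_difference[OF \<mu> h st y(1) v])
    then have "le\<Lambda> \<nu> \<mu>" unfolding lambda_le_def using yb v by blast
    moreover have "\<nu> \<noteq> \<mu>" using yb v yv block_lr_equiv \<mu> by blast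
    ultimately show False using x x' by (simp add: I_def)
  qed
  have "\<Delta> = (\<Sum>x\<in>entries. smul (b x) (cell_fam x))"
    unfolding b_def by (rule cell_fam_expand[OF \<Delta>])
  also have "\<dots> = (\<Sum>x\<in>I. smul (b x) (cell_fam x))"
    by (rule sum.mono_neutral_right) (use finite_entries b0 in \<open>auto simp: I_def\<close>)
  also have "\<dots> \<in> hspan H (cell_fam ` I)"
    by (rule sum_in_hspan) (use bA in \<open>auto simp: I_def\<close>)
  also have "cell_fam ` I = {cell_elt \<nu> s'' t'' | \<nu> s'' t''. \<nu> \<in> \<Lambda> \<and> le\<Lambda> \<nu> \<mu> \<and> \<nu> \<noteq> \<mu> \<and> s'' \<in> {..<d \<nu>} \<and> t'' \<in> {..<d \<nu>}}"
    by (force simp: I_def cell_fam_def)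
  finally show ?thesis unfolding \<Delta>_def .
qed

theorem cell_datum_cell_elt: "cell_datum H \<Lambda> le\<Lambda> (\<lambda>\<mu>. {..<d \<mu>}) cell_elt star"
  unfolding cell_datum_def
proof (intro conjI ballI)
  show "partial_order_on \<Lambda> {(\<mu>, \<nu>). \<mu> \<in> \<Lambda> \<and> \<nu> \<in> \<Lambda> \<and> le\<Lambda> \<mu> \<nu>}"
    by (rule lambda_partial_order)
  show "inj_on (\<lambda>(\<mu>, s, t). cell_elt \<mu> s t) entries"
    using inj_cell_fam by (simp add: cell_fam_def)
  show "is_A_basis H ((\<lambda>(\<mu>, s, t). cell_elt \<mu> s t) ` entries)"
    using basis_cell_fam by (simp add: cell_fam_def)
  show "is_A_anti_involution H star" by (rule star_anti_involution)
  show "star (cell_elt \<mu> s t) = cell_elt \<mu> t s" if "\<mu> \<in> \<Lambda>" "s \<in> {..<d \<mu>}" "t \<in> {..<d \<mu>}" for \<mu> s t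
    using star_cell_elt that by simp
  fix \<mu> h assume \<mu>: "\<mu> \<in> \<Lambda>" and h: "h \<in> HH"
  show "\<exists>r. (\<forall>s'\<in>{..<d \<mu>}. \<forall>s\<in>{..<d \<mu>}. r s' s \<in> A) \<and>
      (\<forall>s\<in>{..<d \<mu>}. \<forall>t\<in>{..<d \<mu>}. h \<star> cell_elt \<mu> s t - (\<Sum>s'\<in>{..<d \<mu>}. smul (r s' s) (cell_elt \<mu> s' t))
        \<in> hspan H {cell_elt \<nu> s'' t'' | \<nu> s'' t''. \<nu> \<in> \<Lambda> \<and> le\<Lambda> \<nu> \<mu> \<and> \<nu> \<noteq> \<mu> \<and> s'' \<in> {..<d \<nu>} \<and> t'' \<in> {..<d \<nu>}})"
    using rep_coef_A[OF \<mu> h] cell_relation[OF \<mu> h]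
    by (intro exI[of _ "rep_coef \<mu> h"] conjI ballI) simp_all
qed simp

theorem cell_elt_eq_sum_block:
  assumes \<mu>: "\<mu> \<in> \<Lambda>" and st: "s < d \<mu>" "t < d \<mu>"
  shows "\<exists>z. (\<forall>w\<in>block \<mu>. z w \<in> ZWof H) \<and> cell_elt \<mu> s t = (\<Sum>w\<in>block \<mu>. smul (const (z w)) (KL w))"
proof (intro exI[of _ "cell_coef \<mu> s t"] conjI ballI)
  show "cell_coef \<mu> s t w \<in> ZWof H" if "w \<in> block \<mu>" for w
    using cell_coef_ZW[OF \<mu> _ st] block_subset[OF \<mu>] that by blast
  have "cell_coef \<mu> s t w = 0" if "w \<in> carrier H - block \<mu>" for w
    using cell_coef_eq_0[OF \<mu> _ st(1)] in_block[OF \<mu>] that by blast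
  then show "cell_elt \<mu> s t = (\<Sum>w\<in>block \<mu>. smul (const (cell_coef \<mu> s t w)) (KL w))"
    unfolding cell_elt_def using finite_W block_subset[OF \<mu>] by (intro sum.mono_neutral_right) auto
qed

end

theorem theorem5p5:
  fixes H :: "('w, 'g::linordered_ab_group_add) hecke_data"
    and \<Lambda> :: "'l set"
    and d :: "'l \<Rightarrow> nat"
    and E :: "'l \<Rightarrow> 'w \<Rightarrow> complex mat"
    and \<rho> :: "'l \<Rightarrow> 'w \<Rightarrow> ('g \<Rightarrow>\<^sub>0 complex) fract mat"
    and a :: "'l \<Rightarrow> 'g"
    and f :: "'l \<Rightarrow> real"
    and c :: "'l \<Rightarrow> 'w \<Rightarrow> complex mat"
    and B :: "'l \<Rightarrow> complex mat"
    and C :: "'l \<Rightarrow> nat \<Rightarrow> nat \<Rightarrow> ('w, 'g) hecke_elt"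
  assumes setting: "hecke_setting H"
    and splitting: "splitting_field H"
    and irreps: "irreps_indexed_by H \<Lambda> d E"
    and afforded: "\<And>\<mu>. \<mu> \<in> \<Lambda> \<Longrightarrow> afforded_by_specialisation H (d \<mu>) (E \<mu>) (\<rho> \<mu>)"
    and schur: "\<And>\<mu>. \<mu> \<in> \<Lambda> \<Longrightarrow> schur_invariants H (d \<mu>) (\<rho> \<mu>) (a \<mu>) (f \<mu>)"
    and good: "L_good H \<Lambda> f"
    and bal: "\<And>\<mu>. \<mu> \<in> \<Lambda> \<Longrightarrow> balanced H (d \<mu>) (a \<mu>) (\<rho> \<mu>)"
    and c_def: "c = (\<lambda>\<mu>. leading_matrix H (d \<mu>) (a \<mu>) (\<rho> \<mu>))"
    and P15: "P15_tilde H (gamma_tilde \<Lambda> d f c)"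
    and c_ZW: "\<And>\<mu> w. \<mu> \<in> \<Lambda> \<Longrightarrow> w \<in> carrier H \<Longrightarrow> c \<mu> w \<in> mats_over (ZWof H) (d \<mu>)"
    and B_ZW: "\<And>\<mu>. \<mu> \<in> \<Lambda> \<Longrightarrow> B \<mu> \<in> mats_over (ZWof H) (d \<mu>)"
    and B_pos: "\<And>\<mu>. \<mu> \<in> \<Lambda> \<Longrightarrow> sym_pos_def (d \<mu>) (B \<mu>)"
    and B_inv: "\<And>\<mu> w. \<mu> \<in> \<Lambda> \<Longrightarrow> w \<in> carrier H \<Longrightarrow>
                  B \<mu> * c \<mu> (inv\<^bsub>H\<^esub> w) = transpose_mat (c \<mu> w) * B \<mu>"
    and B_det: "\<And>\<mu>. \<mu> \<in> \<Lambda> \<Longrightarrow> \<exists>r\<in>coeffs H. det (B \<mu>) * r = 1"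
    and C_def: "C = (\<lambda>\<mu> s t. \<Sum>w\<in>carrier H. \<Sum>u<d \<mu>.
                  smul (Poly_Mapping.single 0 (B \<mu> $$ (t, u) * c \<mu> (inv\<^bsub>H\<^esub> w) $$ (u, s)))
                       (kl_basis H w))"
  shows "(\<forall>\<mu>\<in>\<Lambda>. \<forall>s<d \<mu>. \<forall>t<d \<mu>. \<exists>z.
            (\<forall>w\<in>block_of H \<Lambda> d c \<mu>. z w \<in> ZWof H) \<and>
            C \<mu> s t = (\<Sum>w\<in>block_of H \<Lambda> d c \<mu>. smul (Poly_Mapping.single 0 (z w)) (kl_basis H w))) \<and>
         cell_datum H \<Lambda> (lambda_le H \<Lambda> d c) (\<lambda>\<mu>. {..<d \<mu>}) C (hecke_star H)"
proof -
  interpret cellular_setup H \<Lambda> d E \<rho> a f c B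
    by unfold_locales (fact setting splitting irreps afforded schur bal c_def good P15 c_ZW B_ZW B_pos B_inv B_det)+
  have "C = cell_elt"
    unfolding C_def cell_elt_def cell_coef_def \<beta>_def cl_def const_sum smul_sum_left ..
  then show ?thesis
    using cell_elt_eq_sum_block cell_datum_cell_elt by simp
qed

end
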